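(* Assume conditions $(\mathbf u_\sigma)$ and $(\mathbf{fg})$. Let $(x^0,u^0)\in C_{loc}(\mathbb T,\mathbb X)\times\mathfrak U$ be a uniformly overtaking optimal pair satisfying condition $(\psi)$. Then for each unbounded increasing sequence $(\tau_n)_{n\in\mathbb N}$ in $\mathbb T$ there exists $(x^0,u^0,\lambda^0,\psi^0)$ (with this $x^0,u^0$) satisfying all relations of the Maximum Principle, i.e. $(x^0,u^0,\lambda^0,\psi^0)\in\mathfrak Z$, and the transversality condition $$\liminf_{n\to\infty}\|\psi^0(\tau_n)\|_{\mathbb X}=0.$$
   Context: Notation. $\mathbb T=\mathbb R_{\ge0}$, $\mathbb X=\mathbb R^m$, $\mathbb U$ is a finite-dimensional Euclidean space, $U:\mathbb T\rightsquigarrow\mathbb U$ is a set-valued map with graph $\mathrm{Gr}\,U$, and $\mathfrak U$ is the set of all Borel measurable selectors of $U$. $C_{loc}(\mathbb T,E)$ is the set of continuous functions $\mathbb T\to E$ with the compact-open topology; $\|\cdot\|_C$ is the supremum norm on $\mathbb T$. $\mathcal L^1_{loc}(\mathbb T,\mathbb T)$ is the set of nonnegative locally summable functions on $\mathbb T$. A function $a:\mathbb T\times E'\times\mathbb U\to E''$ is called: (1) Carathéodory if $a(\cdot,y,u)$ is measurable for all $y\in E'$ and all $u$ belonging to some $U(t)$, and $a(t,\cdot,\cdot):E'\times U(t)\to E''$ is continuous for all $t\in\mathbb T$; (2) locally Lipschitz continuous if for each compact $K\subset\mathbb T\times E'$ there is $L^a_K\in\mathcal L^1_{loc}(\mathbb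 T,\mathbb T)$ with $\|a(t,x',u)-a(t,x'',u)\|\le L^a_K(t)\|x'-x''\|$ for all $(t,x'),(t,x'')\in K$, $u\in U(t)$; (3) integrally bounded (on each compact subset) if for each compact $K\subset\mathbb T\times E'$ there is $M^a_K\in\mathcal L^1_{loc}(\mathbb T,\mathbb T)$ with $\|a(t,x,u)\|\le M^a_K(t)$ for all $(t,x)\in K$, $u\in U(t)$; (4) satisfying the continuability condition if it is locally Lipschitz continuous with $L^a_K$ independent of $K$ and it is integrally bounded on each compact subset. Condition $(\mathbf u_\sigma)$: $U$ is $\sigma$-compact-valued and $\mathrm{Gr}\,U$ is a Borel subset of $\mathbb T\times\mathbb U$. Together with it, it is assumed that there is a fixed nondecreasing sequence $(U^{(r)})_{r\in\mathbb N}$ of compact-valued maps $\mathbb T\rightsquigarrow\mathbb U$ with Borel graphs, each integrally bounded on each compact subset of $\mathbb T$ (norms of elements of $U^{(r)}(t)$ are dominated by a locally summable function of $t$), such that $U(t)=\bigcup_rU^{(r)}(t)$ for all $t$, and that $u^0(t)\in U^{(1)}(t)$ for all $t$. Condition $(\mathbf{fg})$: $f:\mathbb T\times\mathbb X\times\mathbb U\to\mathbb X$ and $g:\mathbb T\times\mathbb X\times\mathbb U\to\mathbb R$ are locally Lipschitz continuous Carathéodory maps, integrally bounded on each compact subset, and $f$ satisfies the continuability condition. Condition $(\boldsymbol\partial)$ (standing assumption in this part of the paper): $f$ and $g$ have partial derivatives in $x$ that are locally Lipschitz continuous Carathéodory maps, integrally bounded on each compact subset. For $u\in\mathfrak U$,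 $\varphi[u]$ is the unique solution on $\mathbb T$ of $\dot x=f(t,x,u(t))$, $x(0)=0$, and $J_T(u)=\int_0^Tg(t,\varphi[u](t),u(t))\,dt$. A control $u^0\in\mathfrak U$ is uniformly overtaking optimal if for each $\varepsilon>0$ there is $T>0$ such that $J_t(u^0)\ge J_t(u)-\varepsilon$ for all $u\in\mathfrak U$, $t\ge T$; the pair $(x^0,u^0)$ is then called uniformly overtaking optimal, where $x^0=\varphi[u^0]$. Maximum Principle. $\mathcal H(x,t,u,\lambda,\psi)=\psi f(t,x,u)+\lambda g(t,x,u)$ ($\psi$ a row vector); $\partial_x$ is the Clarke generalized gradient in $x$. $\mathfrak Z$ is the set of $(x,u,\lambda,\psi)\in C_{loc}(\mathbb T,\mathbb X)\times\mathfrak U\times[0,1]\times C_{loc}(\mathbb T,\mathbb X)$ ($x,\psi$ locally absolutely continuous) with $x(0)=0$, $\|\psi(0)\|_{\mathbb X}+\lambda=1$ and, a.e. on $\mathbb T$: $\dot x=f(t,x,u(t))$, $\dot\psi\in-\partial_x\mathcal H(x(t),t,u(t),\lambda,\psi(t))$, $\sup_{p\in U(t)}\mathcal H(x(t),t,p,\lambda,\psi(t))=\mathcal H(x(t),t,u(t),\lambda,\psi(t))$ (the relations of the Maximum Principle). Generalized controls. $\widetilde{\mathfrak U}^{(r)}_n$ is the set of weakly measurable maps $\mu$ from $[0,n]$ to the Radon probability measures on $\mathbb U$ with $\mu(t)(U^{(r)}(t))=1$ for a.a. $t\in[0,n]$. $\widetilde{\mathfrak U}$ is the set of maps $\eta$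 from $\mathbb T$ to the Radon probability measures on $\mathbb U$ such that for every $n\in\mathbb N$ there is $r\in\mathbb N$ with $\eta|_{[0,n]}\in\widetilde{\mathfrak U}^{(r)}_n$; $\widetilde{\mathfrak U}$ is given the indiscrete topology. $\widetilde u^0\in\widetilde{\mathfrak U}$ is given by $\widetilde u^0(t)=$ Dirac measure at $u^0(t)$. $\widetilde{\mathfrak Y}$ is the set of $(x,\eta,\lambda,\psi)\in C_{loc}(\mathbb T,\mathbb X)\times\widetilde{\mathfrak U}\times[0,1]\times C_{loc}(\mathbb T,\mathbb X)$ with $x(0)=0$, $\|\psi(0)\|_{\mathbb X}+\lambda=1$ and, a.e. on $\mathbb T$, $\dot x(t)=\int_{U(t)}f(t,x(t),u)\,\eta(t)(du)$, $\dot\psi(t)\in-\int_{U(t)}\partial_x\mathcal H(x(t),t,u,\lambda,\psi(t))\,\eta(t)(du)$ (integral of a set-valued map). Weights. For an integrally bounded Carathéodory map $w:\mathbb T\times\mathbb U\to\mathbb T$ put $\mathfrak L_w[\eta](\tau)=\int_0^\tau\int_{U(t)}w(t,u)\,\eta(t)(du)\,dt$. $(Fin)(u^0)$ is the set of $\eta\in\widetilde{\mathfrak U}$ with $\eta|_{[T,\infty)}=\widetilde u^0|_{[T,\infty)}$ for some $T\in\mathbb T$. $(Null)(u^0)$ is the set of such $w$ with $\mathfrak L_w[\widetilde u^0]\equiv0$ and such that for every $\eta\in(Fin)(u^0)$ and $\tau\in\mathbb T$, $\mathfrak L_w[\eta](\tau)=0$ implies $\eta=\widetilde u^0$ a.e.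 on $[0,\tau]$. Condition $(\psi)$ for $(x^0,u^0)$: there exists $w\in(Null)(u^0)$ such that for every $(x^0,u^0,\lambda^0,\psi^0)\in\mathfrak Z$ and every $\varepsilon>0$ there exist $\delta>0$ and a neighborhood $\Upsilon\subset C_{loc}(\mathbb T,\mathbb X)\times\widetilde{\mathfrak U}\times[0,1]\times C_{loc}(\mathbb T,\mathbb X)$ of $(x^0,\widetilde u^0,\lambda^0,\psi^0)$ such that every $(x,\eta,\lambda,\psi)\in\Upsilon\cap\widetilde{\mathfrak Y}$ with $\|\mathfrak L_w[\eta]\|_C<\delta$ satisfies $\|\psi-\psi^0\|_C<\varepsilon$.
   Formalization: Besides the Carathéodory condition, f, g and the weight w are assumed measurable in t along every selector of U (for f and g with x fixed); without this the claim fails, e.g. U(t)={t}, f=g=x·1_N(t)·1_{u=t}, where N and its complement have full outer measure. *)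

theory Defs
  imports "HOL-Probability.Probability"
begin

(* Time is the half-line {0..}; a map on it is a function on all reals whose values at negative
   arguments are never used. *)

definition loc_summable :: "(real \<Rightarrow> real) set" where
  "loc_summable = {L. (\<forall>t\<ge>0. 0 \<le> L t) \<and> (\<forall>b\<ge>0. set_integrable lebesgue {0..b} L)}"

definition loc_abs_continuous :: "(real \<Rightarrow> 'e::real_normed_vector) \<Rightarrow> bool" where
  "loc_abs_continuous x \<longleftrightarrow>
     (\<forall>b\<ge>0. \<forall>\<epsilon>>0. \<exists>\<delta>>0. \<forall>D.
        finite D \<and> (\<forall>(s, t)\<in>D. 0 \<le> s \<and> s \<le> t \<and> t \<le> b) \<and>
        pairwise (\<lambda>(s, t) (s', t'). {s<..<t} \<inter> {s'<..<t'} = {}) D \<and>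
        (\<Sum>(s, t)\<in>D. t - s) < \<delta> \<longrightarrow>
        (\<Sum>(s, t)\<in>D. norm (x t - x s)) < \<epsilon>)"

(* Extended-real valued, since a continuous function on {0..} may be unbounded. *)
definition sup_norm :: "(real \<Rightarrow> 'e::real_normed_vector) \<Rightarrow> ereal" where
  "sup_norm x = (SUP t\<in>{0..}. ereal (norm (x t)))"

definition compact_open_topology :: "(real \<Rightarrow> 'e::topological_space) topology" where
  "compact_open_topology = topology_generated_by
     {{x. continuous_on {0..} x \<and> x ` K \<subseteq> V} | K V. compact K \<and> K \<subseteq> {0..} \<and> open V}"

definition indiscrete_topology :: "'c set \<Rightarrow> 'c topology" where
  "indiscrete_topology S = topology_generated_by {S}"

definition selectors :: "(real \<Rightarrow> 'u::euclidean_space set) \<Rightarrow> (real \<Rightarrow> 'u) set" where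
  "selectors U = {u. u \<in> borel_measurable (restrict_space borel {0..}) \<and> (\<forall>t\<ge>0. u t \<in> U t)}"

definition graph :: "(real \<Rightarrow> 'u set) \<Rightarrow> (real \<times> 'u) set" where
  "graph U = {(t, u). 0 \<le> t \<and> u \<in> U t}"

definition caratheodory ::
  "(real \<Rightarrow> 'u::euclidean_space set) \<Rightarrow>
   (real \<Rightarrow> 'y::real_normed_vector \<Rightarrow> 'u \<Rightarrow> 'e::real_normed_vector) \<Rightarrow> bool" where
  "caratheodory U a \<longleftrightarrow>
     (\<forall>y. \<forall>u\<in>(\<Union>t\<in>{0..}. U t). (\<lambda>t. a t y u) \<in> borel_measurable (lebesgue_on {0..})) \<and>
     (\<forall>t\<ge>0. continuous_on (UNIV \<times> U t) (\<lambda>(y, u). a t y u))"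

(* If U is not constant, the Caratheodory property does not make a t y (v t) measurable in t for a
   selector v: take U t = {t} and a t y u = (if u = t \<and> t \<in> N then 1 else 0) with N not
   measurable. It is required separately, for the integrands that are evaluated along controls. *)
definition superposition_measurable ::
  "(real \<Rightarrow> 'u::euclidean_space set) \<Rightarrow>
   (real \<Rightarrow> 'y::real_normed_vector \<Rightarrow> 'u \<Rightarrow> 'e::real_normed_vector) \<Rightarrow> bool" where
  "superposition_measurable U a \<longleftrightarrow>
     (\<forall>y. \<forall>v\<in>selectors U. (\<lambda>t. a t y (v t)) \<in> borel_measurable (lebesgue_on {0..}))"

definition lipschitz_bound ::
  "(real \<Rightarrow> 'u set) \<Rightarrow> (real \<Rightarrow> 'y::real_normed_vector \<Rightarrow> 'u \<Rightarrow> 'e::real_normed_vector) \<Rightarrow>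
   (real \<times> 'y) set \<Rightarrow> (real \<Rightarrow> real) \<Rightarrow> bool" where
  "lipschitz_bound U a K L \<longleftrightarrow>
     (\<forall>t x' x''. \<forall>u\<in>U t. (t, x') \<in> K \<longrightarrow> (t, x'') \<in> K \<longrightarrow>
        norm (a t x' u - a t x'' u) \<le> L t * norm (x' - x''))"

definition locally_lipschitz ::
  "(real \<Rightarrow> 'u set) \<Rightarrow> (real \<Rightarrow> 'y::real_normed_vector \<Rightarrow> 'u \<Rightarrow> 'e::real_normed_vector) \<Rightarrow> bool" where
  "locally_lipschitz U a \<longleftrightarrow>
     (\<forall>K. compact K \<and> K \<subseteq> {0..} \<times> UNIV \<longrightarrow> (\<exists>L\<in>loc_summable. lipschitz_bound U a K L))"

definition integrally_bounded ::
  "(real \<Rightarrow> 'u set) \<Rightarrow> (real \<Rightarrow> 'y::real_normed_vector \<Rightarrow> 'u \<Rightarrow> 'e::real_normed_vector) \<Rightarrow> bool" where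
  "integrally_bounded U a \<longleftrightarrow>
     (\<forall>K. compact K \<and> K \<subseteq> {0..} \<times> UNIV \<longrightarrow>
        (\<exists>M\<in>loc_summable. \<forall>(t, x)\<in>K. \<forall>u\<in>U t. norm (a t x u) \<le> M t))"

definition continuable ::
  "(real \<Rightarrow> 'u set) \<Rightarrow> (real \<Rightarrow> 'y::real_normed_vector \<Rightarrow> 'u \<Rightarrow> 'e::real_normed_vector) \<Rightarrow> bool" where
  "continuable U a \<longleftrightarrow>
     (\<exists>L\<in>loc_summable. \<forall>K. compact K \<and> K \<subseteq> {0..} \<times> UNIV \<longrightarrow> lipschitz_bound U a K L) \<and>
     integrally_bounded U a"

definition cond_u_sigma ::
  "(real \<Rightarrow> 'u::euclidean_space set) \<Rightarrow> (nat \<Rightarrow> real \<Rightarrow> 'u set) \<Rightarrow> bool" where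
  "cond_u_sigma U Ur \<longleftrightarrow>
     (\<forall>t\<ge>0. \<exists>C :: nat \<Rightarrow> 'u set. (\<forall>i. compact (C i)) \<and> U t = (\<Union>i. C i)) \<and>
     graph U \<in> sets borel \<and>
     (\<forall>r. \<forall>t\<ge>0. Ur r t \<subseteq> Ur (Suc r) t) \<and>
     (\<forall>r. \<forall>t\<ge>0. compact (Ur r t)) \<and>
     (\<forall>r. graph (Ur r) \<in> sets borel) \<and>
     (\<forall>r K. compact K \<and> K \<subseteq> {0..} \<longrightarrow>
        (\<exists>M\<in>loc_summable. \<forall>t\<in>K. \<forall>u\<in>Ur r t. norm u \<le> M t)) \<and>
     (\<forall>t\<ge>0. U t = (\<Union>r. Ur r t))"

definition cond_fg ::
  "(real \<Rightarrow> 'u::euclidean_space set) \<Rightarrow> (real \<Rightarrow> 'x::euclidean_space \<Rightarrow> 'u \<Rightarrow> 'x) \<Rightarrow>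
   (real \<Rightarrow> 'x \<Rightarrow> 'u \<Rightarrow> real) \<Rightarrow> bool" where
  "cond_fg U f g \<longleftrightarrow>
     caratheodory U f \<and> superposition_measurable U f \<and>
     locally_lipschitz U f \<and> integrally_bounded U f \<and> continuable U f \<and>
     caratheodory U g \<and> superposition_measurable U g \<and>
     locally_lipschitz U g \<and> integrally_bounded U g"

definition regular_derivative ::
  "(real \<Rightarrow> 'u::euclidean_space set) \<Rightarrow>
   (real \<Rightarrow> 'x::euclidean_space \<Rightarrow> 'u \<Rightarrow> 'e::euclidean_space) \<Rightarrow> bool" where
  "regular_derivative U a \<longleftrightarrow>
     (\<exists>a' :: real \<Rightarrow> 'x \<Rightarrow> 'u \<Rightarrow> 'x \<Rightarrow>\<^sub>L 'e.
        (\<forall>t\<ge>0. \<forall>x. \<forall>u\<in>U t. ((\<lambda>y. a t y u) has_derivative blinfun_apply (a' t x u)) (at x)) \<and>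
        caratheodory U a' \<and> locally_lipschitz U a' \<and> integrally_bounded U a')"

definition cond_partial ::
  "(real \<Rightarrow> 'u::euclidean_space set) \<Rightarrow> (real \<Rightarrow> 'x::euclidean_space \<Rightarrow> 'u \<Rightarrow> 'x) \<Rightarrow>
   (real \<Rightarrow> 'x \<Rightarrow> 'u \<Rightarrow> real) \<Rightarrow> bool" where
  "cond_partial U f g \<longleftrightarrow> regular_derivative U f \<and> regular_derivative U g"

definition trajectory ::
  "(real \<Rightarrow> 'x::euclidean_space \<Rightarrow> 'u \<Rightarrow> 'x) \<Rightarrow> (real \<Rightarrow> 'u) \<Rightarrow> (real \<Rightarrow> 'x) \<Rightarrow> bool" where
  "trajectory f u x \<longleftrightarrow> loc_abs_continuous x \<and> x 0 = 0 \<and>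
     (AE t in lebesgue_on {0..}. (x has_vector_derivative f t (x t) (u t)) (at t within {0..}))"

definition payoff ::
  "(real \<Rightarrow> 'x \<Rightarrow> 'u \<Rightarrow> real) \<Rightarrow> (real \<Rightarrow> 'x) \<Rightarrow> (real \<Rightarrow> 'u) \<Rightarrow> real \<Rightarrow> real" where
  "payoff g x u T = (LINT t:{0..T}|lebesgue. g t (x t) (u t))"

(* The trajectory of a control is unique on {0..} (though not at negative arguments), so it is
   referred to by quantifying over the solutions. *)
definition unif_overtaking_optimal ::
  "(real \<Rightarrow> 'u::euclidean_space set) \<Rightarrow> (real \<Rightarrow> 'x::euclidean_space \<Rightarrow> 'u \<Rightarrow> 'x) \<Rightarrow>
   (real \<Rightarrow> 'x \<Rightarrow> 'u \<Rightarrow> real) \<Rightarrow> (real \<Rightarrow> 'x) \<Rightarrow> (real \<Rightarrow> 'u) \<Rightarrow> bool" where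
  "unif_overtaking_optimal U f g x0 u0 \<longleftrightarrow>
     u0 \<in> selectors U \<and> trajectory f u0 x0 \<and>
     (\<forall>\<epsilon>>0. \<exists>T>0. \<forall>u\<in>selectors U. \<forall>x. trajectory f u x \<longrightarrow>
        (\<forall>t\<ge>T. payoff g x0 u0 t \<ge> payoff g x u t - \<epsilon>))"

definition hamiltonian ::
  "(real \<Rightarrow> 'x::euclidean_space \<Rightarrow> 'u \<Rightarrow> 'x) \<Rightarrow> (real \<Rightarrow> 'x \<Rightarrow> 'u \<Rightarrow> real) \<Rightarrow>
   'x \<Rightarrow> real \<Rightarrow> 'u \<Rightarrow> real \<Rightarrow> 'x \<Rightarrow> real" where
  "hamiltonian f g x t u l p = p \<bullet> f t x u + l * g t x u"

definition clarke_dderiv :: "('x::euclidean_space \<Rightarrow> real) \<Rightarrow> 'x \<Rightarrow> 'x \<Rightarrow> ereal" where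
  "clarke_dderiv h x v =
     Limsup (nhds x \<times>\<^sub>F at_right 0) (\<lambda>(y, s). ereal ((h (y + s *\<^sub>R v) - h y) / s))"

definition clarke_gradient :: "('x::euclidean_space \<Rightarrow> real) \<Rightarrow> 'x \<Rightarrow> 'x set" where
  "clarke_gradient h x = {\<zeta>. \<forall>v. ereal (\<zeta> \<bullet> v) \<le> clarke_dderiv h x v}"

definition extremals ::
  "(real \<Rightarrow> 'u::euclidean_space set) \<Rightarrow> (real \<Rightarrow> 'x::euclidean_space \<Rightarrow> 'u \<Rightarrow> 'x) \<Rightarrow>
   (real \<Rightarrow> 'x \<Rightarrow> 'u \<Rightarrow> real) \<Rightarrow>
   ((real \<Rightarrow> 'x) \<times> (real \<Rightarrow> 'u) \<times> real \<times> (real \<Rightarrow> 'x)) set" where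
  "extremals U f g = {(x, u, l, \<psi>).
     continuous_on {0..} x \<and> u \<in> selectors U \<and> l \<in> {0..1} \<and> continuous_on {0..} \<psi> \<and>
     loc_abs_continuous x \<and> loc_abs_continuous \<psi> \<and>
     x 0 = 0 \<and> norm (\<psi> 0) + l = 1 \<and>
     (AE t in lebesgue_on {0..}.
        (x has_vector_derivative f t (x t) (u t)) (at t within {0..}) \<and>
        (\<exists>d. (\<psi> has_vector_derivative d) (at t within {0..}) \<and>
             d \<in> uminus ` clarke_gradient (\<lambda>y. hamiltonian f g y t (u t) l (\<psi> t)) (x t)) \<and>
        (SUP p\<in>U t. ereal (hamiltonian f g (x t) t p l (\<psi> t))) =
          ereal (hamiltonian f g (x t) t (u t) l (\<psi> t)))}"

(* Finite Borel measures on a Euclidean space are Radon. *)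
definition gen_controls_upto ::
  "(nat \<Rightarrow> real \<Rightarrow> 'u::euclidean_space set) \<Rightarrow> nat \<Rightarrow> nat \<Rightarrow> (real \<Rightarrow> 'u measure) set" where
  "gen_controls_upto Ur r n = {\<mu>.
     (\<forall>t\<in>{0..real n}. prob_space (\<mu> t) \<and> sets (\<mu> t) = sets borel) \<and>
     (\<forall>\<phi> :: 'u \<Rightarrow> real. continuous_on UNIV \<phi> \<and> bounded (range \<phi>) \<longrightarrow>
        (\<lambda>t. LINT u|\<mu> t. \<phi> u) \<in> borel_measurable (lebesgue_on {0..real n})) \<and>
     (AE t in lebesgue_on {0..real n}. measure (\<mu> t) (Ur r t) = 1)}"

definition gen_controls ::
  "(nat \<Rightarrow> real \<Rightarrow> 'u::euclidean_space set) \<Rightarrow> (real \<Rightarrow> 'u measure) set" where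
  "gen_controls Ur = {\<eta>. \<forall>n. \<exists>r. \<eta> \<in> gen_controls_upto Ur r n}"

definition dirac_control :: "(real \<Rightarrow> 'u::euclidean_space) \<Rightarrow> real \<Rightarrow> 'u measure" where
  "dirac_control u t = return borel (u t)"

definition aumann_integral ::
  "'u measure \<Rightarrow> ('u \<Rightarrow> 'x::euclidean_space set) \<Rightarrow> 'x set" where
  "aumann_integral M F = {LINT u|M. h u | h. integrable M h \<and> (AE u in M. h u \<in> F u)}"

definition gen_extremals ::
  "(real \<Rightarrow> 'u::euclidean_space set) \<Rightarrow> (nat \<Rightarrow> real \<Rightarrow> 'u set) \<Rightarrow>
   (real \<Rightarrow> 'x::euclidean_space \<Rightarrow> 'u \<Rightarrow> 'x) \<Rightarrow> (real \<Rightarrow> 'x \<Rightarrow> 'u \<Rightarrow> real) \<Rightarrow>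
   ((real \<Rightarrow> 'x) \<times> (real \<Rightarrow> 'u measure) \<times> real \<times> (real \<Rightarrow> 'x)) set" where
  "gen_extremals U Ur f g = {(x, \<eta>, l, \<psi>).
     continuous_on {0..} x \<and> \<eta> \<in> gen_controls Ur \<and> l \<in> {0..1} \<and> continuous_on {0..} \<psi> \<and>
     loc_abs_continuous x \<and> loc_abs_continuous \<psi> \<and>
     x 0 = 0 \<and> norm (\<psi> 0) + l = 1 \<and>
     (AE t in lebesgue_on {0..}.
        (x has_vector_derivative (LINT u:U t|\<eta> t. f t (x t) u)) (at t within {0..}) \<and>
        (\<exists>d. (\<psi> has_vector_derivative d) (at t within {0..}) \<and>
             d \<in> uminus ` aumann_integral (restrict_space (\<eta> t) (U t))
               (\<lambda>u. clarke_gradient (\<lambda>y. hamiltonian f g y t u l (\<psi> t)) (x t))))}"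

definition extremal_topology ::
  "(nat \<Rightarrow> real \<Rightarrow> 'u::euclidean_space set) \<Rightarrow>
   ((real \<Rightarrow> 'x::euclidean_space) \<times> (real \<Rightarrow> 'u measure) \<times> real \<times> (real \<Rightarrow> 'x)) topology" where
  "extremal_topology Ur =
     prod_topology compact_open_topology
       (prod_topology (indiscrete_topology (gen_controls Ur))
         (prod_topology (top_of_set {0..1}) compact_open_topology))"

definition weight_integral ::
  "(real \<Rightarrow> 'u::euclidean_space set) \<Rightarrow> (real \<Rightarrow> 'u \<Rightarrow> real) \<Rightarrow> (real \<Rightarrow> 'u measure) \<Rightarrow>
   real \<Rightarrow> real" where
  "weight_integral U w \<eta> \<tau> = (LINT t:{0..\<tau>}|lebesgue. (LINT u:U t|\<eta> t. w t u))"

definition fin_controls ::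
  "(nat \<Rightarrow> real \<Rightarrow> 'u::euclidean_space set) \<Rightarrow> (real \<Rightarrow> 'u) \<Rightarrow> (real \<Rightarrow> 'u measure) set" where
  "fin_controls Ur u0 = {\<eta>\<in>gen_controls Ur. \<exists>T\<ge>0. \<forall>t\<ge>T. \<eta> t = dirac_control u0 t}"

(* A weight is a map without state argument: it is passed to the notions above as one that is
   constant in a dummy real state. *)
definition null_weights ::
  "(real \<Rightarrow> 'u::euclidean_space set) \<Rightarrow> (nat \<Rightarrow> real \<Rightarrow> 'u set) \<Rightarrow> (real \<Rightarrow> 'u) \<Rightarrow>
   (real \<Rightarrow> 'u \<Rightarrow> real) set" where
  "null_weights U Ur u0 = {w.
     (\<forall>t\<ge>0. \<forall>u. 0 \<le> w t u) \<and>
     caratheodory U (\<lambda>t (_::real) u. w t u) \<and>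
     superposition_measurable U (\<lambda>t (_::real) u. w t u) \<and>
     integrally_bounded U (\<lambda>t (_::real) u. w t u) \<and>
     (\<forall>\<tau>\<ge>0. weight_integral U w (dirac_control u0) \<tau> = 0) \<and>
     (\<forall>\<eta>\<in>fin_controls Ur u0. \<forall>\<tau>\<ge>0. weight_integral U w \<eta> \<tau> = 0 \<longrightarrow>
        (AE t in lebesgue_on {0..\<tau>}. \<eta> t = dirac_control u0 t))}"

definition cond_psi ::
  "(real \<Rightarrow> 'u::euclidean_space set) \<Rightarrow> (nat \<Rightarrow> real \<Rightarrow> 'u set) \<Rightarrow>
   (real \<Rightarrow> 'x::euclidean_space \<Rightarrow> 'u \<Rightarrow> 'x) \<Rightarrow> (real \<Rightarrow> 'x \<Rightarrow> 'u \<Rightarrow> real) \<Rightarrow>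
   (real \<Rightarrow> 'x) \<Rightarrow> (real \<Rightarrow> 'u) \<Rightarrow> bool" where
  "cond_psi U Ur f g x0 u0 \<longleftrightarrow>
     (\<exists>w\<in>null_weights U Ur u0. \<forall>l0 \<psi>0. (x0, u0, l0, \<psi>0) \<in> extremals U f g \<longrightarrow>
        (\<forall>\<epsilon>>0. \<exists>\<delta>>0. \<exists>\<Upsilon>. openin (extremal_topology Ur) \<Upsilon> \<and>
           (x0, dirac_control u0, l0, \<psi>0) \<in> \<Upsilon> \<and>
           (\<forall>(x, \<eta>, l, \<psi>)\<in>\<Upsilon> \<inter> gen_extremals U Ur f g.
              sup_norm (weight_integral U w \<eta>) < ereal \<delta> \<longrightarrow>
              sup_norm (\<lambda>t. \<psi> t - \<psi>0 t) < ereal \<epsilon>)))"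

end

theory Submission
  imports Defs
begin

text \<open>If the control \<open>u0\<close> were optimal on the finite horizon \<open>[0, \<tau>\<^sub>n]\<close>, then the Maximum Principle would hold
with an adjoint arc that vanishes at \<open>\<tau>\<^sub>n\<close>. Uniform overtaking optimality says only that \<open>u0\<close> is optimal on
\<open>[0, \<tau>\<^sub>n]\<close> up to errors that tend to zero. The penalty method of Ekeland's variational principle repairs
this: among the controls that return to \<open>u0\<close> after \<open>\<tau>\<^sub>n\<close>, the payoff minus \<open>\<delta>\<close> times the distance from
\<open>u0\<close> is maximized up to a tiny error. If \<open>u0\<close> is optimal up to \<open>\<delta>\<^sup>2\<close>, the resulting control \<open>u\<^sub>n\<close> has distance at
most \<open>2 \<delta>\<close> from \<open>u0\<close>. The distance is the measure, with a locally integrable density \<open>R\<close>, of the set on which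
the controls differ. The first-order formula for the payoff has an error that is quadratic in this
distance, so comparison with modifications on small sets of times shows that \<open>u\<^sub>n\<close>, with the adjoint
arc \<open>\<psi>\<^sub>n\<close> that vanishes at \<open>\<tau>\<^sub>n\<close>, satisfies an integrated maximum condition up to an error of order \<open>\<delta>\<close>
(\<open>near_maximizer_maximum_principle\<close>).

The density \<open>R\<close> dominates the dynamics, the payoff, their derivatives and the weight \<open>w\<close>. As \<open>\<delta> \<rightarrow> 0\<close>, the states
\<open>x\<^sub>n\<close> therefore converge to \<open>x0\<close> locally uniformly, the weight integrals of the Dirac controls of \<open>u\<^sub>n\<close>
converge to zero uniformly on the half-line, and the normalized arcs \<open>\<psi>\<^sub>n\<close> converge locally uniformly,
along a subsequence, to an adjoint arc \<open>\<psi>0\<close> along \<open>x0\<close> and \<open>u0\<close> that inherits the maximum condition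
(\<open>limit_convergence\<close>, \<open>limit_maximum_condition\<close>). The limit is thus an extremal. As generalized extremals
are subject to no maximum condition, the Dirac control of \<open>u\<^sub>n\<close> with \<open>x\<^sub>n\<close> and \<open>\<psi>\<^sub>n\<close> is one, and the
stability condition at the limit turns locally uniform into uniform convergence. Hence \<open>\<psi>0\<close> is
uniformly close to an arc that vanishes at \<open>\<tau>\<^sub>n\<close>, so \<open>\<psi>0\<close> is small at \<open>\<tau>\<^sub>n\<close>.

The limiting argument compares \<open>u0\<close> with measurable selectors only. To reach every control value at
almost every time, countably many selectors are needed that are dense in the control sets
(\<open>dense_selectors\<close>). Their existence rests on the measurability of projections of Borel sets, which
follows from Choquet's capacity argument (\<open>compact_capacity_of_projection\<close>). The equations are solved
and estimated in integral form (\<open>caratheodory_ode_solution\<close>, \<open>gronwall\<close>); the translation from almost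
everywhere derivatives is the fundamental theorem of calculus for absolutely continuous functions
(\<open>loc_abs_continuous_FTC\<close>).\<close>

section \<open>Analytic sets and dense measurable selectors\<close>

lemma tendsto_funI:
  fixes f :: "nat \<Rightarrow> 'a \<Rightarrow> 'b::topological_space"
  assumes "\<And>i. (\<lambda>n. f n i) \<longlonglongrightarrow> l i"
  shows "f \<longlonglongrightarrow> l"
proof -
  have "limitin (product_topology (\<lambda>_. euclidean) UNIV) f l sequentially"
    using assms by (simp add: limitin_componentwise)
  then show ?thesis by (simp add: euclidean_product_topology)
qed

text \<open>Souslin's analytic sets. The Baire space of integer sequences is replaced with the sequences of
nonnegative reals, which form a metric space: compact sets of them are sequentially compact.\<close>

definition analytic :: "'a::topological_space set \<Rightarrow> bool" where
  "analytic B \<longleftrightarrow> (\<exists>C :: ('a \<times> (nat \<Rightarrow> real)) set.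
     closed C \<and> (\<forall>(x, z)\<in>C. \<forall>i. 0 \<le> z i) \<and> B = fst ` C)"

lemma closed_nonneg_sequences: "closed {z :: nat \<Rightarrow> real. \<forall>i. 0 \<le> z i}"
proof -
  have "closed (\<Inter>i. {z :: nat \<Rightarrow> real. 0 \<le> z i})"
    by (intro closed_INT ballI closed_Collect_le continuous_on_const continuous_on_product_coordinates)
  moreover have "(\<Inter>i. {z :: nat \<Rightarrow> real. 0 \<le> z i}) = {z. \<forall>i. 0 \<le> z i}" by auto
  ultimately show ?thesis by simp
qed

lemma analytic_closed:
  assumes "closed B" shows "analytic B"
  unfolding analytic_def
proof (intro exI conjI)
  show "closed (B \<times> {z :: nat \<Rightarrow> real. \<forall>i. 0 \<le> z i})"
    by (intro closed_Times assms closed_nonneg_sequences)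
  show "B = fst ` (B \<times> {z :: nat \<Rightarrow> real. \<forall>i. 0 \<le> z i})"
    by (force intro: exI[of _ "\<lambda>_. 0"])
qed auto

lemma continuous_on_snd_coordinate:
  "continuous_on UNIV (\<lambda>p :: 'a::topological_space \<times> ('i \<Rightarrow> 'b::topological_space). snd p i)"
  by (rule continuous_on_compose2[OF continuous_on_product_coordinates continuous_on_snd[OF continuous_on_id]]) auto

lemma closed_reindexed:
  fixes C :: "('a::topological_space \<times> (nat \<Rightarrow> real)) set"
  assumes "closed C"
  shows "closed {p. (fst p, \<lambda>j. snd p ((h :: nat \<Rightarrow> nat) j)) \<in> C}"
proof -
  have "continuous_on UNIV (\<lambda>p :: 'a \<times> (nat \<Rightarrow> real). (fst p, \<lambda>j. snd p (h j)))"
    by (intro continuous_on_Pair continuous_on_coordinatewise_then_product continuous_on_fst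
        continuous_on_id continuous_on_snd_coordinate)
  from closed_vimage[OF assms this] show ?thesis by (simp add: vimage_def)
qed

text \<open>The countably many witnessing sequences are packed into a single one by the pairing function.\<close>

lemma analytic_Inter:
  fixes B :: "nat \<Rightarrow> 'a::topological_space set"
  assumes "\<And>i. analytic (B i)"
  shows "analytic (\<Inter>i. B i)"
proof -
  obtain C :: "nat \<Rightarrow> ('a \<times> (nat \<Rightarrow> real)) set"
    where C: "\<And>i. closed (C i)" "\<And>i x z j. (x, z) \<in> C i \<Longrightarrow> 0 \<le> z j" "\<And>i. B i = fst ` C i"
    using assms unfolding analytic_def by (metis case_prodD)
  define D where "D = (\<Inter>i. {p. (fst p, \<lambda>j. snd p (prod_encode (i, j))) \<in> C i})"
  have "closed D" unfolding D_def by (intro closed_INT ballI closed_reindexed C)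
  moreover have "0 \<le> z k" if "(x, z) \<in> D" for x z k
  proof -
    obtain i j where k: "k = prod_encode (i, j)" by (metis prod_decode_inverse surj_pair)
    have "(x, \<lambda>j. z (prod_encode (i, j))) \<in> C i" using that by (auto simp: D_def)
    from C(2)[OF this, of j] show ?thesis by (simp add: k)
  qed
  moreover have "(\<Inter>i. B i) = fst ` D"
  proof (intro set_eqI iffI)
    fix x assume "x \<in> (\<Inter>i. B i)"
    then have "\<forall>i. \<exists>z. (x, z) \<in> C i" using C(3) by force
    then obtain z where z: "\<And>i. (x, z i) \<in> C i" by metis
    have "(x, \<lambda>k. z (fst (prod_decode k)) (snd (prod_decode k))) \<in> D"
      using z by (auto simp: D_def)
    then show "x \<in> fst ` D" by force
  next
    fix x assume "x \<in> fst ` D"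
    then show "x \<in> (\<Inter>i. B i)" unfolding D_def using C(3) by force
  qed
  ultimately show ?thesis unfolding analytic_def by blast
qed

text \<open>The zeroth coordinate of a sequence names a member of the union. The conditions
\<open>1 \<le> \<bar>z 0 - n\<bar>\<close> or \<open>z 0 = n\<close>, for all \<open>n\<close>, force it to be an integer and define a closed set.\<close>

lemma analytic_Union:
  fixes B :: "nat \<Rightarrow> 'a::topological_space set"
  assumes "\<And>i. analytic (B i)"
  shows "analytic (\<Union>i. B i)"
proof -
  obtain C :: "nat \<Rightarrow> ('a \<times> (nat \<Rightarrow> real)) set"
    where C: "\<And>i. closed (C i)" "\<And>i x z j. (x, z) \<in> C i \<Longrightarrow> 0 \<le> z j" "\<And>i. B i = fst ` C i"
    using assms unfolding analytic_def by (metis case_prodD)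
  define D where "D = {p. \<forall>i. 0 \<le> snd p i} \<inter> (\<Inter>n. {p. 1 \<le> \<bar>snd p 0 - real n\<bar>} \<union>
      {p. snd p 0 = real n} \<inter> {p. (fst p, \<lambda>j. snd p (Suc j)) \<in> C n})"
  have c: "continuous_on UNIV (\<lambda>p :: 'a \<times> (nat \<Rightarrow> real). snd p i)" for i
    by (rule continuous_on_snd_coordinate)
  have "closed {p :: 'a \<times> (nat \<Rightarrow> real). \<forall>i. 0 \<le> snd p i}"
    unfolding Collect_all_eq
    by (intro closed_INT ballI closed_Collect_le continuous_on_const c)
  then have "closed D" unfolding D_def
    by (intro closed_Int closed_INT closed_Un ballI closed_reindexed C closed_Collect_le
        closed_Collect_eq continuous_on_const continuous_on_rabs continuous_on_diff c)
  moreover have "0 \<le> z k" if "(x, z) \<in> D" for x z k using that by (auto simp: D_def)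
  moreover have "(\<Union>i. B i) = fst ` D"
  proof (intro set_eqI iffI)
    fix x assume "x \<in> (\<Union>i. B i)"
    then obtain n z where z: "(x, z) \<in> C n" using C(3) by force
    have "(x, \<lambda>k. case k of 0 \<Rightarrow> real n | Suc j \<Rightarrow> z j) \<in> D"
    proof -
      have "m = n" if "\<not> 1 \<le> \<bar>real n - real m\<bar>" for m using that by linarith
      then show ?thesis using z C(2)[OF z] by (fastforce simp: D_def split: nat.splits)
    qed
    then show "x \<in> fst ` D" by force
  next
    fix x assume "x \<in> fst ` D"
    then obtain z where z: "(x, z) \<in> D" by auto
    then have "0 \<le> z 0" by (auto simp: D_def)
    define n where "n = nat \<lfloor>z 0\<rfloor>"
    have "\<not> 1 \<le> \<bar>z 0 - real n\<bar>" unfolding n_def using \<open>0 \<le> z 0\<close> by (simp; linarith)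
    then have "(x, \<lambda>j. z (Suc j)) \<in> C n" using z by (auto simp: D_def)
    then show "x \<in> (\<Union>i. B i)" using C(3) by force
  qed
  ultimately show ?thesis unfolding analytic_def by blast
qed

text \<open>Complements of analytic sets need not be analytic, so the induction over the Borel sets carries
each set together with its complement.\<close>

lemma analytic_borel:
  fixes B :: "'a::euclidean_space set"
  assumes "B \<in> sets borel"
  shows "analytic B"
proof -
  have op: "analytic S" if oS: "open S" for S :: "'a set"
  proof -
    obtain D where D: "countable D" "\<And>X. X \<in> D \<Longrightarrow> \<exists>a b. X = cbox a b" "\<Union>D = S"
      using open_countable_Union_open_cbox[OF oS] by metis
    have "S = (\<Union>n. from_nat_into (insert {} D) n)"
      using D by (simp add: UN_from_nat_into)
    moreover have "closed (from_nat_into (insert {} D) n)" for n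
      using from_nat_into[of "insert {} D" n] D(2) by fastforce
    ultimately show ?thesis using analytic_Union analytic_closed by metis
  qed
  have "B \<in> sigma_sets UNIV {S. open S}" using assms by (simp add: borel_def)
  then have "analytic B \<and> analytic (- B)"
  proof induction
    case (Basic a) then show ?case using op[of a] analytic_closed[of "- a"] by (simp add: closed_Compl)
  next
    case Empty then show ?case using op analytic_closed by simp
  next
    case (Compl a) then show ?case by (simp add: Compl_eq_Diff_UNIV[symmetric])
  next
    case (Union a)
    then show ?case using analytic_Union[of a] analytic_Inter[of "\<lambda>i. - a i"] by simp
  qed
  then show ?thesis by simp
qed

text \<open>Choquet's capacitability argument. Outer measure is continuous along increasing sequences of
arbitrary sets; therefore the coordinates of the witnessing sequences can be bounded one after the
other, while the outer measure of the projection stays above \<open>a\<close>. When all coordinates are bounded,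
the witnesses form a compact set. The closures of the earlier projections decrease to the projection
of this compact set, and for them the measure is continuous from above.\<close>

lemma compact_capacity_of_projection:
  fixes B :: "(real \<times> 'u::euclidean_space) set"
  assumes B: "B \<in> sets borel" and bd: "bounded B"
    and a: "a < outer_measure_of lebesgue (fst ` B)"
  shows "\<exists>K. compact K \<and> K \<subseteq> B \<and> a \<le> emeasure lebesgue (fst ` K)"
proof -
  obtain C :: "((real \<times> 'u) \<times> (nat \<Rightarrow> real)) set"
    where C: "closed C" "\<And>x z j. (x, z) \<in> C \<Longrightarrow> 0 \<le> z j" "B = fst ` C"
    using analytic_borel[OF B] unfolding analytic_def by (metis case_prodD)
  define pr :: "((real \<times> 'u) \<times> (nat \<Rightarrow> real)) set \<Rightarrow> real set" where "pr S = (fst \<circ> fst) ` S" for S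
  have prC: "pr C = fst ` B" by (simp add: pr_def C(3) image_comp)
  have step: "\<exists>k::nat. a < outer_measure_of lebesgue (pr (S \<inter> {p. snd p m \<le> real k}))"
    if "a < outer_measure_of lebesgue (pr S)" for S m
  proof -
    have "(\<Union>k. pr (S \<inter> {p. snd p m \<le> real k})) = pr S"
      unfolding pr_def image_UN[symmetric] Int_UN_distrib[symmetric]
      by (rule arg_cong[where f="\<lambda>S. (fst \<circ> fst) ` S"]) (use real_arch_simple in auto)
    moreover have "incseq (\<lambda>k. pr (S \<inter> {p. snd p m \<le> real k}))"
      unfolding pr_def by (rule incseq_SucI) force
    ultimately have "a < (SUP k. outer_measure_of lebesgue (pr (S \<inter> {p. snd p m \<le> real k})))"
      using that SUP_outer_measure_of_incseq[of "\<lambda>k. pr (S \<inter> {p. snd p m \<le> real k})" lebesgue] by simp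
    then show ?thesis by (auto simp: less_SUP_iff)
  qed
  have "\<exists>S. (S 0 = C \<and> a < outer_measure_of lebesgue (pr (S 0))) \<and>
     (\<forall>m. a < outer_measure_of lebesgue (pr (S (Suc m))) \<and>
           (\<exists>k::nat. S (Suc m) = S m \<inter> {p. snd p m \<le> real k}))"
  proof -
    define nxt where "nxt m S = S \<inter> {p :: (real \<times> 'u) \<times> (nat \<Rightarrow> real). snd p m \<le> real
       (SOME k::nat. a < outer_measure_of lebesgue (pr (S \<inter> {p. snd p m \<le> real k})))}" for m S
    have nxt: "a < outer_measure_of lebesgue (pr (nxt m S))"
      if "a < outer_measure_of lebesgue (pr S)" for S m
      unfolding nxt_def by (rule someI_ex[OF step[OF that]])
    define S where "S = rec_nat C nxt"
    have "a < outer_measure_of lebesgue (pr (S m))" for m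
      by (induction m) (use a prC nxt in \<open>auto simp: S_def\<close>)
    moreover have "S (Suc m) = nxt m (S m)" for m by (simp add: S_def)
    moreover have "S 0 = C" by (simp add: S_def)
    ultimately show ?thesis unfolding nxt_def by (intro exI[of _ S]) blast
  qed
  then obtain S where S0: "S 0 = C" and Sa0: "a < outer_measure_of lebesgue (pr (S 0))"
     and S1: "\<forall>m. a < outer_measure_of lebesgue (pr (S (Suc m))) \<and>
           (\<exists>k::nat. S (Suc m) = S m \<inter> {p. snd p m \<le> real k})" by blast
  from S1 have "\<forall>m. \<exists>k::nat. S (Suc m) = S m \<inter> {p. snd p m \<le> real k}" by blast
  from choice[OF this] obtain k where SS: "\<And>m. S (Suc m) = S m \<inter> {p. snd p m \<le> real (k m :: nat)}" by blast
  have Sa: "a < outer_measure_of lebesgue (pr (S m))" for m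
    using Sa0 S1 by (cases m) blast+
  have Seq: "S m = C \<inter> {p. \<forall>i<m. snd p i \<le> real (k i)}" for m
    by (induction m) (auto simp: S0 SS less_Suc_eq)
  define D where "D = C \<inter> {p. \<forall>i. snd p i \<le> real (k i)}"
  obtain r where r: "\<And>x. x \<in> B \<Longrightarrow> norm x \<le> r" using bd by (auto simp: bounded_iff)
  have clD: "closed D"
    unfolding D_def Collect_all_eq
    by (intro closed_Int closed_INT ballI closed_Collect_le continuous_on_const continuous_on_snd_coordinate C)
  define Z where "Z = {z :: nat \<Rightarrow> real. \<forall>i. 0 \<le> z i \<and> z i \<le> real (k i)}"
  have "Z = PiE UNIV (\<lambda>i. {0..real (k i)})" by (auto simp: Z_def)
  moreover have "compactin (product_topology (\<lambda>_::nat. euclidean) UNIV) (PiE UNIV (\<lambda>i. {0..real (k i)}))"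
    by (subst compactin_PiE) auto
  ultimately have cZ: "compact Z" by (simp add: euclidean_product_topology)
  have cW: "compact (cball (0::real \<times> 'u) r \<times> Z)" by (intro compact_Times cZ compact_cball)
  have "D \<subseteq> cball 0 r \<times> Z"
  proof
    fix p assume p: "p \<in> D"
    then have "fst p \<in> B" unfolding C(3) D_def by blast
    then show "p \<in> cball 0 r \<times> Z"
      using r[of "fst p"] p C(2)[of "fst p" "snd p"] unfolding D_def Z_def by (cases p) auto
  qed
  then have cD: "compact D"
    using cW clD by (metis compact_Int_closed inf.absorb_iff2)
  define K where "K = fst ` D"
  have cK: "compact K" unfolding K_def
    by (intro compact_continuous_image cD continuous_on_fst continuous_on_id)
  have KB: "K \<subseteq> B" unfolding K_def D_def C(3) by auto
  define E where "E m = closure (pr (S m))" for m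
  have Ebd: "E m \<subseteq> {-r..r}" for m
  proof -
    have "\<bar>t\<bar> \<le> r" if "((t, u), z) \<in> C" for t u z
      using r[of "(t, u)"] that norm_fst_le[of t u] unfolding C(3) by force
    then have "pr (S m) \<subseteq> {-r..r}" unfolding pr_def Seq by (force simp: abs_le_iff)
    then show ?thesis unfolding E_def by (rule closure_minimal) simp
  qed
  have Efin: "emeasure lebesgue (E m) \<noteq> \<infinity>" for m
  proof -
    have "emeasure lebesgue (E m) \<le> emeasure lebesgue {-r..r}"
      by (intro emeasure_mono Ebd) simp
    then show ?thesis by (auto simp: top_unique emeasure_lborel_Icc_eq split: if_splits)
  qed
  have Ea: "a \<le> emeasure lebesgue (E m)" for m
  proof -
    have "a < outer_measure_of lebesgue (E m)"
      unfolding E_def by (rule less_le_trans[OF Sa outer_measure_of_mono[OF closure_subset]])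
    then show ?thesis by (simp add: E_def)
  qed
  have "decseq E" unfolding E_def decseq_Suc_iff pr_def by (auto simp: SS intro!: closure_mono)
  then have "a \<le> emeasure lebesgue (\<Inter>m. E m)"
  proof -
    have "range E \<subseteq> sets lebesgue" by (auto simp: E_def)
    then show ?thesis
      using INF_emeasure_decseq[of E lebesgue] \<open>decseq E\<close> Efin Ea by (metis INF_greatest)
  qed
  \<comment> \<open>A witness for a point near \<open>t\<close> has only its first \<open>m\<close> coordinates bounded. Cutting off the others
    makes a subsequence converge, and in the limit the cut-off changes no coordinate.\<close>
  moreover have "(\<Inter>m. E m) \<subseteq> fst ` K"
  proof
    fix t assume "t \<in> (\<Inter>m. E m)"
    then have "\<forall>m. \<exists>s\<in>pr (S m). dist s t < inverse (Suc m)"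
      by (simp add: E_def closure_approachable del: of_nat_Suc)
    then have "\<forall>m. \<exists>p. p \<in> S m \<and> dist (fst (fst p)) t < inverse (Suc m)"
      unfolding pr_def by force
    then obtain p where pS: "\<And>m. p m \<in> S m" and pt: "\<And>m. dist (fst (fst (p m))) t < inverse (Suc m)"
      by metis
    define q where "q m = (fst (p m), \<lambda>i. min (snd (p m) i) (real (k i)))" for m
    have pC: "p m \<in> C" for m using pS[of m] by (simp add: Seq)
    have "q m \<in> cball 0 r \<times> Z" for m
      using pC[of m] C(2)[of "fst (p m)" "snd (p m)"] r[of "fst (p m)"] unfolding C(3) Z_def q_def by auto
    then obtain l \<sigma> where l: "strict_mono \<sigma>" "(q \<circ> \<sigma>) \<longlonglongrightarrow> l" "l \<in> cball 0 r \<times> Z"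
      using cW by (metis compact_imp_seq_compact seq_compact_def)
    have l1: "(\<lambda>m. fst (p (\<sigma> m))) \<longlonglongrightarrow> fst l"
      using tendsto_fst[OF l(2)] by (simp add: q_def o_def)
    have l2: "(\<lambda>m. snd (p (\<sigma> m))) \<longlonglongrightarrow> snd l"
    proof (rule tendsto_funI)
      fix i
      have "(\<lambda>m. snd (q (\<sigma> m)) i) \<longlonglongrightarrow> snd l i"
        using continuous_on_tendsto_compose[OF continuous_on_product_coordinates tendsto_snd[OF l(2)]]
        by (simp add: o_def)
      moreover have "\<forall>\<^sub>F m in sequentially. snd (q (\<sigma> m)) i = snd (p (\<sigma> m)) i"
      proof (rule eventually_sequentiallyI[of "Suc i"])
        fix m assume "Suc i \<le> m"
        then have "i < \<sigma> m" using seq_suble[OF l(1), of m] by simp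
        then show "snd (q (\<sigma> m)) i = snd (p (\<sigma> m)) i"
          using pS[of "\<sigma> m"] by (simp add: Seq q_def min_def)
      qed
      ultimately show "(\<lambda>m. snd (p (\<sigma> m)) i) \<longlonglongrightarrow> snd l i" by (rule Lim_transform_eventually)
    qed
    have "(\<lambda>m. p (\<sigma> m)) \<longlonglongrightarrow> l"
      using tendsto_Pair[OF l1 l2] by simp
    then have "l \<in> C" by (rule closed_sequentially[OF C(1) pC])
    then have "l \<in> D" using l(3) by (auto simp: D_def Z_def)
    moreover have "t = fst (fst l)"
    proof -
      have "(\<lambda>m. fst (fst (p (\<sigma> m)))) \<longlonglongrightarrow> fst (fst l)" by (intro tendsto_intros l1)
      moreover have "(\<lambda>m. fst (fst (p m))) \<longlonglongrightarrow> t"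
        by (rule metric_LIMSEQ_I) (meson pt LIMSEQ_inverse_real_of_nat reals_Archimedean less_trans
          dual_order.strict_trans2 le_imp_inverse_le of_nat_0_less_iff zero_less_Suc of_nat_le_iff Suc_le_mono less_imp_le)
      then have "(\<lambda>m. fst (fst (p (\<sigma> m)))) \<longlonglongrightarrow> t"
        using LIMSEQ_subseq_LIMSEQ[OF _ l(1)] by (auto simp: o_def)
      ultimately show ?thesis using LIMSEQ_unique by blast
    qed
    ultimately show "t \<in> fst ` K" by (auto simp: K_def)
  qed
  moreover have "fst ` K \<in> sets lebesgue"
    using compact_continuous_image[OF continuous_on_fst[OF continuous_on_id] cK]
    by (simp add: borel_compact)
  ultimately have "a \<le> emeasure lebesgue (fst ` K)"
    by (meson emeasure_mono order_trans)
  then show ?thesis using cK KB by blast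
qed

text \<open>A dense sequence supplies balls of radius \<open>2\<^sup>-\<^sup>j\<close>. In step \<open>j\<close> each section is cut down to the first of
these balls that it meets, so the sections shrink to a point, the value of the selection. Being
determined by a least index, the cut preserves the property that the times at which the section
meets a given closed set form a Borel set; this makes the selection measurable.\<close>

lemma compact_section_selection:
  fixes K :: "(real \<times> 'u::euclidean_space) set"
  assumes K: "compact K"
  shows "\<exists>s. s \<in> borel_measurable (restrict_space borel (fst ` K)) \<and> (\<forall>t\<in>fst ` K. (t, s t) \<in> K)"
proof -
  obtain D :: "'u set" where "countable D" and D: "\<And>X. open X \<Longrightarrow> X \<noteq> {} \<Longrightarrow> \<exists>d\<in>D. d \<in> X"
    using countable_dense_exists by metis
  then have "D \<noteq> {}" by blast
  define d where "d = from_nat_into D"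
  have dense: "\<exists>n. u \<in> cball (d n) (1 / 2 ^ j)" for u and j :: nat
  proof -
    have "(0::real) < 1 / 2 ^ j" by simp
    then have "u \<in> ball u (1 / 2 ^ j)" by (rule centre_in_ball[THEN iffD2])
    then have "\<exists>x\<in>D. x \<in> ball u (1 / 2 ^ j)" using D[OF open_ball] by (metis empty_iff)
    then obtain x where "x \<in> D" "x \<in> ball u (1 / 2 ^ j)" by blast
    moreover obtain n where "x = d n"
      using \<open>x \<in> D\<close> \<open>countable D\<close> unfolding d_def by (metis from_nat_into_surj)
    ultimately show ?thesis by (auto simp: dist_commute intro!: exI[of _ n])
  qed
  define hits :: "(real \<times> 'u) set \<Rightarrow> 'u set \<Rightarrow> real set" where "hits S F = {t. \<exists>u\<in>F. (t, u) \<in> S}" for S F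
  define idx where "idx S j t = (LEAST n. t \<in> hits S (cball (d n) (1 / 2 ^ j)))" for S and j :: nat and t
  define nxt where "nxt j S = {p \<in> S. snd p \<in> cball (d (idx S j (fst p))) (1 / 2 ^ j)}" for j :: nat and S
  define Q where "Q = rec_nat K nxt"
  have Q0: "Q 0 = K" and QS: "Q (Suc j) = nxt j (Q j)" for j by (simp_all add: Q_def)
  have inv: "(\<forall>t. compact {u. (t, u) \<in> Q j}) \<and> (\<forall>F. closed F \<longrightarrow> hits (Q j) F \<in> sets borel)" for j
  proof (induction j)
    case 0
    have "compact {u. (t, u) \<in> K}" for t
    proof -
      have "{u. (t, u) \<in> K} = snd ` (K \<inter> ({t} \<times> UNIV))" by force
      then show ?thesis
        using K by (auto intro!: compact_continuous_image continuous_intros compact_Int_closed closed_Times)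
    qed
    moreover have "hits K F \<in> sets borel" if "closed F" for F
    proof -
      have "hits K F = fst ` (K \<inter> (UNIV \<times> F))" by (force simp: hits_def)
      then have "compact (hits K F)"
        using K that by (auto intro!: compact_continuous_image continuous_intros compact_Int_closed closed_Times)
      then show ?thesis by (rule borel_compact)
    qed
    ultimately show ?case by (simp add: Q0)
  next
    case (Suc j)
    have "compact {u. (t, u) \<in> Q (Suc j)}" for t
    proof -
      have "{u. (t, u) \<in> Q (Suc j)} = {u. (t, u) \<in> Q j} \<inter> cball (d (idx (Q j) j t)) (1 / 2 ^ j)"
        by (auto simp: QS nxt_def)
      then show ?thesis using Suc by (simp add: compact_Int_closed)
    qed
    moreover have "hits (Q (Suc j)) F \<in> sets borel" if F: "closed F" for F
    proof -
      have "hits (Q (Suc j)) F = (\<Union>n. hits (Q j) (cball (d n) (1 / 2 ^ j) \<inter> F) -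
              (\<Union>m\<in>{..<n}. hits (Q j) (cball (d m) (1 / 2 ^ j))))" (is "_ = ?R")
      proof (intro set_eqI iffI)
        fix t assume "t \<in> hits (Q (Suc j)) F"
        then obtain u where u: "u \<in> F" "(t, u) \<in> Q j" "u \<in> cball (d (idx (Q j) j t)) (1 / 2 ^ j)"
          by (auto simp: hits_def QS nxt_def)
        have "t \<notin> hits (Q j) (cball (d m) (1 / 2 ^ j))" if "m < idx (Q j) j t" for m
          using not_less_Least[OF that[unfolded idx_def]] .
        moreover have "t \<in> hits (Q j) (cball (d (idx (Q j) j t)) (1 / 2 ^ j) \<inter> F)"
          unfolding hits_def using u by blast
        ultimately show "t \<in> ?R" by blast
      next
        fix t assume "t \<in> ?R"
        then obtain n where n: "t \<in> hits (Q j) (cball (d n) (1 / 2 ^ j) \<inter> F)"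
          "\<And>m. m < n \<Longrightarrow> t \<notin> hits (Q j) (cball (d m) (1 / 2 ^ j))" by blast
        have "idx (Q j) j t = n"
          unfolding idx_def using n by (intro Least_equality) (auto simp: hits_def not_less[symmetric])
        then show "t \<in> hits (Q (Suc j)) F" using n(1) by (auto simp: hits_def QS nxt_def)
      qed
      also have "\<dots> \<in> sets borel"
      proof -
        have "hits (Q j) (cball (d n) (1 / 2 ^ j) \<inter> F) \<in> sets borel"
          "hits (Q j) (cball (d n) (1 / 2 ^ j)) \<in> sets borel" for n
          using Suc F by (auto simp: closed_Int)
        then show ?thesis by (intro sets.countable_UN image_subsetI sets.Diff sets.finite_UN) auto
      qed
      finally show ?thesis .
    qed
    ultimately show ?case by blast
  qed
  have ne: "{u. (t, u) \<in> Q j} \<noteq> {}" if "t \<in> fst ` K" for t j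
  proof (induction j)
    case 0 then show ?case using that by (auto simp: Q0)
  next
    case (Suc j)
    then obtain u where "(t, u) \<in> Q j" by auto
    moreover obtain n where "u \<in> cball (d n) (1 / 2 ^ j)" using dense by blast
    ultimately have "t \<in> hits (Q j) (cball (d n) (1 / 2 ^ j))" unfolding hits_def by blast
    then have "t \<in> hits (Q j) (cball (d (idx (Q j) j t)) (1 / 2 ^ j))" unfolding idx_def by (rule LeastI)
    then show ?case by (auto simp: hits_def QS nxt_def)
  qed
  have mono: "Q n \<subseteq> Q m" if "m \<le> n" for m n
    using that by (induction rule: dec_induct) (auto simp: QS nxt_def)
  have nest: "\<exists>u\<in>F. \<forall>j. (t, u) \<in> Q j" if "\<And>j. t \<in> hits (Q j) F" "closed F" for t F
  proof -
    have "(\<Inter>j. {u. (t, u) \<in> Q j} \<inter> F) \<noteq> {}"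
    proof (rule compact_nest)
      show "compact ({u. (t, u) \<in> Q j} \<inter> F)" for j using inv that(2) by (simp add: compact_Int_closed)
      show "{u. (t, u) \<in> Q j} \<inter> F \<noteq> {}" for j using that(1)[of j] by (auto simp: hits_def)
      show "{u. (t, u) \<in> Q n} \<inter> F \<subseteq> {u. (t, u) \<in> Q m} \<inter> F" if "m \<le> n" for m n
        using mono[OF that] by auto
    qed
    then show ?thesis by blast
  qed
  have uniq: "u = v" if "\<And>j. (t, u) \<in> Q j" "\<And>j. (t, v) \<in> Q j" for t u v
  proof (rule ccontr)
    assume "u \<noteq> v"
    then obtain j where j: "(1 / 2) ^ j < dist u v / 2"
      using real_arch_pow_inv[of "dist u v / 2" "1 / 2"] by auto
    have "u \<in> cball (d (idx (Q j) j t)) (1 / 2 ^ j)" "v \<in> cball (d (idx (Q j) j t)) (1 / 2 ^ j)"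
      using that[of "Suc j"] by (auto simp: QS nxt_def)
    then have "dist u v \<le> 2 * (1 / 2 ^ j)"
      using dist_triangle2[of u v "d (idx (Q j) j t)"] by (simp add: dist_commute)
    then show False using j by (simp add: power_one_over)
  qed
  define s where "s t = (SOME u. \<forall>j. (t, u) \<in> Q j)" for t
  have s: "(t, s t) \<in> Q j" if "t \<in> fst ` K" for t j
  proof -
    have "\<exists>u. \<forall>j. (t, u) \<in> Q j" using nest[of t UNIV] ne[OF that] by (fastforce simp: hits_def)
    then have "\<forall>j. (t, s t) \<in> Q j" unfolding s_def by (rule someI_ex)
    then show ?thesis by blast
  qed
  have "s \<in> borel_measurable (restrict_space borel (fst ` K))"
    unfolding borel_eq_closed[where 'a='u]
  proof (rule measurable_measure_of)
    fix F :: "'u set" assume "F \<in> Collect closed"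
    then have F: "closed F" by simp
    have "s t \<in> F \<longleftrightarrow> (\<forall>j. t \<in> hits (Q j) F)" if "t \<in> fst ` K" for t
    proof
      show "\<forall>j. t \<in> hits (Q j) F" if "s t \<in> F" using s[OF \<open>t \<in> fst ` K\<close>] that by (auto simp: hits_def)
      show "s t \<in> F" if "\<forall>j. t \<in> hits (Q j) F" using nest[of t F] that F uniq s[OF \<open>t \<in> fst ` K\<close>] by metis
    qed
    then have eq: "s -` F \<inter> space (restrict_space borel (fst ` K)) = fst ` K \<inter> (\<Inter>j. hits (Q j) F)"
      by (auto simp: space_restrict_space)
    have "(\<Inter>j. hits (Q j) F) \<in> sets borel" using inv F by (intro sets.countable_INT'') auto
    then show "s -` F \<inter> space (restrict_space borel (fst ` K)) \<in> sets (restrict_space borel (fst ` K))"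
      unfolding eq sets_restrict_space by blast
  qed auto
  then show ?thesis using s[of _ 0] by (auto simp: Q0 intro!: exI[of _ s])
qed

text \<open>This contains the measurable projection theorem: the projection differs by a null set from a
countable union of compact sets, because compact subsets exhaust the measure of a measurable hull.\<close>

lemma projection_exhausted_by_compacts:
  fixes B :: "(real \<times> 'u::euclidean_space) set"
  assumes B: "B \<in> sets borel" and bd: "bounded B"
  shows "\<exists>K. (\<forall>m::nat. compact (K m) \<and> K m \<subseteq> B) \<and> negligible (fst ` B - (\<Union>m. fst ` K m))"
proof -
  obtain H where H: "H \<in> sets lebesgue" "fst ` B \<subseteq> H" "outer_measure_of lebesgue (fst ` B) = emeasure lebesgue H"
    using outer_measure_of_attain[of "fst ` B" lebesgue] by auto
  obtain r where r: "\<And>x. x \<in> B \<Longrightarrow> norm x \<le> r" using bd by (auto simp: bounded_iff)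
  have "\<bar>t\<bar> \<le> r" if "(t, u) \<in> B" for t u
    using r[OF that] norm_fst_le[of t u] by simp
  then have "fst ` B \<subseteq> {-r..r}" by (force simp: abs_le_iff)
  then have "emeasure lebesgue H \<le> emeasure lebesgue {-r..r}"
    unfolding H(3)[symmetric] by (metis (no_types, lifting) outer_measure_of_mono outer_measure_of_eq lmeasurable_interval(1) cbox_interval fmeasurableD)
  then have fin: "emeasure lebesgue H \<noteq> \<infinity>" by (auto simp: top_unique emeasure_lborel_Icc_eq split: if_splits)
  show ?thesis
  proof (cases "emeasure lebesgue H = 0")
    case True
    then have "negligible H" using H(1) by (simp add: negligible_iff_null_sets null_setsI)
    then show ?thesis
      using H(2) by (intro exI[of _ "\<lambda>_. {}"]) (auto intro: negligible_subset)
  next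
    case False
    define h where "h = emeasure lebesgue H"
    have "\<exists>K. compact K \<and> K \<subseteq> B \<and> h - ennreal (1 / real (Suc m)) \<le> emeasure lebesgue (fst ` K)" for m
    proof (rule compact_capacity_of_projection[OF B bd])
      show "h - ennreal (1 / real (Suc m)) < outer_measure_of lebesgue (fst ` B)"
        unfolding H(3) h_def using False fin by (intro ennreal_between) (auto simp: top.not_eq_extremum[symmetric] zero_less_iff_neq_zero)
    qed
    then obtain K where K: "\<And>m. compact (K m)" "\<And>m. K m \<subseteq> B"
      "\<And>m. h - ennreal (1 / real (Suc m)) \<le> emeasure lebesgue (fst ` K m)" by metis
    define M where "M = (\<Union>m. fst ` K m)"
    have sK: "fst ` K m \<in> sets lebesgue" for m
      using compact_continuous_image[OF continuous_on_fst[OF continuous_on_id] K(1)]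
      by (simp add: borel_compact)
    then have M: "M \<in> sets lebesgue" unfolding M_def by blast
    have MH: "M \<subseteq> H" using H(2) K(2) unfolding M_def by blast
    have "h \<le> emeasure lebesgue M"
    proof (rule ennreal_le_epsilon)
      fix e :: real assume "0 < e"
      then obtain m where m: "1 / real (Suc m) < e" using nat_approx_posE by blast
      have "h \<le> (h - ennreal (1 / real (Suc m))) + ennreal (1 / real (Suc m))"
        by (metis add.commute ennreal_minus_le_iff linear order_refl top.not_eq_extremum)
      also have "\<dots> \<le> emeasure lebesgue M + ennreal e"
      proof (rule add_mono)
        have "emeasure lebesgue (fst ` K m) \<le> emeasure lebesgue M"
          by (rule emeasure_mono[OF _ M]) (auto simp: M_def)
        then show "h - ennreal (1 / real (Suc m)) \<le> emeasure lebesgue M" using K(3)[of m] by (rule order_trans[rotated])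
        show "ennreal (1 / real (Suc m)) \<le> ennreal e" using m by (intro ennreal_leI) simp
      qed
      finally show "h \<le> emeasure lebesgue M + ennreal e" .
    qed
    moreover have "emeasure lebesgue M \<le> h" unfolding h_def by (rule emeasure_mono[OF MH H(1)])
    ultimately have "emeasure lebesgue M = h" by simp
    then have "emeasure lebesgue (H - M) = 0"
      using emeasure_Diff[of lebesgue M H] MH M H(1) fin
      by (simp add: h_def)
    then have "negligible (H - M)" using H(1) M by (simp add: negligible_iff_null_sets null_setsI)
    then have "negligible (fst ` B - M)" by (rule negligible_subset) (use H(2) in auto)
    then show ?thesis using K unfolding M_def by blast
  qed
qed

lemma measurable_restrict_patch:
  fixes a b :: "real \<Rightarrow> 'u::euclidean_space"
  assumes a: "a \<in> borel_measurable (restrict_space borel A)"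
    and b: "b \<in> borel_measurable (restrict_space borel S)" and A: "A \<in> sets borel" and S: "S \<in> sets borel"
  shows "(\<lambda>t. if t \<in> A then a t else b t) \<in> borel_measurable (restrict_space borel S)"
proof -
  have *: "f \<in> borel_measurable (restrict_space borel T) \<longleftrightarrow> (\<lambda>t. indicator T t *\<^sub>R f t) \<in> borel_measurable borel"
    if "T \<in> sets borel" for f :: "real \<Rightarrow> 'u" and T
    using that by (simp add: borel_measurable_restrict_space_iff)
  have "(\<lambda>t. indicator S t *\<^sub>R (if t \<in> A then a t else b t)) =
     (\<lambda>t. indicator S t *\<^sub>R (indicator A t *\<^sub>R a t) + indicator (- A) t *\<^sub>R (indicator S t *\<^sub>R b t))"
    by (auto simp: indicator_def)
  moreover have "\<dots> \<in> borel_measurable borel"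
    by (intro borel_measurable_add borel_measurable_scaleR[OF borel_measurable_indicator]
        *[THEN iffD1] a b A S) (use A in auto)
  ultimately show ?thesis unfolding *[OF S] by simp
qed

text \<open>A Castaing representation up to a null set. For each ball of a countable base, the given selector
is replaced with a selection from the ball at (almost) all times at which the ball meets the section.\<close>

theorem dense_selectors:
  fixes G :: "real \<Rightarrow> 'u::euclidean_space set"
  assumes G: "graph G \<in> sets borel" and u: "u \<in> selectors G"
  shows "\<exists>v. (\<forall>k::nat. v k \<in> selectors G) \<and>
    (\<exists>N. negligible N \<and> (\<forall>t. 0 \<le> t \<longrightarrow> t \<notin> N \<longrightarrow> G t \<subseteq> closure (range (\<lambda>k. v k t))))"
proof -
  obtain D :: "'u set" where cD: "countable D" and D: "\<And>X. open X \<Longrightarrow> X \<noteq> {} \<Longrightarrow> \<exists>d\<in>D. d \<in> X"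
    using countable_dense_exists by metis
  then have "D \<noteq> {}" by blast
  define d where "d = from_nat_into D"
  define B where "B i j n = graph G \<inter> ({0..real n} \<times> cball (d j) (1 / real (Suc i)))" for i j n :: nat
  have "B i j n \<in> sets borel" for i j n
    unfolding B_def by (intro sets.Int G borel_closed closed_Times) auto
  moreover have "bounded (B i j n)" for i j n
    by (rule bounded_subset[of "{0..real n} \<times> cball (d j) (1 / real (Suc i))"])
       (auto simp: B_def intro!: bounded_Times)
  ultimately have "\<forall>i j n. \<exists>K. (\<forall>m::nat. compact (K m) \<and> K m \<subseteq> B i j n) \<and>
      negligible (fst ` B i j n - (\<Union>m. fst ` K m))"
    by (intro allI projection_exhausted_by_compacts) blast+
  then obtain K where K: "\<And>i j n m. compact (K i j n m)" "\<And>i j n m. K i j n m \<subseteq> B i j n"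
    "\<And>i j n. negligible (fst ` B i j n - (\<Union>m::nat. fst ` K i j n m))"
    by metis
  obtain s where s: "\<And>i j n m. s i j n m \<in> borel_measurable (restrict_space borel (fst ` K i j n m))"
     "\<And>i j n m t. t \<in> fst ` K i j n m \<Longrightarrow> (t, s i j n m t) \<in> K i j n m"
    using compact_section_selection[OF K(1)] by metis
  define w where "w i j n m t = (if t \<in> fst ` K i j n m then s i j n m t else u t)" for i j n m t
  have cK: "fst ` K i j n m \<in> sets borel" for i j n m
    by (intro borel_compact compact_continuous_image continuous_on_fst continuous_on_id K)
  have w: "w i j n m \<in> selectors G" for i j n m
    unfolding selectors_def
  proof (intro CollectI conjI allI impI)
    show "w i j n m \<in> borel_measurable (restrict_space borel {0..})"
      unfolding w_def using u s(1) cK by (intro measurable_restrict_patch) (auto simp: selectors_def)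
    show "w i j n m t \<in> G t" if "0 \<le> t" for t
      using u that s(2)[of t i j n m] K(2)[of i j n m] unfolding w_def B_def selectors_def graph_def by auto
  qed
  define N where "N = (\<Union>i j n. fst ` B i j n - (\<Union>m. fst ` K i j n m))"
  have neg: "negligible (\<Union>n::nat. F n)" if "\<And>n. negligible (F n)" for F :: "nat \<Rightarrow> real set"
    using that by (intro negligible_countable_Union) auto
  have N: "negligible N" unfolding N_def by (intro neg K(3))
  define dec where "dec k = (case prod_decode k of (i, k') \<Rightarrow> case prod_decode k' of (j, k'') \<Rightarrow>
      case prod_decode k'' of (n, m) \<Rightarrow> w i j n m)" for k
  have dec: "dec (prod_encode (i, prod_encode (j, prod_encode (n, m)))) = w i j n m" for i j n m
    by (simp add: dec_def)
  have "G t \<subseteq> closure (range (\<lambda>k. dec k t))" if t: "0 \<le> t" "t \<notin> N" for t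
  proof
    fix p assume p: "p \<in> G t"
    show "p \<in> closure (range (\<lambda>k. dec k t))"
      unfolding closure_approachable
    proof (intro allI impI)
      fix e :: real assume "0 < e"
      then obtain i where i: "1 / real (Suc i) < e / 2" using nat_approx_posE[of "e / 2"] by auto
      have "p \<in> ball p (1 / real (Suc i))" by simp
      then have "\<exists>x\<in>D. x \<in> ball p (1 / real (Suc i))" using D[OF open_ball] by (metis empty_iff)
      then obtain j where j: "p \<in> cball (d j) (1 / real (Suc i))"
        unfolding d_def using cD by (metis from_nat_into_surj mem_ball mem_cball dist_commute less_imp_le)
      obtain n where "t \<le> real n" using real_arch_simple by blast
      then have "(t, p) \<in> B i j n" using j p t by (simp add: B_def graph_def)
      then have "t \<in> fst ` B i j n" by force
      then obtain m where m: "t \<in> fst ` K i j n m" using t(2) unfolding N_def by blast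
      then have "(t, w i j n m t) \<in> B i j n" using s(2)[OF m] K(2)[of i j n m] m by (auto simp: w_def)
      then have "dist (w i j n m t) p < e"
        using i j dist_triangle3[of "w i j n m t" p "d j"] by (auto simp: B_def)
      then show "\<exists>y\<in>range (\<lambda>k. dec k t). dist y p < e" using dec by (metis rangeI)
    qed
  qed
  moreover have "dec k \<in> selectors G" for k using w by (simp add: dec_def split: prod.splits)
  ultimately show ?thesis using N by blast
qed

section \<open>Absolute continuity and the fundamental theorem of calculus\<close>

lemma atLeast_lebesgue [simp]: "{a::real..} \<in> sets lebesgue"
  by (metis borel_closed closed_atLeast sets_completionI_sets sets_lborel)

text \<open>Averages over \<open>[t, t + h]\<close> converge almost everywhere; applied to the reflected function, this also
covers the averages over \<open>[t - h, t]\<close>.\<close>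

lemma has_vector_derivative_indefinite_integral_AE_UNIV:
  fixes h :: "real \<Rightarrow> 'b::euclidean_space"
  assumes h: "\<And>a b. h integrable_on {a..b}"
  shows "\<exists>N. negligible N \<and> (\<forall>t. t \<notin> N \<longrightarrow> ((\<forall>e>0. \<exists>d>0. \<forall>y. \<bar>y - t\<bar> < d \<longrightarrow>
     norm (integral {min t y..max t y} h - \<bar>y - t\<bar> *\<^sub>R h t) \<le> e * \<bar>y - t\<bar>)))"
proof -
  obtain N1 where N1: "negligible N1" and N1': "\<And>x e. \<lbrakk>x \<notin> N1; 0 < e\<rbrakk> \<Longrightarrow>
       \<exists>d>0. \<forall>r. 0 < r \<and> r < d \<longrightarrow> norm (integral {x..x + r} h /\<^sub>R r - h x) < e"
    using integrable_ccontinuous_explicit[of h] h by (auto simp: box_real)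
  have "(\<lambda>x. h (- x)) integrable_on {a..b}" for a b
    using h[of "- b" "- a"] Henstock_Kurzweil_Integration.integrable_reflect_real[of h "-a" "-b"] by simp
  then obtain N2 where N2: "negligible N2" and N2': "\<And>x e. \<lbrakk>x \<notin> N2; 0 < e\<rbrakk> \<Longrightarrow>
       \<exists>d>0. \<forall>r. 0 < r \<and> r < d \<longrightarrow> norm (integral {x..x + r} (\<lambda>x. h (- x)) /\<^sub>R r - h (- x)) < e"
    using integrable_ccontinuous_explicit[of "\<lambda>x. h (- x)"] by (auto simp: box_real)
  have scale: "norm (v - r *\<^sub>R w) \<le> e * r" if "norm (v /\<^sub>R r - w) < e" "0 < r" for v w :: 'b and e r
  proof -
    have "v - r *\<^sub>R w = r *\<^sub>R (v /\<^sub>R r - w)" using that by (simp add: scaleR_diff_right)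
    then have "norm (v - r *\<^sub>R w) = r * norm (v /\<^sub>R r - w)" using that by simp
    also have "\<dots> \<le> r * e" using that by (intro mult_left_mono) auto
    finally show ?thesis by (simp add: mult.commute)
  qed
  show ?thesis
  proof (intro exI[of _ "N1 \<union> uminus ` N2"] conjI allI impI)
    show "negligible (N1 \<union> uminus ` N2)"
      using N1 N2 by (intro negligible_Un negligible_differentiable_image_negligible)
        (auto intro!: derivative_intros)
    fix t e :: real assume t: "t \<notin> N1 \<union> uminus ` N2" and e: "0 < e"
    have "- t \<notin> N2" using t by force
    then obtain d1 d2 where d: "0 < d1" "0 < d2"
      "\<And>r. 0 < r \<Longrightarrow> r < d1 \<Longrightarrow> norm (integral {t..t + r} h /\<^sub>R r - h t) < e"
      "\<And>r. 0 < r \<Longrightarrow> r < d2 \<Longrightarrow> norm (integral {- t..- t + r} (\<lambda>x. h (- x)) /\<^sub>R r - h t) < e"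
      using N1'[of t e] N2'[of "- t" e] t e by auto
    have "norm (integral {min t y..max t y} h - \<bar>y - t\<bar> *\<^sub>R h t) \<le> e * \<bar>y - t\<bar>"
      if "\<bar>y - t\<bar> < min d1 d2" for y
    proof (cases y t rule: linorder_cases)
      case equal then show ?thesis by simp
    next
      case greater
      then show ?thesis using scale[OF d(3)[of "y - t"]] that by (simp add: min_def max_def split: if_splits)
    next
      case less
      have "integral {- t..- t + (t - y)} (\<lambda>x. h (- x)) = integral {y..t} h"
        using Henstock_Kurzweil_Integration.integral_reflect_real[of t y h] by simp
      then show ?thesis using scale[OF d(4)[of "t - y"]] that less by (simp add: min_def max_def split: if_splits)
    qed
    then show "\<exists>d>0. \<forall>y. \<bar>y - t\<bar> < d \<longrightarrow>
        norm (integral {min t y..max t y} h - \<bar>y - t\<bar> *\<^sub>R h t) \<le> e * \<bar>y - t\<bar>"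
      using d by (intro exI[of _ "min d1 d2"]) auto
  qed
qed

lemma has_vector_derivative_indefinite_integral_AE:
  fixes h :: "real \<Rightarrow> 'b::euclidean_space"
  assumes h: "\<And>b. 0 \<le> b \<Longrightarrow> h integrable_on {0..b}"
  shows "AE t in lebesgue_on {0..}. ((\<lambda>t. integral {0..t} h) has_vector_derivative h t) (at t within {0..})"
proof -
  define H where "H t = (if t \<in> {0..} then h t else 0)" for t
  have HI: "H integrable_on {a..b}" for a b
  proof -
    have "{0..} \<inter> {a..b} = {max 0 a..b}" by auto
    moreover have "h integrable_on {max 0 a..b}"
    proof (cases "max 0 a \<le> b")
      case True
      then show ?thesis by (intro integrable_on_subinterval[OF h[of b]]) auto
    qed auto
    ultimately show ?thesis unfolding H_def integrable_restrict_Int by simp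
  qed
  obtain N where N: "negligible N" "\<And>t e. t \<notin> N \<Longrightarrow> 0 < e \<Longrightarrow> \<exists>d>0. \<forall>y. \<bar>y - t\<bar> < d \<longrightarrow>
     norm (integral {min t y..max t y} H - \<bar>y - t\<bar> *\<^sub>R H t) \<le> e * \<bar>y - t\<bar>"
    using has_vector_derivative_indefinite_integral_AE_UNIV[of H, OF HI] by blast
  have "((\<lambda>t. integral {0..t} h) has_vector_derivative h t) (at t within {0..})"
    if t: "t \<in> {0..}" "t \<notin> N" for t
    unfolding has_vector_derivative_def has_derivative_within_alt
  proof (intro conjI allI impI)
    show "bounded_linear (\<lambda>x. x *\<^sub>R h t)" by (rule bounded_linear_scaleR_left)
    fix e :: real assume "0 < e"
    then obtain d where d: "0 < d" "\<And>y. \<bar>y - t\<bar> < d \<Longrightarrow>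
       norm (integral {min t y..max t y} H - \<bar>y - t\<bar> *\<^sub>R H t) \<le> e * \<bar>y - t\<bar>" using N(2)[OF t(2)] by blast
    have "norm (integral {0..y} h - integral {0..t} h - (y - t) *\<^sub>R h t) \<le> e * norm (y - t)"
      if y: "0 \<le> y" "\<bar>y - t\<bar> < d" for y
    proof -
      have eq: "integral {min t y..max t y} H = integral {min t y..max t y} h"
        using t y by (intro integral_cong) (auto simp: H_def)
      have Ht: "H t = h t" using t by (simp add: H_def)
      show ?thesis
      proof (cases "t \<le> y")
        case True
        then have "integral {0..t} h + integral {t..y} h = integral {0..y} h"
          using t y by (intro Henstock_Kurzweil_Integration.integral_combine h) auto
        then have "integral {0..y} h - integral {0..t} h = integral {t..y} h" by (metis add_diff_cancel_left')
        then show ?thesis using d(2)[OF y(2)] eq Ht True by (simp add: min_def max_def)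
      next
        case False
        then have "integral {0..y} h + integral {y..t} h = integral {0..t} h"
          using t y by (intro Henstock_Kurzweil_Integration.integral_combine h) auto
        then have "integral {0..y} h - integral {0..t} h - (y - t) *\<^sub>R h t = - (integral {y..t} h - (t - y) *\<^sub>R h t)"
          by (metis (no_types, lifting) add_diff_cancel_left' minus_diff_eq minus_diff_minus scaleR_minus_left)
        then have "norm (integral {0..y} h - integral {0..t} h - (y - t) *\<^sub>R h t) = norm (integral {y..t} h - (t - y) *\<^sub>R h t)"
          by (metis norm_minus_cancel)
        then show ?thesis using d(2)[OF y(2)] eq Ht False by (simp add: min_def max_def)
      qed
    qed
    then show "\<exists>d>0. \<forall>y\<in>{0..}. norm (y - t) < d \<longrightarrow>
         norm (integral {0..y} h - integral {0..t} h - (y - t) *\<^sub>R h t) \<le> e * norm (y - t)"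
      using d(1) by (intro exI[of _ d]) auto
  qed
  moreover have "AE t in lebesgue_on {0..}. t \<notin> N"
    using N(1) by (subst AE_restrict_space_iff) (auto simp: negligible_iff_null_sets dest: AE_not_in elim!: eventually_mono)
  moreover have "AE t in lebesgue_on {0..}. t \<in> {0::real..}"
    by (subst AE_restrict_space_iff) auto
  ultimately show ?thesis by (auto elim: eventually_elim2)
qed

lemma sum_integral_nonoverlapping_le:
  fixes \<phi> :: "real \<Rightarrow> real"
  assumes \<phi>: "\<phi> integrable_on {a..b}" "\<And>x. x \<in> {a..b} \<Longrightarrow> 0 \<le> \<phi> x"
    and D: "finite D" "\<And>i. i \<in> D \<Longrightarrow> a \<le> lo i \<and> lo i \<le> hi i \<and> hi i \<le> b"
    and dis: "\<And>i j. i \<in> D \<Longrightarrow> j \<in> D \<Longrightarrow> i \<noteq> j \<Longrightarrow> {lo i<..<hi i} \<inter> {lo j<..<hi j} = {}"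
  shows "(\<Sum>i\<in>D. integral {lo i..hi i} \<phi>) \<le> integral {a..b} \<phi>"
proof -
  define ch where "ch i x = (if x \<in> {lo i<..<hi i} then \<phi> x else 0)" for i x
  have I: "ch i integrable_on {a..b}" "integral {a..b} (ch i) = integral {lo i..hi i} \<phi>" if "i \<in> D" for i
  proof -
    have eq: "{lo i<..<hi i} \<inter> {a..b} = {lo i<..<hi i}" using D(2)[OF that] by auto
    have "\<phi> integrable_on {lo i..hi i}" using D(2)[OF that] by (intro integrable_on_subinterval[OF \<phi>(1)]) auto
    then show "ch i integrable_on {a..b}"
      unfolding ch_def integrable_restrict_Int eq using integrable_on_open_interval[of \<phi> "lo i" "hi i"] by (simp add: box_real)
    show "integral {a..b} (ch i) = integral {lo i..hi i} \<phi>"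
      unfolding ch_def integral_restrict_Int eq using integral_open_interval[of "lo i" "hi i" \<phi>] by (simp add: box_real)
  qed
  have "(\<Sum>i\<in>D. integral {lo i..hi i} \<phi>) = integral {a..b} (\<lambda>x. \<Sum>i\<in>D. ch i x)"
    using I by (subst integral_sum) (auto simp: D)
  also have "\<dots> \<le> integral {a..b} \<phi>"
  proof (rule integral_le)
    show "(\<lambda>x. \<Sum>i\<in>D. ch i x) integrable_on {a..b}" using I D(1) by (intro integrable_sum) auto
    fix x assume x: "x \<in> {a..b}"
    show "(\<Sum>i\<in>D. ch i x) \<le> \<phi> x"
    proof (cases "\<exists>i\<in>D. x \<in> {lo i<..<hi i}")
      case True
      then obtain i where i: "i \<in> D" "x \<in> {lo i<..<hi i}" by blast
      have "ch j x = 0" if "j \<in> D - {i}" for j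
        using dis[of i j] i that unfolding ch_def by auto
      then have "(\<Sum>j\<in>D. ch j x) = ch i x" using i D(1) by (simp add: sum.remove)
      then show ?thesis using i by (simp add: ch_def)
    next
      case False
      then have "(\<Sum>j\<in>D. ch j x) = 0" by (intro sum.neutral) (auto simp: ch_def)
      then show ?thesis using \<phi>(2)[OF x] by simp
    qed
  qed (rule \<phi>)
  finally show ?thesis .
qed

text \<open>The integrand is split into the part \<open>min \<bar>h\<bar> n\<close>, whose integral is at most \<open>n\<close> times the total length of
the intervals, and a remainder whose integral over the whole interval is small.\<close>

lemma loc_abs_continuous_integral:
  fixes h :: "real \<Rightarrow> 'b::euclidean_space"
  assumes h: "\<And>b. 0 \<le> b \<Longrightarrow> h absolutely_integrable_on {0..b}"
  shows "loc_abs_continuous (\<lambda>t. c + integral {0..t} h)"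
  unfolding loc_abs_continuous_def
proof (intro allI impI)
  fix b \<epsilon> :: real assume b: "0 \<le> b" and \<epsilon>: "0 < \<epsilon>"
  define m where "m n x = min (norm (h x)) (real n)" for n x
  have nI: "(\<lambda>x. norm (h x)) integrable_on {0..b}" using h[OF b] by (simp add: absolutely_integrable_on_def)
  have mI: "m n integrable_on {0..b}" for n
    unfolding m_def using absolutely_integrable_norm[OF h[OF b]]
    by (intro set_lebesgue_integral_eq_integral(1) absolutely_integrable_min_1 absolutely_integrable_on_const)
       (auto simp: o_def)
  have "(\<lambda>n. integral {0..b} (m n)) \<longlonglongrightarrow> integral {0..b} (\<lambda>x. norm (h x))"
  proof (rule dominated_convergence(2)[OF mI nI])
    show "norm (m n x) \<le> norm (h x)" for n x by (simp add: m_def)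
    show "(\<lambda>n. m n x) \<longlonglongrightarrow> norm (h x)" for x
    proof -
      obtain k where "norm (h x) \<le> real k" using real_arch_simple by blast
      then have "\<forall>\<^sub>F n in sequentially. m n x = norm (h x)"
        by (intro eventually_sequentiallyI[of k]) (auto simp: m_def)
      then show ?thesis by (rule tendsto_eventually)
    qed
  qed
  then have "\<forall>\<^sub>F n in sequentially. dist (integral {0..b} (m n)) (integral {0..b} (\<lambda>x. norm (h x))) < \<epsilon> / 2"
    using \<epsilon> by (intro tendstoD) auto
  then obtain n where n: "dist (integral {0..b} (m n)) (integral {0..b} (\<lambda>x. norm (h x))) < \<epsilon> / 2"
    by (auto simp: eventually_sequentially)
  define r where "r x = norm (h x) - m n x" for x
  have rI: "r integrable_on {0..b}" unfolding r_def by (intro integrable_diff nI mI)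
  have r0: "0 \<le> r x" for x by (simp add: r_def m_def)
  have r\<epsilon>: "integral {0..b} r < \<epsilon> / 2"
    using n unfolding r_def integral_diff[OF nI mI] dist_real_def by linarith
  show "\<exists>\<delta>>0. \<forall>D. finite D \<and> (\<forall>(s, t)\<in>D. 0 \<le> s \<and> s \<le> t \<and> t \<le> b) \<and>
        pairwise (\<lambda>(s, t) (s', t'). {s<..<t} \<inter> {s'<..<t'} = {}) D \<and>
        (\<Sum>(s, t)\<in>D. t - s) < \<delta> \<longrightarrow>
        (\<Sum>(s, t)\<in>D. norm (c + integral {0..t} h - (c + integral {0..s} h))) < \<epsilon>"
  proof (intro exI[of _ "\<epsilon> / (2 * (real n + 1))"] conjI allI impI)
    show "0 < \<epsilon> / (2 * (real n + 1))" using \<epsilon> by simp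
    fix D assume asm: "finite D \<and> (\<forall>(s, t)\<in>D. 0 \<le> s \<and> s \<le> t \<and> t \<le> b) \<and>
        pairwise (\<lambda>(s, t) (s', t'). {s<..<t} \<inter> {s'<..<t'} = {}) D \<and>
        (\<Sum>(s, t)\<in>D. t - s) < \<epsilon> / (2 * (real n + 1))"
    have D: "\<And>p. p \<in> D \<Longrightarrow> 0 \<le> fst p \<and> fst p \<le> snd p \<and> snd p \<le> b"
      "\<And>p q. p \<in> D \<Longrightarrow> q \<in> D \<Longrightarrow> p \<noteq> q \<Longrightarrow> {fst p<..<snd p} \<inter> {fst q<..<snd q} = {}"
      using asm by (auto simp: pairwise_def split_beta)
    have "norm (c + integral {0..snd p} h - (c + integral {0..fst p} h))
       \<le> real n * (snd p - fst p) + integral {fst p..snd p} r" if p: "p \<in> D" for p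
    proof -
      note pp = D(1)[OF p]
      have hI: "h integrable_on {0..snd p}" using h[of "snd p"] pp by (auto intro: set_lebesgue_integral_eq_integral(1))
      have sub: "f integrable_on {fst p..snd p}" if "f integrable_on {0..b}" for f :: "real \<Rightarrow> real"
        by (rule integrable_on_subinterval[OF that]) (use pp in auto)
      have "integral {0..fst p} h + integral {fst p..snd p} h = integral {0..snd p} h"
        using pp by (intro Henstock_Kurzweil_Integration.integral_combine hI) auto
      then have "norm (c + integral {0..snd p} h - (c + integral {0..fst p} h)) = norm (integral {fst p..snd p} h)"
        by (metis add_diff_cancel_left add_diff_cancel_left')
      also have "\<dots> \<le> integral {fst p..snd p} (\<lambda>x. real n + r x)"
      proof (rule integral_norm_bound_integral)
        show "h integrable_on {fst p..snd p}" by (rule integrable_on_subinterval[OF hI]) (use pp in auto)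
        show "(\<lambda>x. real n + r x) integrable_on {fst p..snd p}"
          by (intro integrable_add sub rI) auto
      qed (auto simp: r_def m_def)
      also have "\<dots> = real n * (snd p - fst p) + integral {fst p..snd p} r"
        using pp by (subst integral_add) (auto intro!: sub rI)
      finally show ?thesis .
    qed
    then have "(\<Sum>(s, t)\<in>D. norm (c + integral {0..t} h - (c + integral {0..s} h)))
       \<le> (\<Sum>p\<in>D. real n * (snd p - fst p) + integral {fst p..snd p} r)"
      unfolding split_beta by (rule sum_mono)
    also have "\<dots> = real n * (\<Sum>p\<in>D. snd p - fst p) + (\<Sum>p\<in>D. integral {fst p..snd p} r)"
      by (simp add: sum.distrib sum_distrib_left)
    also have "(\<Sum>p\<in>D. integral {fst p..snd p} r) \<le> integral {0..b} r"
      using asm by (intro sum_integral_nonoverlapping_le rI r0 D) auto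
    also have "real n * (\<Sum>p\<in>D. snd p - fst p) \<le> (real n + 1) * (\<epsilon> / (2 * (real n + 1)))"
      using asm D by (intro mult_mono) (auto simp: split_beta intro!: sum_nonneg)
    also have "(real n + 1) * (\<epsilon> / (2 * (real n + 1))) + integral {0..b} r < \<epsilon>"
    proof -
      have *: "(real n + 1) * (\<epsilon> / (2 * (real n + 1))) = \<epsilon> / 2" by (simp add: field_simps)
      show ?thesis unfolding * using r\<epsilon> by linarith
    qed
    finally show "(\<Sum>(s, t)\<in>D. norm (c + integral {0..t} h - (c + integral {0..s} h))) < \<epsilon>" by simp
  qed
qed

text \<open>Absolute continuity for indexed families of intervals. A set of pairs would identify equal
intervals with distinct indices, but only degenerate intervals can be equal, and these do not
contribute to the sums.\<close>

lemma loc_abs_continuousD: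
  assumes "loc_abs_continuous x" "0 \<le> b" "0 < \<epsilon>"
  obtains \<delta> where "0 < \<delta>" "\<And>(D :: 'i set) lo hi. finite D \<Longrightarrow> (\<forall>i\<in>D. 0 \<le> lo i \<and> lo i \<le> hi i \<and> hi i \<le> b) \<Longrightarrow>
     (\<forall>i\<in>D. \<forall>j\<in>D. i \<noteq> j \<longrightarrow> {lo i<..<hi i} \<inter> {lo j<..<hi j} = {}) \<Longrightarrow> (\<Sum>i\<in>D. hi i - lo i) < \<delta> \<Longrightarrow>
     (\<Sum>i\<in>D. norm (x (hi i) - x (lo i))) < \<epsilon>"
proof -
  obtain \<delta> where \<delta>: "0 < \<delta>" and *: "\<And>D. finite D \<Longrightarrow> (\<forall>(s, t)\<in>D. 0 \<le> s \<and> s \<le> t \<and> t \<le> b) \<Longrightarrow>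
        pairwise (\<lambda>(s, t) (s', t'). {s<..<t} \<inter> {s'<..<t'} = {}) D \<Longrightarrow>
        (\<Sum>(s, t)\<in>D. t - s) < \<delta> \<Longrightarrow> (\<Sum>(s, t)\<in>D. norm (x t - x s)) < \<epsilon>"
    using assms unfolding loc_abs_continuous_def by meson
  show ?thesis
  proof (rule that[OF \<delta>])
    fix D :: "'i set" and lo hi
    assume fin: "finite D" and bd: "\<forall>i\<in>D. 0 \<le> lo i \<and> lo i \<le> hi i \<and> hi i \<le> b"
      and dis: "\<forall>i\<in>D. \<forall>j\<in>D. i \<noteq> j \<longrightarrow> {lo i<..<hi i} \<inter> {lo j<..<hi j} = {}"
      and small: "(\<Sum>i\<in>D. hi i - lo i) < \<delta>"
    define A where "A = {i\<in>D. lo i < hi i}"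
    have A: "finite A" "A \<subseteq> D" using fin by (auto simp: A_def)
    have inj: "inj_on (\<lambda>i. (lo i, hi i)) A"
    proof (rule inj_onI, rule ccontr)
      fix i j assume ij: "i \<in> A" "j \<in> A" "(lo i, hi i) = (lo j, hi j)" "i \<noteq> j"
      then have "{lo i<..<hi i} = {}" using dis A(2) by (metis Int_absorb Pair_inject subsetD)
      then show False using ij(1) by (auto simp: A_def)
    qed
    have "(\<Sum>i\<in>A. norm (x (hi i) - x (lo i))) = (\<Sum>(s, t)\<in>(\<lambda>i. (lo i, hi i)) ` A. norm (x t - x s))"
      by (subst sum.reindex[OF inj]) simp
    also have "\<dots> < \<epsilon>"
    proof (rule *)
      show "pairwise (\<lambda>(s, t) (s', t'). {s<..<t} \<inter> {s'<..<t'} = {}) ((\<lambda>i. (lo i, hi i)) ` A)"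
        unfolding pairwise_image using dis A(2) by (auto simp: pairwise_def)
      have "(\<Sum>i\<in>A. hi i - lo i) \<le> (\<Sum>i\<in>D. hi i - lo i)" using bd A fin by (intro sum_mono2) auto
      then show "(\<Sum>(s, t)\<in>(\<lambda>i. (lo i, hi i)) ` A. t - s) < \<delta>"
        using small by (subst sum.reindex[OF inj]) simp
    qed (use A bd in auto)
    also have "(\<Sum>i\<in>A. norm (x (hi i) - x (lo i))) = (\<Sum>i\<in>D. norm (x (hi i) - x (lo i)))"
      using bd A fin by (intro sum.mono_neutral_left) (fastforce simp: A_def order_le_less)+
    finally show "(\<Sum>i\<in>D. norm (x (hi i) - x (lo i))) < \<epsilon>" .
  qed
qed

text \<open>A Henstock gauge is chosen that makes every interval tagged outside the exceptional null set so
short that the increment of \<open>x\<close> is nearly linear. Intervals tagged in the null set are confined to an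
open set of small measure, so that absolute continuity makes their increments small as well.\<close>

theorem loc_abs_continuous_FTC:
  fixes x :: "real \<Rightarrow> 'b::euclidean_space"
  assumes x: "loc_abs_continuous x"
    and d: "AE t in lebesgue_on {0..}. (x has_vector_derivative d t) (at t within {0..})"
    and b: "0 \<le> b"
  shows "(d has_integral x b - x 0) {0..b}"
proof -
  obtain N where N: "N \<in> null_sets lebesgue" "\<And>t. 0 \<le> t \<Longrightarrow> t \<notin> N \<Longrightarrow> (x has_vector_derivative d t) (at t within {0..})"
  proof -
    have "AE t in lebesgue. t \<in> {0..} \<longrightarrow> (x has_vector_derivative d t) (at t within {0..})"
      using d by (subst (asm) AE_restrict_space_iff) auto
    then show ?thesis using that by (auto elim!: AE_E3)
  qed
  define d' where "d' t = (if t \<in> N then 0 else d t)" for t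
  have "(d' has_integral x b - x 0) (cbox 0 b)"
    unfolding has_integral
  proof (intro allI impI)
    fix e :: real assume e: "0 < e"
    define e' where "e' = e / (2 * (b + 1))"
    have e': "0 < e'" using e b by (simp add: e'_def)
    have e2: "0 < e / 2" using e by simp
    obtain \<delta> where \<delta>: "0 < \<delta>" and AC: "\<And>(D :: (real \<times> real set) set) lo hi. finite D \<Longrightarrow>
       (\<forall>i\<in>D. 0 \<le> lo i \<and> lo i \<le> hi i \<and> hi i \<le> b) \<Longrightarrow>
       (\<forall>i\<in>D. \<forall>j\<in>D. i \<noteq> j \<longrightarrow> {lo i<..<hi i} \<inter> {lo j<..<hi j} = {}) \<Longrightarrow> (\<Sum>i\<in>D. hi i - lo i) < \<delta> \<Longrightarrow>
       (\<Sum>i\<in>D. norm (x (hi i) - x (lo i))) < e / 2"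
      by (rule loc_abs_continuousD[OF x b e2, where 'i="real \<times> real set"]) (rule that)
    obtain W where W: "open W" "N \<subseteq> W" "W \<in> lmeasurable" "measure lebesgue W < \<delta>"
    proof -
      obtain W where W: "open W" "N \<subseteq> W" "W - N \<in> lmeasurable" "emeasure lebesgue (W - N) < ennreal \<delta>"
        using sets_lebesgue_outer_open[of N \<delta>] N(1) \<delta> by (auto simp: null_sets_def)
      have "W = (W - N) \<union> N" using W(2) by auto
      moreover have "N \<in> lmeasurable" using N(1) by (simp add: negligible_iff_null_sets[symmetric] negligible_imp_measurable)
      ultimately have WL: "W \<in> lmeasurable" using W(3) by (metis fmeasurable.Un)
      moreover have "measure lebesgue W = measure lebesgue (W - N)"
        using measure_Diff_null_set[OF fmeasurableD[OF WL] N(1)] by simp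
      moreover have "measure lebesgue (W - N) < \<delta>"
        using W(3,4) \<delta> by (simp add: emeasure_eq_measure2 ennreal_less_iff)
      ultimately show ?thesis using that W by metis
    qed
    have "\<forall>t. \<exists>r>0. 0 \<le> t \<longrightarrow> t \<notin> N \<longrightarrow> (\<forall>y\<in>{0..}. \<bar>y - t\<bar> < r \<longrightarrow> norm (x y - x t - (y - t) *\<^sub>R d t) \<le> e' * \<bar>y - t\<bar>)"
    proof
      fix t
      show "\<exists>r>0. 0 \<le> t \<longrightarrow> t \<notin> N \<longrightarrow> (\<forall>y\<in>{0..}. \<bar>y - t\<bar> < r \<longrightarrow> norm (x y - x t - (y - t) *\<^sub>R d t) \<le> e' * \<bar>y - t\<bar>)"
      proof (cases "0 \<le> t \<and> t \<notin> N")
        case True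
        then show ?thesis using N(2)[of t] e' unfolding has_vector_derivative_def has_derivative_within_alt by auto
      qed (auto intro: exI[of _ 1])
    qed
    then obtain r where r: "\<And>t. 0 < r t" "\<And>t y. 0 \<le> t \<Longrightarrow> t \<notin> N \<Longrightarrow> 0 \<le> y \<Longrightarrow> \<bar>y - t\<bar> < r t \<Longrightarrow>
        norm (x y - x t - (y - t) *\<^sub>R d t) \<le> e' * \<bar>y - t\<bar>" by (metis atLeast_iff)
    define \<gamma> where "\<gamma> t = (if t \<in> N then W else ball t (r t))" for t
    have "gauge \<gamma>" using W r(1) by (auto simp: gauge_def \<gamma>_def)
    moreover have "norm ((\<Sum>(t, k)\<in>D. measure lborel k *\<^sub>R d' t) - (x b - x 0)) < e"
      if D: "D tagged_division_of cbox 0 b" and fine: "\<gamma> fine D" for D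
    proof -
      have finD: "finite D" using D by (rule tagged_division_of_finite)
      define lo where "lo = (\<lambda>i :: real \<times> real set. Inf (snd i))"
      define hi where "hi = (\<lambda>i :: real \<times> real set. Sup (snd i))"
      have K: "snd i = {lo i..hi i}" "lo i \<le> hi i" "0 \<le> lo i" "hi i \<le> b" "fst i \<in> {lo i..hi i}"
         "snd i \<subseteq> \<gamma> (fst i)" "measure lborel (snd i) = hi i - lo i" if i: "i \<in> D" for i
      proof -
        obtain t k where ik: "i = (t, k)" by (cases i)
        obtain p q where k: "k = {p..q}" using tagged_division_ofD(4)[OF D i[unfolded ik]] by (auto simp: box_real)
        have t: "t \<in> k" "k \<subseteq> {0..b}" using tagged_division_ofD(2,3)[OF D i[unfolded ik]] by auto
        then have pq: "p \<le> q" using k by auto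
        have lh: "lo i = p" "hi i = q" using k pq by (auto simp: lo_def hi_def ik)
        show "snd i = {lo i..hi i}" "lo i \<le> hi i" "0 \<le> lo i" "hi i \<le> b" "fst i \<in> {lo i..hi i}" "measure lborel (snd i) = hi i - lo i"
          using t pq k unfolding lh by (auto simp: ik)
        show "snd i \<subseteq> \<gamma> (fst i)" using fineD[OF fine i[unfolded ik]] by (simp add: ik)
      qed
      have dis: "{lo i<..<hi i} \<inter> {lo j<..<hi j} = {}" if "i \<in> D" "j \<in> D" "i \<noteq> j" for i j
      proof -
        have "interior (snd i) \<inter> interior (snd j) = {}"
          using tagged_division_ofD(5)[OF D, of "fst i" "snd i" "fst j" "snd j"] that by simp
        then show ?thesis using K(1)[OF that(1)] K(1)[OF that(2)] by (simp del: Int_atLeastAtMost greaterThanLessThan_eq)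
      qed
      have tel: "(\<Sum>i\<in>D. x (hi i) - x (lo i)) = x b - x 0"
        using additive_tagged_division_1[OF b D[unfolded box_real], of x] by (simp add: lo_def hi_def split_beta)
      have "(\<Sum>(t, k)\<in>D. measure lborel k *\<^sub>R d' t) - (x b - x 0) = (\<Sum>i\<in>D. (hi i - lo i) *\<^sub>R d' (fst i) - (x (hi i) - x (lo i)))"
        unfolding tel[symmetric] sum_subtractf by (simp add: split_beta K(7) cong: sum.cong)
      also have "norm \<dots> \<le> (\<Sum>i\<in>D. norm ((hi i - lo i) *\<^sub>R d' (fst i) - (x (hi i) - x (lo i))))" by (rule norm_sum)
      also have "\<dots> \<le> (\<Sum>i\<in>D. e' * (hi i - lo i) + (if fst i \<in> N then norm (x (hi i) - x (lo i)) else 0))"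
      proof (rule sum_mono)
        fix i assume i: "i \<in> D"
        show "norm ((hi i - lo i) *\<^sub>R d' (fst i) - (x (hi i) - x (lo i))) \<le>
            e' * (hi i - lo i) + (if fst i \<in> N then norm (x (hi i) - x (lo i)) else 0)"
        proof (cases "fst i \<in> N")
          case True
          then show ?thesis using e' K(2)[OF i] by (simp add: d'_def norm_minus_commute)
        next
          case False
          define t where "t = fst i"
          have "snd i \<subseteq> ball t (r t)" using K(6)[OF i] False by (simp add: \<gamma>_def t_def)
          moreover have "lo i \<in> snd i" "hi i \<in> snd i" using K(1,2)[OF i] by auto
          ultimately have nb: "\<bar>lo i - t\<bar> < r t" "\<bar>hi i - t\<bar> < r t" by (auto simp: dist_real_def)
          have t: "0 \<le> t" "lo i \<le> t" "t \<le> hi i" "t \<notin> N" using K(2-5)[OF i] False by (auto simp: t_def)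
          have n12: "norm (x (lo i) - x t - (lo i - t) *\<^sub>R d t) \<le> e' * \<bar>lo i - t\<bar>"
               "norm (x (hi i) - x t - (hi i - t) *\<^sub>R d t) \<le> e' * \<bar>hi i - t\<bar>"
            using r(2)[OF t(1,4) K(3)[OF i] nb(1)] r(2)[OF t(1,4) _ nb(2)] t by auto
          have eq: "(hi i - lo i) *\<^sub>R d t - (x (hi i) - x (lo i)) =
             (x (lo i) - x t - (lo i - t) *\<^sub>R d t) - (x (hi i) - x t - (hi i - t) *\<^sub>R d t)"
            by (simp add: algebra_simps)
          have "norm ((hi i - lo i) *\<^sub>R d t - (x (hi i) - x (lo i))) \<le> e' * \<bar>lo i - t\<bar> + e' * \<bar>hi i - t\<bar>"
            unfolding eq by (rule order_trans[OF norm_triangle_ineq4 add_mono[OF n12]])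
          also have "\<dots> = e' * (hi i - lo i)" using t by (simp add: algebra_simps)
          finally show ?thesis using False by (simp add: d'_def t_def)
        qed
      qed
      also have "\<dots> = e' * (\<Sum>i\<in>D. hi i - lo i) + (\<Sum>i\<in>{i\<in>D. fst i \<in> N}. norm (x (hi i) - x (lo i)))"
        using finD by (simp add: sum.distrib sum_distrib_left sum.inter_filter)
      also have "(\<Sum>i\<in>{i\<in>D. fst i \<in> N}. norm (x (hi i) - x (lo i))) < e / 2"
      proof (rule AC)
        have WI: "(\<lambda>x. if x \<in> W then 1 else 0 :: real) integrable_on {0..b}"
          unfolding integrable_restrict_Int using W(3)
          by (metis lmeasurable_iff_integrable_on lmeasurable_interval(1) fmeasurable.Int box_real(2))
        have "(\<Sum>i\<in>{i\<in>D. fst i \<in> N}. hi i - lo i) =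
            (\<Sum>i\<in>{i\<in>D. fst i \<in> N}. integral {lo i..hi i} (\<lambda>x. if x \<in> W then 1 else 0 :: real))"
        proof (rule sum.cong)
          fix i assume i: "i \<in> {i\<in>D. fst i \<in> N}"
          then have "{lo i..hi i} \<subseteq> W" using K(1,6)[of i] by (auto simp: \<gamma>_def)
          then have "integral {lo i..hi i} (\<lambda>x. if x \<in> W then 1 else 0 :: real) = integral {lo i..hi i} (\<lambda>x. 1)"
            by (intro integral_cong) auto
          then show "hi i - lo i = integral {lo i..hi i} (\<lambda>x. if x \<in> W then 1 else 0 :: real)"
            using K(2)[of i] i by simp
        qed simp
        also have "\<dots> \<le> integral {0..b} (\<lambda>x. if x \<in> W then 1 else 0 :: real)"
          using finD K(2-4) dis by (intro sum_integral_nonoverlapping_le WI) auto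
        also have "\<dots> = measure lebesgue (W \<inter> {0..b})"
          unfolding integral_restrict_Int using W(3)
          by (metis lmeasure_integral lmeasurable_interval(1) fmeasurable.Int box_real(2))
        also have "\<dots> \<le> measure lebesgue W"
          using W(3) by (intro measure_mono_fmeasurable) (auto simp: fmeasurableD)
        finally show "(\<Sum>i\<in>{i\<in>D. fst i \<in> N}. hi i - lo i) < \<delta>" using W(4) by simp
      qed (use finD K dis in auto)
      also have "(\<Sum>i\<in>D. hi i - lo i) = b"
        using additive_tagged_division_1[OF b D[unfolded box_real], of "\<lambda>x. x"] by (simp add: lo_def hi_def split_beta)
      also have "e' * b \<le> e / 2" using e b by (simp add: e'_def field_simps)
      finally show ?thesis by simp
    qed
    ultimately show "\<exists>\<gamma>. gauge \<gamma> \<and> (\<forall>D. D tagged_division_of cbox 0 b \<and> \<gamma> fine D \<longrightarrow>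
       norm ((\<Sum>(t, k)\<in>D. measure lborel k *\<^sub>R d' t) - (x b - x 0)) < e)"
      by (intro exI[of _ \<gamma>]) simp
  qed
  then have "(d' has_integral x b - x 0) {0..b}" by (simp add: box_real)
  then show ?thesis
    by (rule has_integral_spike[OF N(1)[folded negligible_iff_null_sets], rotated]) (simp add: d'_def)
qed

corollary loc_abs_continuous_FTC_interval:
  fixes x :: "real \<Rightarrow> 'b::euclidean_space"
  assumes x: "loc_abs_continuous x"
    and d: "AE t in lebesgue_on {0..}. (x has_vector_derivative d t) (at t within {0..})"
    and ab: "0 \<le> a" "a \<le> b"
  shows "(d has_integral x b - x a) {a..b}"
proof -
  have b: "(d has_integral x b - x 0) {0..b}" and a: "(d has_integral x a - x 0) {0..a}"
    using loc_abs_continuous_FTC[OF x d] ab by auto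
  have I: "d integrable_on {a..b}"
    by (rule integrable_on_subinterval[OF has_integral_integrable[OF b]]) (use ab in auto)
  have "integral {0..a} d + integral {a..b} d = integral {0..b} d"
    using ab b by (intro Henstock_Kurzweil_Integration.integral_combine has_integral_integrable) auto
  then have "integral {a..b} d = x b - x a"
    using integral_unique[OF a] integral_unique[OF b] by (simp add: algebra_simps)
  then show ?thesis using I by (metis has_integral_integral)
qed

lemma loc_abs_continuous_continuous_on:
  assumes x: "loc_abs_continuous x"
  shows "continuous_on {0..} x"
  unfolding continuous_on_iff
proof (intro ballI allI impI)
  fix t e :: real assume t: "t \<in> {0..}" and e: "0 < e"
  obtain \<delta> where \<delta>: "0 < \<delta>" and AC: "\<And>(D :: unit set) lo hi. finite D \<Longrightarrow>
     (\<forall>i\<in>D. 0 \<le> lo i \<and> lo i \<le> hi i \<and> hi i \<le> t + 1) \<Longrightarrow>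
     (\<forall>i\<in>D. \<forall>j\<in>D. i \<noteq> j \<longrightarrow> {lo i<..<hi i} \<inter> {lo j<..<hi j} = {}) \<Longrightarrow> (\<Sum>i\<in>D. hi i - lo i) < \<delta> \<Longrightarrow>
     (\<Sum>i\<in>D. norm (x (hi i) - x (lo i))) < e"
    by (rule loc_abs_continuousD[OF x _ e, of "t + 1", where 'i=unit]) (use t in simp, rule that)
  have *: "norm (x v - x u) < e" if "0 \<le> u" "u \<le> v" "v \<le> t + 1" "v - u < \<delta>" for u v
    using AC[of UNIV "\<lambda>_. u" "\<lambda>_. v"] that by (simp add: UNIV_unit)
  have "dist (x s) (x t) < e" if "s \<in> {0..}" "dist s t < min \<delta> 1" for s
    using *[of s t] *[of t s] that t unfolding dist_norm
    by (cases "s \<le> t") (auto simp: norm_minus_commute abs_real_def split: if_splits)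
  then show "\<exists>d>0. \<forall>s\<in>{0..}. dist s t < d \<longrightarrow> dist (x s) (x t) < e"
    using \<delta> by (intro exI[of _ "min \<delta> 1"]) auto
qed

text \<open>This criterion covers products and smooth functions of absolutely continuous functions.\<close>

lemma loc_abs_continuous_dominated:
  assumes x: "loc_abs_continuous x" and y: "loc_abs_continuous y"
    and z: "\<And>b. 0 \<le> b \<Longrightarrow> \<exists>C. \<forall>s\<in>{0..b}. \<forall>t\<in>{0..b}. norm (z t - z s) \<le> C * (norm (x t - x s) + norm (y t - y s))"
  shows "loc_abs_continuous z"
  unfolding loc_abs_continuous_def
proof (intro allI impI)
  fix b \<epsilon> :: real assume b: "0 \<le> b" and \<epsilon>: "0 < \<epsilon>"
  obtain C0 where C0: "\<And>s t. s \<in> {0..b} \<Longrightarrow> t \<in> {0..b} \<Longrightarrow> norm (z t - z s) \<le> C0 * (norm (x t - x s) + norm (y t - y s))"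
    using z[OF b] by blast
  define C where "C = \<bar>C0\<bar> + 1"
  have C: "0 < C" by (simp add: C_def)
  have Cz: "norm (z t - z s) \<le> C * (norm (x t - x s) + norm (y t - y s))" if "s \<in> {0..b}" "t \<in> {0..b}" for s t
    by (rule order_trans[OF C0[OF that] mult_right_mono]) (auto simp: C_def)
  define e where "e = \<epsilon> / (2 * C)"
  have e: "0 < e" using \<epsilon> C by (simp add: e_def)
  obtain d1 where d1: "0 < d1" "\<And>D. finite D \<Longrightarrow> (\<forall>(s, t)\<in>D. 0 \<le> s \<and> s \<le> t \<and> t \<le> b) \<Longrightarrow>
        pairwise (\<lambda>(s, t) (s', t'). {s<..<t} \<inter> {s'<..<t'} = {}) D \<Longrightarrow>
        (\<Sum>(s, t)\<in>D. t - s) < d1 \<Longrightarrow> (\<Sum>(s, t)\<in>D. norm (x t - x s)) < e"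
    using x b e unfolding loc_abs_continuous_def by meson
  obtain d2 where d2: "0 < d2" "\<And>D. finite D \<Longrightarrow> (\<forall>(s, t)\<in>D. 0 \<le> s \<and> s \<le> t \<and> t \<le> b) \<Longrightarrow>
        pairwise (\<lambda>(s, t) (s', t'). {s<..<t} \<inter> {s'<..<t'} = {}) D \<Longrightarrow>
        (\<Sum>(s, t)\<in>D. t - s) < d2 \<Longrightarrow> (\<Sum>(s, t)\<in>D. norm (y t - y s)) < e"
    using y b e unfolding loc_abs_continuous_def by meson
  show "\<exists>\<delta>>0. \<forall>D. finite D \<and> (\<forall>(s, t)\<in>D. 0 \<le> s \<and> s \<le> t \<and> t \<le> b) \<and>
        pairwise (\<lambda>(s, t) (s', t'). {s<..<t} \<inter> {s'<..<t'} = {}) D \<and>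
        (\<Sum>(s, t)\<in>D. t - s) < \<delta> \<longrightarrow> (\<Sum>(s, t)\<in>D. norm (z t - z s)) < \<epsilon>"
  proof (intro exI[of _ "min d1 d2"] conjI allI impI)
    fix D assume asm: "finite D \<and> (\<forall>(s, t)\<in>D. 0 \<le> s \<and> s \<le> t \<and> t \<le> b) \<and>
        pairwise (\<lambda>(s, t) (s', t'). {s<..<t} \<inter> {s'<..<t'} = {}) D \<and> (\<Sum>(s, t)\<in>D. t - s) < min d1 d2"
    have "(\<Sum>(s, t)\<in>D. norm (z t - z s)) \<le> (\<Sum>(s, t)\<in>D. C * (norm (x t - x s) + norm (y t - y s)))"
      by (rule sum_mono) (use asm in \<open>auto intro!: Cz split: prod.splits\<close>)
    also have "\<dots> = C * ((\<Sum>(s, t)\<in>D. norm (x t - x s)) + (\<Sum>(s, t)\<in>D. norm (y t - y s)))"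
      by (simp add: split_beta sum.distrib sum_distrib_left distrib_left)
    also have "\<dots> < C * (e + e)"
      using asm d1(2)[of D] d2(2)[of D] by (intro mult_strict_left_mono add_strict_mono C) auto
    also have "\<dots> = \<epsilon>" using C by (simp add: e_def)
    finally show "(\<Sum>(s, t)\<in>D. norm (z t - z s)) < \<epsilon>" .
  qed (use d1 d2 in auto)
qed

section \<open>Primitives, Gronwall's inequality and Caratheodory equations\<close>

definition loc_integrable :: "(real \<Rightarrow> 'b::euclidean_space) \<Rightarrow> bool" where
  "loc_integrable h \<longleftrightarrow> (\<forall>b\<ge>0. h absolutely_integrable_on {0..b})"

lemma loc_integrable_on:
  assumes "loc_integrable h" "0 \<le> a"
  shows "h absolutely_integrable_on {a..b}" "h integrable_on {a..b}"
proof -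
  have "{a..b} \<subseteq> {0..max 0 b}" using assms(2) by auto
  have "h absolutely_integrable_on {0..max 0 b}" using assms(1) by (simp add: loc_integrable_def)
  then show h: "h absolutely_integrable_on {a..b}"
    by (rule set_integrable_subset) (use \<open>{a..b} \<subseteq> {0..max 0 b}\<close> in simp_all)
  show "h integrable_on {a..b}" by (rule set_lebesgue_integral_eq_integral(1)[OF h])
qed

lemma loc_integrable_bounded:
  assumes f: "f \<in> borel_measurable (lebesgue_on {0..})" and L: "loc_integrable (L :: real \<Rightarrow> real)"
    and le: "\<And>t. 0 \<le> t \<Longrightarrow> norm (f t) \<le> L t"
  shows "loc_integrable f"
  unfolding loc_integrable_def
proof (intro allI impI)
  fix b :: real assume "0 \<le> b"
  show "f absolutely_integrable_on {0..b}"
    by (rule measurable_bounded_by_integrable_imp_absolutely_integrable[OF _ _ loc_integrable_on(2)[OF L]])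
       (use f le in \<open>auto intro: measurable_restrict_mono\<close>)
qed

lemma loc_integrable_measurable:
  assumes "loc_integrable h"
  shows "h \<in> borel_measurable (lebesgue_on {0..})"
proof -
  have "(\<lambda>t. indicator {0..real n} t *\<^sub>R h t) \<in> borel_measurable lebesgue" for n
    using loc_integrable_on(1)[OF assms, of 0 "real n"] by (auto simp: set_integrable_def)
  then have "(\<lambda>t. indicator {0..} t *\<^sub>R h t) \<in> borel_measurable lebesgue"
  proof (rule borel_measurable_LIMSEQ_metric)
    fix t :: real
    obtain k where "t \<le> real k" using real_arch_simple by blast
    then have "\<forall>\<^sub>F n in sequentially. indicator {0..real n} t *\<^sub>R h t = indicator {0..} t *\<^sub>R h t"
      by (intro eventually_sequentiallyI[of k]) (auto simp: indicator_def)
    then show "(\<lambda>n. indicator {0..real n} t *\<^sub>R h t) \<longlonglongrightarrow> indicator {0..} t *\<^sub>R h t"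
      by (rule tendsto_eventually)
  qed
  then show ?thesis by (simp add: borel_measurable_restrict_space_iff)
qed

lemma loc_integrable_add: "loc_integrable h \<Longrightarrow> loc_integrable k \<Longrightarrow> loc_integrable (\<lambda>t. h t + k t)"
  unfolding loc_integrable_def by (auto intro: set_integral_add)

lemma loc_integrable_diff: "loc_integrable h \<Longrightarrow> loc_integrable k \<Longrightarrow> loc_integrable (\<lambda>t. h t - k t)"
  unfolding loc_integrable_def by (auto intro: set_integral_diff)

lemma loc_integrable_const: "loc_integrable (\<lambda>t. c)"
  unfolding loc_integrable_def by (auto intro!: absolutely_integrable_on_const)

lemma loc_integrable_norm: "loc_integrable h \<Longrightarrow> loc_integrable (\<lambda>t. norm (h t))"
  unfolding loc_integrable_def using absolutely_integrable_norm by (auto simp: o_def)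

lemma loc_integrable_mult_const: "loc_integrable h \<Longrightarrow> loc_integrable (\<lambda>t. c * h t :: real)"
  unfolding loc_integrable_def by auto

lemma continuous_on_imp_measurable_half_line:
  "continuous_on {0..} x \<Longrightarrow> x \<in> borel_measurable (lebesgue_on {0::real..})"
  by (intro continuous_imp_measurable_on_sets_lebesgue) auto

lemma loc_integrable_mult_continuous:
  fixes y :: "real \<Rightarrow> real"
  assumes L: "loc_integrable L" and y: "continuous_on {0..} y"
  shows "loc_integrable (\<lambda>t. L t * y t)"
  unfolding loc_integrable_def
proof (intro allI impI)
  fix b :: real assume "0 \<le> b"
  have c: "continuous_on {0..b} y" by (rule continuous_on_subset[OF y]) auto
  have "(\<lambda>t. y t * L t) absolutely_integrable_on {0..b}"
    using c loc_integrable_on(1)[OF L]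
    by (intro absolutely_integrable_bounded_measurable_product_real continuous_imp_measurable_on_sets_lebesgue)
       (auto intro!: compact_imp_bounded compact_continuous_image)
  then show "(\<lambda>t. L t * y t) absolutely_integrable_on {0..b}" by (simp add: mult.commute)
qed

lemma loc_integrable_summable: "L \<in> loc_summable \<longleftrightarrow> loc_integrable L \<and> (\<forall>t\<ge>0. 0 \<le> L t)"
  by (auto simp: loc_summable_def loc_integrable_def)

lemma loc_abs_continuous_primitive:
  "loc_integrable h \<Longrightarrow> loc_abs_continuous (\<lambda>t. c + integral {0..t} h)"
  by (rule loc_abs_continuous_integral) (simp add: loc_integrable_def)

lemma primitive_has_vector_derivative_AE:
  assumes "loc_integrable h"
  shows "AE t in lebesgue_on {0..}. ((\<lambda>t. c + integral {0..t} h) has_vector_derivative h t) (at t within {0..})"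
proof -
  have "AE t in lebesgue_on {0..}. ((\<lambda>t. integral {0..t} h) has_vector_derivative h t) (at t within {0..})"
    by (rule has_vector_derivative_indefinite_integral_AE) (use loc_integrable_on[OF assms] in auto)
  then show ?thesis
    by (rule eventually_mono) (auto intro!: derivative_eq_intros)
qed

lemma continuous_on_primitive:
  "loc_integrable h \<Longrightarrow> continuous_on {0..} (\<lambda>t. c + integral {0..t} h)"
  by (intro loc_abs_continuous_continuous_on loc_abs_continuous_primitive)

lemma primitive_diff:
  assumes "loc_integrable h" "0 \<le> a" "a \<le> b"
  shows "integral {0..b} h - integral {0..a} h = integral {a..b} h"
  using Henstock_Kurzweil_Integration.integral_combine[of 0 a b h] loc_integrable_on[OF assms(1), of 0 b] assms(2,3)
  by (simp add: algebra_simps)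

lemma integral_norm_le:
  fixes h :: "real \<Rightarrow> 'b::euclidean_space"
  assumes "loc_integrable h" "loc_integrable k" "0 \<le> a" "\<And>t. t \<in> {a..b} \<Longrightarrow> norm (h t) \<le> k t"
  shows "norm (integral {a..b} h) \<le> integral {a..b} k"
  using assms by (intro integral_norm_bound_integral loc_integrable_on) auto

lemma loc_abs_continuous_bounded:
  assumes "loc_abs_continuous x"
  obtains B where "\<And>t. t \<in> {0..b} \<Longrightarrow> norm (x t) \<le> B"
proof -
  have "bounded (x ` {0..b})"
    using loc_abs_continuous_continuous_on[OF assms]
    by (auto intro!: compact_imp_bounded compact_continuous_image elim: continuous_on_subset)
  then show ?thesis using that unfolding bounded_iff by blast
qed

lemma loc_abs_continuous_inner:
  fixes x y :: "real \<Rightarrow> 'b::real_inner"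
  assumes x: "loc_abs_continuous x" and y: "loc_abs_continuous y"
  shows "loc_abs_continuous (\<lambda>t. x t \<bullet> y t)"
proof (rule loc_abs_continuous_dominated[OF x y])
  fix b :: real
  obtain B1 where B1: "\<And>t. t \<in> {0..b} \<Longrightarrow> norm (x t) \<le> B1" using loc_abs_continuous_bounded[OF x] by blast
  obtain B2 where B2: "\<And>t. t \<in> {0..b} \<Longrightarrow> norm (y t) \<le> B2" using loc_abs_continuous_bounded[OF y] by blast
  have "norm (x t \<bullet> y t - x s \<bullet> y s) \<le> max B1 B2 * (norm (x t - x s) + norm (y t - y s))"
    if st: "s \<in> {0..b}" "t \<in> {0..b}" for s t
  proof -
    have "x t \<bullet> y t - x s \<bullet> y s = (x t - x s) \<bullet> y t + x s \<bullet> (y t - y s)" by (simp add: inner_diff_left inner_diff_right)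
    also have "norm \<dots> \<le> norm (x t - x s) * norm (y t) + norm (x s) * norm (y t - y s)"
      using norm_triangle_ineq[of "(x t - x s) \<bullet> y t" "x s \<bullet> (y t - y s)"]
        Cauchy_Schwarz_ineq2[of "x t - x s" "y t"] Cauchy_Schwarz_ineq2[of "x s" "y t - y s"] by simp
    also have "\<dots> \<le> norm (x t - x s) * max B1 B2 + max B1 B2 * norm (y t - y s)"
      using B1[OF st(1)] B2[OF st(2)] by (intro add_mono mult_left_mono mult_right_mono) auto
    finally show ?thesis by (simp add: algebra_simps)
  qed
  then show "\<exists>C. \<forall>s\<in>{0..b}. \<forall>t\<in>{0..b}. norm (x t \<bullet> y t - x s \<bullet> y s) \<le> C * (norm (x t - x s) + norm (y t - y s))"
    by blast
qed

lemma inner_primitives_has_integral: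
  fixes h k :: "real \<Rightarrow> 'b::euclidean_space"
  assumes h: "loc_integrable h" and k: "loc_integrable k" and b: "0 \<le> b"
    and x: "\<And>t. x t = c + integral {0..t} h" and y: "\<And>t. y t = d + integral {0..t} k"
  shows "((\<lambda>t. h t \<bullet> y t + x t \<bullet> k t) has_integral x b \<bullet> y b - x 0 \<bullet> y 0) {0..b}"
proof (rule loc_abs_continuous_FTC[OF _ _ b])
  have "loc_abs_continuous x" "loc_abs_continuous y"
    using loc_abs_continuous_primitive[OF h, of c] loc_abs_continuous_primitive[OF k, of d]
    unfolding x[symmetric, abs_def] y[symmetric, abs_def] by simp_all
  then show "loc_abs_continuous (\<lambda>t. x t \<bullet> y t)" by (rule loc_abs_continuous_inner)
  have "AE t in lebesgue_on {0..}. (x has_vector_derivative h t) (at t within {0..})"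
       "AE t in lebesgue_on {0..}. (y has_vector_derivative k t) (at t within {0..})"
    using primitive_has_vector_derivative_AE[OF h, of c] primitive_has_vector_derivative_AE[OF k, of d]
    unfolding x[symmetric, abs_def] y[symmetric, abs_def] by simp_all
  then show "AE t in lebesgue_on {0..}. ((\<lambda>t. x t \<bullet> y t) has_vector_derivative h t \<bullet> y t + x t \<bullet> k t) (at t within {0..})"
  proof eventually_elim
    case (elim t)
    then show ?case
      unfolding has_vector_derivative_def
      by (auto intro!: derivative_eq_intros simp: algebra_simps inner_add_left)
  qed
qed

lemma exp_primitive:
  fixes L :: "real \<Rightarrow> real"
  assumes L: "loc_integrable L"
  shows "loc_abs_continuous (\<lambda>t. exp (c * integral {0..t} L))"
    and "AE t in lebesgue_on {0..}. ((\<lambda>t. exp (c * integral {0..t} L)) has_vector_derivative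
       c * L t * exp (c * integral {0..t} L)) (at t within {0..})"
proof -
  have p: "loc_abs_continuous (\<lambda>t. integral {0..t} L)"
    using loc_abs_continuous_primitive[OF L, of 0] by simp
  show "loc_abs_continuous (\<lambda>t. exp (c * integral {0..t} L))"
  proof (rule loc_abs_continuous_dominated[OF p p])
    fix b :: real assume b: "0 \<le> b"
    obtain B where B: "\<And>t. t \<in> {0..b} \<Longrightarrow> \<bar>integral {0..t} L\<bar> \<le> B"
      using loc_abs_continuous_bounded[OF p] unfolding real_norm_def by blast
    have "\<bar>exp (c * u) - exp (c * v)\<bar> \<le> (\<bar>c\<bar> * exp (\<bar>c\<bar> * B)) * \<bar>u - v\<bar>" if "u \<in> {-B..B}" "v \<in> {-B..B}" for u v
    proof -
      have "norm (exp (c * u) - exp (c * v)) \<le> (\<bar>c\<bar> * exp (\<bar>c\<bar> * B)) * norm (u - v)"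
      proof (rule field_differentiable_bound[OF convex_real_interval(5) _ _ that])
        fix z assume "z \<in> {-B..B}"
        then have "\<bar>c\<bar> * \<bar>z\<bar> \<le> \<bar>c\<bar> * B" by (intro mult_left_mono) auto
        then have "c * z \<le> \<bar>c\<bar> * B" using abs_ge_self[of "c * z"] by (simp only: abs_mult)
        then show "norm (c * exp (c * z)) \<le> \<bar>c\<bar> * exp (\<bar>c\<bar> * B)" by (simp add: abs_mult mult_left_mono)
      qed (auto intro!: derivative_eq_intros)
      then show ?thesis by simp
    qed
    moreover have "integral {0..t} L \<in> {-B..B}" if "t \<in> {0..b}" for t
      using B[OF that] by (simp add: abs_le_iff)
    ultimately have "\<forall>s\<in>{0..b}. \<forall>t\<in>{0..b}. norm (exp (c * integral {0..t} L) - exp (c * integral {0..s} L)) \<le>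
      (\<bar>c\<bar> * exp (\<bar>c\<bar> * B)) * norm (integral {0..t} L - integral {0..s} L)"
      unfolding real_norm_def by blast
    then show "\<exists>C. \<forall>s\<in>{0..b}. \<forall>t\<in>{0..b}. norm (exp (c * integral {0..t} L) - exp (c * integral {0..s} L)) \<le>
      C * (norm (integral {0..t} L - integral {0..s} L) + norm (integral {0..t} L - integral {0..s} L))"
      by (intro exI[of _ "(\<bar>c\<bar> * exp (\<bar>c\<bar> * B)) / 2"]) (simp add: mult.assoc)
  qed
  have "AE t in lebesgue_on {0..}. ((\<lambda>t. 0 + integral {0..t} L) has_vector_derivative L t) (at t within {0..})"
    by (rule primitive_has_vector_derivative_AE[OF L])
  then show "AE t in lebesgue_on {0..}. ((\<lambda>t. exp (c * integral {0..t} L)) has_vector_derivative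
       c * L t * exp (c * integral {0..t} L)) (at t within {0..})"
  proof eventually_elim
    case (elim t)
    then have "((\<lambda>t. integral {0..t} L) has_real_derivative L t) (at t within {0..})"
      by (simp add: has_real_derivative_iff_has_vector_derivative)
    from DERIV_chain2[OF DERIV_exp DERIV_cmult[OF this, of c]]
    show ?case by (simp add: has_real_derivative_iff_has_vector_derivative ac_simps)
  qed
qed

lemma exp_primitive_has_integral:
  fixes L :: "real \<Rightarrow> real"
  assumes L: "loc_integrable L" and ab: "0 \<le> a" "a \<le> b"
  shows "((\<lambda>t. c * L t * exp (c * integral {0..t} L)) has_integral
     exp (c * integral {0..b} L) - exp (c * integral {0..a} L)) {a..b}"
  by (rule loc_abs_continuous_FTC_interval[OF exp_primitive(1)[OF L] exp_primitive(2)[OF L] ab])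

text \<open>The right-hand side \<open>z\<close> of the assumed inequality satisfies \<open>z' \<le> L z\<close>, hence \<open>exp (- \<integral> L) z\<close> does not
increase.\<close>

theorem gronwall:
  fixes y :: "real \<Rightarrow> real"
  assumes L: "loc_integrable L" "\<And>t. 0 \<le> t \<Longrightarrow> 0 \<le> L t"
    and y: "continuous_on {0..b} y" "\<And>t. t \<in> {0..b} \<Longrightarrow> y t \<le> A + integral {0..t} (\<lambda>s. L s * y s)"
    and t: "t \<in> {0..b}"
  shows "y t \<le> A * exp (integral {0..t} L)"
proof -
  define y' where "y' s = y (min s b)" for s
  have y'c: "continuous_on {0..} y'" unfolding y'_def
    by (rule continuous_on_compose2[OF y(1)]) (use t in \<open>auto intro!: continuous_intros\<close>)
  have Ly: "loc_integrable (\<lambda>s. L s * y' s)" by (rule loc_integrable_mult_continuous[OF L(1) y'c])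
  define z where "z s = A + integral {0..s} (\<lambda>s. L s * y' s)" for s
  have zc: "loc_abs_continuous z" unfolding z_def by (rule loc_abs_continuous_primitive[OF Ly])
  have yz: "y s \<le> z s" if "s \<in> {0..b}" for s
  proof -
    have "integral {0..s} (\<lambda>s. L s * y' s) = integral {0..s} (\<lambda>s. L s * y s)"
      using that by (intro integral_cong) (auto simp: y'_def min_def)
    then show ?thesis using y(2)[OF that] by (simp add: z_def)
  qed
  define E where "E s = exp ((-1) * integral {0..s} L)" for s
  note Ec = exp_primitive[OF L(1), of "-1", folded E_def]
  have "loc_abs_continuous (\<lambda>s. E s * z s)" using loc_abs_continuous_inner[OF Ec(1) zc] by simp
  moreover have "AE s in lebesgue_on {0..}. (z has_vector_derivative L s * y' s) (at s within {0..})"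
    using primitive_has_vector_derivative_AE[OF Ly, of A] by (simp add: z_def[abs_def])
  then have "AE s in lebesgue_on {0..}. ((\<lambda>s. E s * z s) has_vector_derivative E s * L s * (y' s - z s)) (at s within {0..})"
    using Ec(2)
    by eventually_elim (auto simp: has_real_derivative_iff_has_vector_derivative[symmetric] algebra_simps
        intro!: derivative_eq_intros)
  ultimately have "((\<lambda>s. E s * L s * (y' s - z s)) has_integral E t * z t - E 0 * z 0) {0..t}"
    using t by (intro loc_abs_continuous_FTC_interval) auto
  then have "((\<lambda>s. - (E s * L s * (y' s - z s))) has_integral - (E t * z t - E 0 * z 0)) {0..t}"
    by (rule has_integral_neg)
  then have "0 \<le> - (E t * z t - E 0 * z 0)"
  proof (rule has_integral_nonneg)
    fix s assume s: "s \<in> {0..t}"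
    then have "y' s \<le> z s" using t yz[of s] by (simp add: y'_def min_def)
    then have "E s * L s * (y' s - z s) \<le> 0" using L(2)[of s] s by (intro mult_nonneg_nonpos) (auto simp: E_def)
    then show "0 \<le> - (E s * L s * (y' s - z s))" by simp
  qed
  then have "E t * z t \<le> A" by (simp add: E_def z_def)
  then have "exp (integral {0..t} L) * (E t * z t) \<le> exp (integral {0..t} L) * A" by (intro mult_left_mono) auto
  then have "z t \<le> A * exp (integral {0..t} L)" by (simp add: E_def exp_minus field_simps)
  then show ?thesis using yz[OF t] by linarith
qed

text \<open>Along a step function the superposition is measurable; \<open>x\<close> is the limit of step functions.\<close>

lemma measurable_superposition_continuous:
  fixes G :: "real \<Rightarrow> 'e::real_normed_vector \<Rightarrow> 'b::metric_space" and x :: "real \<Rightarrow> 'e"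
  assumes G: "\<And>y. (\<lambda>t. G t y) \<in> borel_measurable (lebesgue_on {0..})"
    and c: "\<And>t. 0 \<le> t \<Longrightarrow> continuous_on UNIV (G t)" and x: "continuous_on {0..} x"
  shows "(\<lambda>t. G t (x t)) \<in> borel_measurable (lebesgue_on {0..})"
proof (rule borel_measurable_LIMSEQ_metric)
  define s where "s n t = real_of_int \<lfloor>real (Suc n) * t\<rfloor> / real (Suc n)" for n t
  show "(\<lambda>t. G t (x (s n t))) \<in> borel_measurable (lebesgue_on {0..})" for n
    unfolding s_def
  proof (rule measurable_compose_countable[of "\<lambda>i t. G t (x (real_of_int i / real (Suc n)))"])
    show "(\<lambda>t. \<lfloor>real (Suc n) * t\<rfloor>) \<in> lebesgue_on {0..} \<rightarrow>\<^sub>M count_space UNIV"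
      by (rule measurable_compose[OF _ measurable_real_floor]) (intro continuous_on_imp_measurable_half_line continuous_intros)
  qed (rule G)
  fix t assume "t \<in> space (lebesgue_on {0::real..})"
  then have t: "0 \<le> t" by simp
  have s0: "0 \<le> s n t" for n using t by (simp add: s_def)
  have "\<bar>s n t - t\<bar> \<le> 1 / real (Suc n)" for n
  proof -
    have "real_of_int \<lfloor>real (Suc n) * t\<rfloor> \<le> real (Suc n) * t" "real (Suc n) * t \<le> real_of_int \<lfloor>real (Suc n) * t\<rfloor> + 1" by linarith+
    then have "\<bar>real_of_int \<lfloor>real (Suc n) * t\<rfloor> - real (Suc n) * t\<bar> \<le> 1" by linarith
    moreover have "s n t - t = (real_of_int \<lfloor>real (Suc n) * t\<rfloor> - real (Suc n) * t) / real (Suc n)"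
      by (simp add: s_def diff_divide_distrib del: of_nat_Suc)
    ultimately show ?thesis by (simp add: divide_right_mono del: of_nat_Suc)
  qed
  then have "(\<lambda>n. s n t - t) \<longlonglongrightarrow> 0"
    by (intro Lim_null_comparison[OF _ LIMSEQ_inverse_real_of_nat]) (auto simp: inverse_eq_divide simp del: of_nat_Suc)
  then have "(\<lambda>n. s n t) \<longlonglongrightarrow> t" by (simp add: LIM_zero_iff)
  then have "(\<lambda>n. x (s n t)) \<longlonglongrightarrow> x t"
    using s0 t by (intro continuous_on_tendsto_compose[OF x]) auto
  then show "(\<lambda>n. G t (x (s n t))) \<longlonglongrightarrow> G t (x t)"
    by (intro continuous_on_tendsto_compose[OF c[OF t]]) auto
qed

lemma continuous_on_max_primitive:
  assumes "loc_integrable h"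
  shows "continuous_on S (\<lambda>t. integral {0..max 0 t} h)"
proof -
  have "continuous_on {0..} (\<lambda>t. 0 + integral {0..t} h)" by (rule continuous_on_primitive[OF assms])
  then show ?thesis
    by (intro continuous_on_compose2[of "{0..}" "\<lambda>t. integral {0..t} h" S "max 0"]) (auto intro!: continuous_intros)
qed

text \<open>By this integral, the Picard operator with base point \<open>a\<close> contracts with factor one half, on both sides
of \<open>a\<close>, in the supremum norm with weight \<open>exp (- 2 W)\<close>.\<close>

lemma exp_distance_weight_integral:
  fixes L :: "real \<Rightarrow> real"
  assumes L: "loc_integrable L" and a: "0 \<le> a" and t: "0 \<le> t"
  defines "W \<equiv> \<lambda>s. \<bar>integral {0..s} L - integral {0..a} L\<bar>"
  assumes L0: "\<And>t. 0 \<le> t \<Longrightarrow> 0 \<le> L t"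
  shows "((\<lambda>s. L s * exp (2 * W s)) has_integral (exp (2 * W t) - 1) / 2) {min a t..max a t}"
proof -
  have mono: "integral {0..s} L \<le> integral {0..s'} L" if "0 \<le> s" "s \<le> s'" for s s'
  proof -
    have "0 \<le> integral {s..s'} L" using that L0 by (intro integral_nonneg loc_integrable_on[OF L]) auto
    then show ?thesis using primitive_diff[OF L that] by linarith
  qed
  show ?thesis
  proof (cases "a \<le> t")
    case True
    have "((\<lambda>s. exp (- 2 * integral {0..a} L) / 2 * (2 * L s * exp (2 * integral {0..s} L))) has_integral
       exp (- 2 * integral {0..a} L) / 2 * (exp (2 * integral {0..t} L) - exp (2 * integral {0..a} L))) {a..t}"
      by (intro has_integral_mult_right exp_primitive_has_integral L a True)
    moreover have "exp (- 2 * integral {0..a} L) / 2 * (exp (2 * integral {0..t} L) - exp (2 * integral {0..a} L))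
       = (exp (2 * W t) - 1) / 2"
      using mono[OF a True] by (simp add: W_def exp_diff exp_minus field_simps)
    ultimately have "((\<lambda>s. exp (- 2 * integral {0..a} L) / 2 * (2 * L s * exp (2 * integral {0..s} L))) has_integral
       (exp (2 * W t) - 1) / 2) {a..t}" by (simp only:)
    then have "((\<lambda>s. L s * exp (2 * W s)) has_integral (exp (2 * W t) - 1) / 2) {a..t}"
    proof (rule has_integral_eq[rotated])
      fix s assume "s \<in> {a..t}"
      then have "W s = integral {0..s} L - integral {0..a} L" using mono[of a s] a by (simp add: W_def)
      then have e: "exp (2 * W s) = exp (2 * integral {0..s} L) * exp (- 2 * integral {0..a} L)"
        unfolding exp_add[symmetric] by simp
      show "exp (- 2 * integral {0..a} L) / 2 * (2 * L s * exp (2 * integral {0..s} L)) = L s * exp (2 * W s)"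
        unfolding e by simp
    qed
    then show ?thesis using True by (simp add: min_def max_def)
  next
    case False
    have "((\<lambda>s. - (exp (2 * integral {0..a} L) / 2) * (- 2 * L s * exp (- 2 * integral {0..s} L))) has_integral
       - (exp (2 * integral {0..a} L) / 2) * (exp (- 2 * integral {0..a} L) - exp (- 2 * integral {0..t} L))) {t..a}"
      by (intro has_integral_mult_right exp_primitive_has_integral L t) (use False in auto)
    moreover have "- (exp (2 * integral {0..a} L) / 2) * (exp (- 2 * integral {0..a} L) - exp (- 2 * integral {0..t} L))
       = (exp (2 * W t) - 1) / 2"
      using mono[OF t, of a] False by (simp add: W_def exp_diff exp_minus field_simps)
    ultimately have "((\<lambda>s. - (exp (2 * integral {0..a} L) / 2) * (- 2 * L s * exp (- 2 * integral {0..s} L))) has_integral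
       (exp (2 * W t) - 1) / 2) {t..a}" by (simp only:)
    then have "((\<lambda>s. L s * exp (2 * W s)) has_integral (exp (2 * W t) - 1) / 2) {t..a}"
    proof (rule has_integral_eq[rotated])
      fix s assume "s \<in> {t..a}"
      then have "W s = integral {0..a} L - integral {0..s} L" using mono[of s a] t by (simp add: W_def)
      then have e: "exp (2 * W s) = exp (2 * integral {0..a} L) * exp (- 2 * integral {0..s} L)"
        unfolding exp_add[symmetric] by simp
      show "- (exp (2 * integral {0..a} L) / 2) * (- 2 * L s * exp (- 2 * integral {0..s} L)) = L s * exp (2 * W s)"
        unfolding e by simp
    qed
    then show ?thesis using False by (simp add: min_def max_def)
  qed
qed

text \<open>Banach's fixed point theorem for the unknown \<open>y = exp (- 2 W) x\<close> in the space of bounded continuous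
functions on the line, where \<open>W\<close> is the integral of \<open>L\<close> between \<open>a\<close> and \<open>t\<close>. The weight also keeps the
image of a bounded function bounded. The value is prescribed at an arbitrary time \<open>a\<close>: states start
at time 0, whereas adjoint arcs are determined by their terminal value.\<close>

theorem caratheodory_ode_solution:
  fixes F :: "real \<Rightarrow> 'e::euclidean_space \<Rightarrow> 'e" and L :: "real \<Rightarrow> real"
  assumes meas: "\<And>y. (\<lambda>t. F t y) \<in> borel_measurable (lebesgue_on {0..})"
    and L: "loc_integrable L" "\<And>t. 0 \<le> t \<Longrightarrow> 0 \<le> L t"
    and lip: "\<And>t y z. 0 \<le> t \<Longrightarrow> norm (F t y - F t z) \<le> L t * norm (y - z)"
    and bd: "\<And>t. 0 \<le> t \<Longrightarrow> norm (F t 0) \<le> L t" and a: "0 \<le> a"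
  shows "\<exists>x. continuous_on {0..} x \<and> loc_integrable (\<lambda>t. F t (x t)) \<and> x a = c \<and>
     (\<forall>t\<ge>0. x t = x 0 + integral {0..t} (\<lambda>s. F s (x s)))"
proof -
  \<comment> \<open>Bounded continuous functions live on the whole line, hence the constant extension to negative times.\<close>
  define W where "W t = \<bar>integral {0..max 0 t} L - integral {0..a} L\<bar>" for t
  have Wc: "continuous_on S W" for S
    unfolding W_def by (intro continuous_intros continuous_on_max_primitive L)
  have W0: "0 \<le> W t" for t by (simp add: W_def)
  have Wmax: "W t = W (max 0 t)" for t by (simp add: W_def)
  have Wint: "((\<lambda>s. L s * exp (2 * W s)) has_integral (exp (2 * W t) - 1) / 2) {min a t..max a t}" if "0 \<le> t" for t
  proof -
    have "((\<lambda>s. L s * exp (2 * \<bar>integral {0..s} L - integral {0..a} L\<bar>)) has_integral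
       (exp (2 * \<bar>integral {0..t} L - integral {0..a} L\<bar>) - 1) / 2) {min a t..max a t}"
      by (rule exp_distance_weight_integral[OF L(1) a that L(2)])
    then have "((\<lambda>s. L s * exp (2 * W s)) has_integral
       (exp (2 * \<bar>integral {0..t} L - integral {0..a} L\<bar>) - 1) / 2) {min a t..max a t}"
      by (rule has_integral_eq[rotated]) (use that a in \<open>auto simp: W_def\<close>)
    then show ?thesis using that by (simp add: W_def)
  qed
  have Lint: "integral {min a t..max a t} L = W t" if "0 \<le> t" for t
  proof (cases "a \<le> t")
    case True
    have "0 \<le> integral {a..t} L" using a L by (intro integral_nonneg loc_integrable_on) auto
    then show ?thesis using primitive_diff[OF L(1) a True] True that by (simp add: W_def)
  next
    case False
    have "0 \<le> integral {t..a} L" using that L by (intro integral_nonneg loc_integrable_on) auto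
    then show ?thesis using primitive_diff[OF L(1) that, of a] False that by (simp add: W_def)
  qed
  have Fc: "continuous_on UNIV (F t)" if "0 \<le> t" for t
    using lip[OF that] by (intro lipschitz_on_continuous_on[of "L t"] lipschitz_onI)
       (auto simp: dist_norm L(2)[OF that])
  have Fm: "(\<lambda>t. F t (x t)) \<in> borel_measurable (lebesgue_on {0..})" if "continuous_on {0..} x" for x
    by (rule measurable_superposition_continuous[OF meas Fc that])
  have Fb: "norm (F t y) \<le> L t * (1 + norm y)" if "0 \<le> t" for t y
    using norm_triangle_ineq[of "F t y - F t 0" "F t 0"] lip[OF that, of y 0] bd[OF that] by (simp add: algebra_simps)
  have FI: "loc_integrable (\<lambda>t. F t (x t))" if x: "continuous_on {0..} x" for x
  proof (rule loc_integrable_bounded[OF Fm[OF x]])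
    show "loc_integrable (\<lambda>t. L t * (1 + norm (x t)))"
      by (intro loc_integrable_mult_continuous L continuous_intros x)
  qed (rule Fb)
  have diff: "norm (integral {0..t} h - integral {0..a} h) \<le> integral {min a t..max a t} k"
    if "loc_integrable h" "loc_integrable k" "0 \<le> t" "\<And>s. 0 \<le> s \<Longrightarrow> norm (h s) \<le> k s"
    for h :: "real \<Rightarrow> 'e" and k t
  proof -
    have "norm (integral {min a t..max a t} h) \<le> integral {min a t..max a t} k"
      by (rule integral_norm_le) (use that a in auto)
    moreover have "norm (integral {0..t} h - integral {0..a} h) = norm (integral {min a t..max a t} h)"
      using primitive_diff[OF that(1), of a t] primitive_diff[OF that(1), of t a] that(3) a
      by (cases "a \<le> t") (auto simp: min_def max_def norm_minus_commute[of "integral {0..t} h"])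
    ultimately show ?thesis by simp
  qed
  define S where "S y t = c + (integral {0..t} (\<lambda>s. F s (exp (2 * W s) *\<^sub>R y s)) - integral {0..a} (\<lambda>s. F s (exp (2 * W s) *\<^sub>R y s)))"
    for y t
  define T where "T y t = exp (- (2 * W t)) *\<^sub>R S y (max 0 t)" for y t
  have hI: "loc_integrable (\<lambda>s. F s (exp (2 * W s) *\<^sub>R y s))" if "continuous_on UNIV y" for y
    by (intro FI continuous_intros Wc continuous_on_subset[OF that]) auto
  have Tc: "continuous_on UNIV (T y)" if "continuous_on UNIV y" for y
    unfolding T_def S_def by (intro continuous_intros Wc continuous_on_max_primitive hI that)
  have Tdiff: "norm (T y t - T z t) \<le> d / 2"
    if y: "continuous_on UNIV y" and z: "continuous_on UNIV z" and d: "\<And>s. norm (y s - z s) \<le> d" for y z d t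
  proof -
    define r where "r = max 0 t"
    have r: "0 \<le> r" and Wr: "W t = W r" using Wmax[of t] by (auto simp: r_def)
    have d0: "0 \<le> d" using d[of 0] norm_ge_zero order_trans by blast
    have Le: "loc_integrable (\<lambda>s. L s * exp (2 * W s))"
      by (intro loc_integrable_mult_continuous L continuous_intros Wc)
    have SI: "S y r - S z r = integral {0..r} (\<lambda>s. F s (exp (2 * W s) *\<^sub>R y s) - F s (exp (2 * W s) *\<^sub>R z s))
        - integral {0..a} (\<lambda>s. F s (exp (2 * W s) *\<^sub>R y s) - F s (exp (2 * W s) *\<^sub>R z s))"
      unfolding S_def using r a by (simp add: integral_diff loc_integrable_on[OF hI[OF y]] loc_integrable_on[OF hI[OF z]])
    have "norm (S y r - S z r) \<le> integral {min a r..max a r} (\<lambda>s. d * (L s * exp (2 * W s)))"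
      unfolding SI
    proof (rule diff[OF loc_integrable_diff[OF hI[OF y] hI[OF z]] loc_integrable_mult_const[OF Le] r])
      fix s :: real assume s: "0 \<le> s"
      have "norm (F s (exp (2 * W s) *\<^sub>R y s) - F s (exp (2 * W s) *\<^sub>R z s)) \<le> L s * norm (exp (2 * W s) *\<^sub>R (y s - z s))"
        using lip[OF s] by (simp add: scaleR_diff_right)
      also have "\<dots> \<le> L s * (exp (2 * W s) * d)"
        using d[of s] L(2)[OF s] by (intro mult_left_mono) auto
      finally show "norm (F s (exp (2 * W s) *\<^sub>R y s) - F s (exp (2 * W s) *\<^sub>R z s)) \<le> d * (L s * exp (2 * W s))"
        by (simp add: ac_simps)
    qed
    also have "\<dots> = d * ((exp (2 * W r) - 1) / 2)"
      using integral_unique[OF has_integral_mult_right[OF Wint[OF r], of d]] by simp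
    also have "\<dots> \<le> d * (exp (2 * W r) / 2)" using d0 by (intro mult_left_mono) auto
    finally have "norm (S y r - S z r) \<le> d * exp (2 * W r) / 2" by simp
    then have "exp (- (2 * W r)) * norm (S y r - S z r) \<le> exp (- (2 * W r)) * (d * exp (2 * W r) / 2)"
      by (intro mult_left_mono) auto
    also have "\<dots> = d / 2" by (simp add: exp_minus field_simps)
    finally show ?thesis
      by (simp add: T_def r_def[symmetric] Wr scaleR_diff_right[symmetric] del: scaleR_diff_right)
  qed
  have T0: "norm (T (\<lambda>_. 0) t) \<le> norm c + 1" for t
  proof -
    define r where "r = max 0 t"
    have r: "0 \<le> r" and Wr: "W t = W r" using Wmax[of t] by (auto simp: r_def)
    have "norm (integral {0..r} (\<lambda>s. F s 0) - integral {0..a} (\<lambda>s. F s 0)) \<le> integral {min a r..max a r} L"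
      using hI[of "\<lambda>_. 0"] by (intro diff L r bd) auto
    then have "norm (S (\<lambda>_. 0) r) \<le> norm c + W r"
      unfolding S_def using norm_triangle_ineq[of c] Lint[OF r] by (simp add: order_trans[OF norm_triangle_ineq])
    then have "norm (T (\<lambda>_. 0) t) \<le> exp (- (2 * W r)) * (norm c + W r)"
      by (simp add: T_def r_def[symmetric] Wr mult_left_mono)
    also have "\<dots> = exp (- (2 * W r)) * norm c + exp (- (2 * W r)) * W r" by (simp add: distrib_left)
    also have "\<dots> \<le> 1 * norm c + 1"
    proof (rule add_mono)
      show "exp (- (2 * W r)) * norm c \<le> 1 * norm c" using W0[of r] by (intro mult_right_mono) auto
      have "W r \<le> exp (2 * W r)" using exp_ge_add_one_self[of "2 * W r"] W0[of r] by linarith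
      then show "exp (- (2 * W r)) * W r \<le> 1" by (simp add: exp_minus field_simps)
    qed
    finally show ?thesis by simp
  qed
  have TB: "T (apply_bcontfun y) \<in> bcontfun" for y :: "real \<Rightarrow>\<^sub>C 'e"
  proof (rule bcontfun_normI)
    show "continuous_on UNIV (T (apply_bcontfun y))" by (rule Tc) simp
    fix t
    have "norm (T (apply_bcontfun y) t - T (\<lambda>_. 0) t) \<le> norm y / 2"
      by (rule Tdiff) (auto simp: norm_bounded)
    then show "norm (T (apply_bcontfun y) t) \<le> norm y / 2 + (norm c + 1)"
      using T0[of t] norm_triangle_ineq[of "T (apply_bcontfun y) t - T (\<lambda>_. 0) t" "T (\<lambda>_. 0) t"] by simp
  qed
  define TT where "TT y = Bcontfun (T (apply_bcontfun y))" for y :: "real \<Rightarrow>\<^sub>C 'e"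
  have TT: "apply_bcontfun (TT y) = T (apply_bcontfun y)" for y
    unfolding TT_def using TB by (simp add: Bcontfun_inverse)
  have "\<exists>!y. TT y = y"
  proof (rule banach_fix_type[of "1/2"])
    show "\<forall>y z. dist (TT y) (TT z) \<le> 1 / 2 * dist y z"
    proof (intro allI dist_bound)
      fix y z t
      have "norm (T (apply_bcontfun y) t - T (apply_bcontfun z) t) \<le> dist y z / 2"
        by (rule Tdiff) (auto simp: dist_norm[symmetric] dist_bounded)
      then show "dist (apply_bcontfun (TT y) t) (apply_bcontfun (TT z) t) \<le> 1 / 2 * dist y z"
        by (simp add: TT dist_norm)
    qed
  qed auto
  then obtain y where y: "TT y = y" by blast
  then have Ty: "T (apply_bcontfun y) = apply_bcontfun y" using TT[of y] by simp
  define x where "x = S (apply_bcontfun y)"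
  have xy: "exp (2 * W t) *\<^sub>R apply_bcontfun y t = x t" if "0 \<le> t" for t
  proof -
    have "apply_bcontfun y t = exp (- (2 * W t)) *\<^sub>R x t" using fun_cong[OF Ty, of t] that unfolding x_def T_def by (simp add: max_def)
    then show ?thesis by (simp add: exp_minus)
  qed
  have I: "integral {0..t} (\<lambda>s. F s (exp (2 * W s) *\<^sub>R apply_bcontfun y s)) = integral {0..t} (\<lambda>s. F s (x s))" for t
    by (intro integral_cong) (simp add: xy)
  have xt: "x t = c + (integral {0..t} (\<lambda>s. F s (x s)) - integral {0..a} (\<lambda>s. F s (x s)))" for t
    using I[of t] I[of a] unfolding x_def S_def by metis
  have xc: "continuous_on {0..} x"
  proof -
    have "continuous_on {0..} (\<lambda>t. exp (2 * W t) *\<^sub>R apply_bcontfun y t)" by (intro continuous_intros Wc) auto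
    then show ?thesis by (rule continuous_on_eq) (simp add: xy)
  qed
  show ?thesis
  proof (intro exI[of _ x] conjI allI impI)
    show "x a = c" using xt[of a] by simp
    show "x t = x 0 + integral {0..t} (\<lambda>s. F s (x s))" for t using xt[of t] xt[of 0] by simp
  qed (use xc FI in auto)
qed

section \<open>Trajectories and the gradient of the Hamiltonian\<close>

lemma has_integral_primitive_solution:
  fixes x :: "real \<Rightarrow> 'b::euclidean_space"
  assumes h: "loc_integrable h" and x: "\<And>t. 0 \<le> t \<Longrightarrow> x t = c + integral {0..t} h"
  shows "loc_abs_continuous x"
    and "AE t in lebesgue_on {0..}. (x has_vector_derivative h t) (at t within {0..})"
proof -
  have "norm (x t - x s) \<le> 1 * (norm ((c + integral {0..t} h) - (c + integral {0..s} h)) + norm ((c + integral {0..t} h) - (c + integral {0..s} h)))"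
    if "s \<in> {0..b}" "t \<in> {0..b}" for b s t using x[of s] x[of t] that by simp
  then show "loc_abs_continuous x"
    by (intro loc_abs_continuous_dominated[OF loc_abs_continuous_primitive[OF h, of c] loc_abs_continuous_primitive[OF h, of c]]) blast
  have "AE t in lebesgue_on {0..}. t \<in> {0::real..}" by (subst AE_restrict_space_iff) auto
  then show "AE t in lebesgue_on {0..}. (x has_vector_derivative h t) (at t within {0..})"
    using primitive_has_vector_derivative_AE[OF h, of c]
  proof eventually_elim
    case (elim t)
    show ?case by (rule has_vector_derivative_transform[OF elim(1) _ elim(2)]) (simp add: x)
  qed
qed

text \<open>The bound that Gronwall's inequality gives for solutions of \<open>\<bar>x'\<bar> \<le> R (1 + \<bar>x\<bar>)\<close> with \<open>x 0 = 0\<close>.\<close>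

definition tube_radius :: "(real \<Rightarrow> real) \<Rightarrow> real \<Rightarrow> real" where
  "tube_radius R t = integral {0..t} R * exp (integral {0..t} R)"

lemma borel_selector_lebesgue_measurable:
  assumes "u \<in> selectors U"
  shows "u \<in> borel_measurable (lebesgue_on {0..})"
proof -
  have "(\<lambda>t. indicator {0..} t *\<^sub>R u t) \<in> borel_measurable borel"
    using assms by (simp add: selectors_def borel_measurable_restrict_space_iff)
  then have "(\<lambda>t. indicator {0..} t *\<^sub>R u t) \<in> borel_measurable lebesgue"
    by (intro measurable_completion) simp
  then show ?thesis by (simp add: borel_measurable_restrict_space_iff)
qed

lemma selectors_patch:
  assumes "v \<in> selectors U" "u \<in> selectors U" "A \<in> sets borel"
  shows "(\<lambda>t. if t \<in> A then v t else u t) \<in> selectors U"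
proof -
  have v: "v \<in> borel_measurable (restrict_space borel (A \<inter> {0..}))"
    by (rule measurable_restrict_mono[of _ _ "{0..}"]) (use assms in \<open>auto simp: selectors_def\<close>)
  have "(\<lambda>t. if t \<in> A \<inter> {0..} then v t else u t) \<in> borel_measurable (restrict_space borel {0..})"
    by (rule measurable_restrict_patch[OF v]) (use assms in \<open>auto simp: selectors_def\<close>)
  then have "(\<lambda>t. if t \<in> A then v t else u t) \<in> borel_measurable (restrict_space borel {0..})"
    by (rule measurable_cong[THEN iffD1, rotated]) (auto simp: space_restrict_space)
  then show ?thesis using assms by (auto simp: selectors_def)
qed

text \<open>The global Lipschitz and growth modulus \<open>R0\<close> of the dynamics confines all trajectories to one tube. In
this tube a single locally integrable function \<open>R\<close> bounds the data and their derivatives and serves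
as Lipschitz constant of the derivatives, for all control values at once.\<close>

locale control_problem =
  fixes U :: "real \<Rightarrow> 'u::euclidean_space set"
    and f :: "real \<Rightarrow> 'x::euclidean_space \<Rightarrow> 'u \<Rightarrow> 'x"
    and g :: "real \<Rightarrow> 'x \<Rightarrow> 'u \<Rightarrow> real"
    and f' :: "real \<Rightarrow> 'x \<Rightarrow> 'u \<Rightarrow> 'x \<Rightarrow>\<^sub>L 'x"
    and g' :: "real \<Rightarrow> 'x \<Rightarrow> 'u \<Rightarrow> 'x \<Rightarrow>\<^sub>L real"
    and R0 R :: "real \<Rightarrow> real"
  assumes f_meas: "superposition_measurable U f" and g_meas: "superposition_measurable U g"
    and f_cont: "caratheodory U f" and g_cont: "caratheodory U g"
    and f'_cont: "caratheodory U f'" and g'_cont: "caratheodory U g'"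
    and f_der: "\<And>t x u. 0 \<le> t \<Longrightarrow> u \<in> U t \<Longrightarrow> ((\<lambda>y. f t y u) has_derivative blinfun_apply (f' t x u)) (at x)"
    and g_der: "\<And>t x u. 0 \<le> t \<Longrightarrow> u \<in> U t \<Longrightarrow> ((\<lambda>y. g t y u) has_derivative blinfun_apply (g' t x u)) (at x)"
    and R0: "loc_integrable R0" "\<And>t. 0 \<le> t \<Longrightarrow> 0 \<le> R0 t"
    and f_lip: "\<And>t x y u. 0 \<le> t \<Longrightarrow> u \<in> U t \<Longrightarrow> norm (f t x u - f t y u) \<le> R0 t * norm (x - y)"
    and f_zero: "\<And>t u. 0 \<le> t \<Longrightarrow> u \<in> U t \<Longrightarrow> norm (f t 0 u) \<le> R0 t"
    and R: "loc_integrable R" "\<And>t. 0 \<le> t \<Longrightarrow> R0 t \<le> R t"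
    and bounds: "\<And>t x u. 0 \<le> t \<Longrightarrow> u \<in> U t \<Longrightarrow> norm x \<le> tube_radius R0 t \<Longrightarrow>
        norm (f t x u) \<le> R t \<and> \<bar>g t x u\<bar> \<le> R t \<and> norm (f' t x u) \<le> R t \<and> norm (g' t x u) \<le> R t"
    and lips: "\<And>t x y u. 0 \<le> t \<Longrightarrow> u \<in> U t \<Longrightarrow> norm x \<le> tube_radius R0 t \<Longrightarrow> norm y \<le> tube_radius R0 t \<Longrightarrow>
        norm (f' t x u - f' t y u) \<le> R t * norm (x - y) \<and> norm (g' t x u - g' t y u) \<le> R t * norm (x - y)"
begin

lemma R_nonneg: "0 \<le> t \<Longrightarrow> 0 \<le> R t"
  using R0(2) R(2) by force

lemma selectorD: "u \<in> selectors U \<Longrightarrow> 0 \<le> t \<Longrightarrow> u t \<in> U t"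
  by (simp add: selectors_def)

lemma continuous_in_state:
  fixes a :: "real \<Rightarrow> 'x \<Rightarrow> 'u \<Rightarrow> 'e::real_normed_vector"
  assumes "caratheodory U a" "0 \<le> t" "u \<in> U t"
  shows "continuous_on UNIV (\<lambda>y. a t y u)"
proof -
  have "continuous_on (UNIV \<times> U t) (\<lambda>(y, u). a t y u)" using assms by (simp add: caratheodory_def)
  then show ?thesis
    using assms(3) by (auto intro!: continuous_on_compose2[of _ "\<lambda>(y, u). a t y u" UNIV "\<lambda>y. (y, u)", simplified] continuous_intros)
qed

lemma measurable_along:
  fixes a :: "real \<Rightarrow> 'x \<Rightarrow> 'u \<Rightarrow> 'e::real_normed_vector"
  assumes "superposition_measurable U a" "caratheodory U a" "u \<in> selectors U" "continuous_on {0..} x"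
  shows "(\<lambda>t. a t (x t) (u t)) \<in> borel_measurable (lebesgue_on {0..})"
proof (rule measurable_superposition_continuous[OF _ _ assms(4)])
  show "(\<lambda>t. a t y (u t)) \<in> borel_measurable (lebesgue_on {0..})" for y
    using assms by (simp add: superposition_measurable_def)
  show "continuous_on UNIV (\<lambda>y. a t y (u t))" if "0 \<le> t" for t
    using assms that by (intro continuous_in_state) (auto simp: selectors_def)
qed

lemma f_linear_growth:
  assumes "0 \<le> t" "u \<in> U t" shows "norm (f t y u) \<le> R0 t * (1 + norm y)"
  using norm_triangle_ineq[of "f t y u - f t 0 u" "f t 0 u"] f_lip[OF assms, of y 0] f_zero[OF assms]
  by (simp add: algebra_simps)

lemma f_along_integrable:
  assumes "u \<in> selectors U" "continuous_on {0..} x"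
  shows "loc_integrable (\<lambda>t. f t (x t) (u t))"
proof (rule loc_integrable_bounded[OF measurable_along[OF f_meas f_cont assms]])
  show "loc_integrable (\<lambda>t. R0 t * (1 + norm (x t)))"
    by (intro loc_integrable_mult_continuous R0 continuous_intros assms)
qed (use assms f_linear_growth selectorD in auto)

definition traj :: "(real \<Rightarrow> 'u) \<Rightarrow> (real \<Rightarrow> 'x) \<Rightarrow> bool" where
  "traj u x \<longleftrightarrow> u \<in> selectors U \<and> continuous_on {0..} x \<and> (\<forall>t\<ge>0. x t = integral {0..t} (\<lambda>s. f s (x s) (u s)))"

lemma trajD:
  assumes "traj u x"
  shows "u \<in> selectors U" "continuous_on {0..} x" "\<And>t. 0 \<le> t \<Longrightarrow> x t = integral {0..t} (\<lambda>s. f s (x s) (u s))" "x 0 = 0"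
  using assms unfolding traj_def by auto

lemma traj_exists: "u \<in> selectors U \<Longrightarrow> \<exists>x. traj u x"
proof -
  assume u: "u \<in> selectors U"
  have "\<exists>x. continuous_on {0..} x \<and> loc_integrable (\<lambda>t. f t (x t) (u t)) \<and> x 0 = 0 \<and>
     (\<forall>t\<ge>0. x t = x 0 + integral {0..t} (\<lambda>s. f s (x s) (u s)))"
  proof (rule caratheodory_ode_solution[of "\<lambda>t y. f t y (u t)" R0 0 0])
    show "(\<lambda>t. f t y (u t)) \<in> borel_measurable (lebesgue_on {0..})" for y
      using f_meas u by (simp add: superposition_measurable_def)
    show "norm (f t y (u t) - f t z (u t)) \<le> R0 t * norm (y - z)" if "0 \<le> t" for t y z
      by (rule f_lip[OF that selectorD[OF u that]])
    show "norm (f t 0 (u t)) \<le> R0 t" if "0 \<le> t" for t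
      by (rule f_zero[OF that selectorD[OF u that]])
  qed (use R0 in auto)
  then obtain x where x: "continuous_on {0..} x" "x 0 = 0" "\<And>t. 0 \<le> t \<Longrightarrow> x t = x 0 + integral {0..t} (\<lambda>s. f s (x s) (u s))"
    by blast
  have "traj u x"
    unfolding traj_def using u x(1) x(3)[unfolded x(2) add_0] by blast
  then show "\<exists>x. traj u x" by blast
qed

lemma traj_solution:
  assumes "traj u x"
  shows "loc_abs_continuous x"
    and "AE t in lebesgue_on {0..}. (x has_vector_derivative f t (x t) (u t)) (at t within {0..})"
  using has_integral_primitive_solution[OF f_along_integrable[OF trajD(1,2)[OF assms]], of x 0] trajD(3)[OF assms] by auto

lemma traj_trajectory: "traj u x \<Longrightarrow> trajectory f u x"
  using traj_solution[of u x] trajD(4)[of u x] by (simp add: trajectory_def)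

lemma trajectory_traj:
  assumes "trajectory f u x" "u \<in> selectors U"
  shows "traj u x"
  unfolding traj_def
proof (intro conjI allI impI)
  have *: "loc_abs_continuous x" "x 0 = 0" "AE t in lebesgue_on {0..}. (x has_vector_derivative f t (x t) (u t)) (at t within {0..})"
    using assms by (auto simp: trajectory_def)
  show "continuous_on {0..} x" by (rule loc_abs_continuous_continuous_on[OF *(1)])
  show "x t = integral {0..t} (\<lambda>s. f s (x s) (u s))" if "0 \<le> t" for t
    using loc_abs_continuous_FTC[OF *(1,3) that] *(2) by (simp add: integral_unique)
qed (rule assms)

lemma traj_in_tube:
  assumes x: "traj u x" and t: "0 \<le> t"
  shows "norm (x t) \<le> tube_radius R0 t"
proof -
  note xx = trajD[OF x]
  have nI: "loc_integrable (\<lambda>s. R0 s * norm (x s))" by (intro loc_integrable_mult_continuous R0 continuous_intros xx)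
  have "norm (x s) \<le> integral {0..t} R0 + integral {0..s} (\<lambda>s. R0 s * norm (x s))" if s: "s \<in> {0..t}" for s
  proof -
    have "norm (x s) = norm (integral {0..s} (\<lambda>s. f s (x s) (u s)))" using xx(3)[of s] s by simp
    also have "\<dots> \<le> integral {0..s} (\<lambda>s. R0 s + R0 s * norm (x s))"
      using xx(1) selectorD f_linear_growth
      by (intro integral_norm_le f_along_integrable xx loc_integrable_add R0 nI) (auto simp: algebra_simps)
    also have "\<dots> = integral {0..s} R0 + integral {0..s} (\<lambda>s. R0 s * norm (x s))"
      by (intro integral_add loc_integrable_on R0 nI) auto
    also have "integral {0..s} R0 \<le> integral {0..t} R0"
      using s R0(2) by (intro integral_subset_le loc_integrable_on R0) auto
    finally show ?thesis by simp
  qed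
  moreover have "continuous_on {0..t} (\<lambda>s. norm (x s))"
    by (rule continuous_on_subset[OF continuous_on_norm[OF xx(2)]]) auto
  ultimately show ?thesis using gronwall[OF R0, of t "\<lambda>s. norm (x s)" _ t] t by (simp add: tube_radius_def)
qed

lemma g_along_integrable:
  assumes x: "traj u x" and v: "v \<in> selectors U"
  shows "loc_integrable (\<lambda>t. g t (x t) (v t))"
  by (rule loc_integrable_bounded[OF measurable_along[OF g_meas g_cont v trajD(2)[OF x]] R(1)])
     (use bounds traj_in_tube[OF x] selectorD[OF v] in auto)

lemma f_along_integrable':
  assumes x: "traj u x" and v: "v \<in> selectors U"
  shows "loc_integrable (\<lambda>t. f t (x t) (v t))"
  by (rule f_along_integrable[OF v trajD(2)[OF x]])

lemma payoff_eq_integral: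
  assumes x: "traj u x"
  shows "payoff g x u T = integral {0..T} (\<lambda>t. g t (x t) (u t))"
  unfolding payoff_def
  by (rule set_lebesgue_integral_eq_integral(2)) (rule loc_integrable_on[OF g_along_integrable[OF x trajD(1)[OF x]]], simp)

text \<open>The measure with density \<open>R\<close> of the set on which two controls differ. Since \<open>R\<close> dominates the data
in the tube, a small distance of the controls makes the states, the adjoint arcs and the Hamiltonians close.\<close>

definition control_dist :: "(real \<Rightarrow> 'u) \<Rightarrow> (real \<Rightarrow> 'u) \<Rightarrow> real \<Rightarrow> real" where
  "control_dist u v t = integral {0..t} (\<lambda>s. if u s = v s then 0 else R s)"

lemma control_dist_integrable:
  assumes "u \<in> selectors U" "v \<in> selectors U"
  shows "loc_integrable (\<lambda>s. if u s = v s then 0 else R s)"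
proof (rule loc_integrable_bounded[OF _ R(1)])
  have "(\<lambda>t. u t - v t) -` {0} \<inter> space (lebesgue_on {0..}) \<in> sets (lebesgue_on {0..})"
    by (rule measurable_sets[OF borel_measurable_diff[OF assms[THEN borel_selector_lebesgue_measurable]]]) simp
  moreover have "(\<lambda>t. u t - v t) -` {0} \<inter> space (lebesgue_on {0..}) = {t \<in> space (lebesgue_on {0..}). u t = v t}" by auto
  ultimately have "{t \<in> space (lebesgue_on {0..}). u t = v t} \<in> sets (lebesgue_on {0..})" by simp
  then show "(\<lambda>s. if u s = v s then 0 else R s) \<in> borel_measurable (lebesgue_on {0..})"
    by (intro measurable_If loc_integrable_measurable[OF R(1)]) auto
qed (auto simp: R_nonneg)

lemma control_dist_mono:
  assumes "u \<in> selectors U" "v \<in> selectors U" "s \<le> t"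
  shows "control_dist u v s \<le> control_dist u v t"
  unfolding control_dist_def
  by (intro integral_subset_le loc_integrable_on control_dist_integrable) (use assms R_nonneg in auto)

lemma control_dist_nonneg:
  assumes "u \<in> selectors U" "v \<in> selectors U"
  shows "0 \<le> control_dist u v t"
  unfolding control_dist_def
  by (intro integral_nonneg loc_integrable_on control_dist_integrable) (use assms R_nonneg in auto)

lemma traj_stability:
  assumes x: "traj u x" and y: "traj v y" and t: "0 \<le> t"
  shows "norm (x t - y t) \<le> 2 * control_dist u v t * exp (integral {0..t} R)"
proof -
  note xx = trajD[OF x] and yy = trajD[OF y]
  have RI: "loc_integrable (\<lambda>s. R s * norm (x s - y s))" by (intro loc_integrable_mult_continuous R continuous_intros xx yy)
  note DI = control_dist_integrable[OF xx(1) yy(1)]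
  have "norm (x s - y s) \<le> 2 * control_dist u v t + integral {0..s} (\<lambda>s. R s * norm (x s - y s))" if s: "s \<in> {0..t}" for s
  proof -
    have "x s - y s = integral {0..s} (\<lambda>s. f s (x s) (u s) - f s (y s) (v s))"
      using xx(3)[of s] yy(3)[of s] s
        integral_diff[OF loc_integrable_on(2)[OF f_along_integrable'[OF x xx(1)]] loc_integrable_on(2)[OF f_along_integrable'[OF y yy(1)]]] by simp
    also have "norm \<dots> \<le> integral {0..s} (\<lambda>s. 2 * (if u s = v s then 0 else R s) + R s * norm (x s - y s))"
    proof (rule integral_norm_le)
      fix r assume "r \<in> {0..s}"
      then have r: "0 \<le> r" by simp
      have "norm (f r (x r) (u r) - f r (y r) (u r)) \<le> R r * norm (x r - y r)"
        using f_lip[OF r selectorD[OF xx(1) r]] R(2)[OF r] by (meson mult_right_mono norm_ge_zero order_trans)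
      moreover have "norm (f r (y r) (u r) - f r (y r) (v r)) \<le> 2 * (if u r = v r then 0 else R r)"
        using bounds[OF r selectorD[OF xx(1) r] traj_in_tube[OF y r]] bounds[OF r selectorD[OF yy(1) r] traj_in_tube[OF y r]]
          norm_triangle_ineq4[of "f r (y r) (u r)" "f r (y r) (v r)"] by auto
      ultimately show "norm (f r (x r) (u r) - f r (y r) (v r)) \<le> 2 * (if u r = v r then 0 else R r) + R r * norm (x r - y r)"
        using norm_triangle_ineq[of "f r (x r) (u r) - f r (y r) (u r)" "f r (y r) (u r) - f r (y r) (v r)"] by simp
    qed (intro loc_integrable_add loc_integrable_diff loc_integrable_mult_const DI RI f_along_integrable xx yy | simp)+
    also have "\<dots> = 2 * control_dist u v s + integral {0..s} (\<lambda>s. R s * norm (x s - y s))"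
      unfolding control_dist_def integral_mult_right[symmetric]
      by (intro integral_add loc_integrable_on loc_integrable_mult_const DI RI) auto
    also have "control_dist u v s \<le> control_dist u v t" using s by (intro control_dist_mono xx yy) auto
    finally show ?thesis by simp
  qed
  moreover have "continuous_on {0..t} (\<lambda>s. norm (x s - y s))"
    by (rule continuous_on_subset[OF continuous_on_norm[OF continuous_on_diff[OF xx(2) yy(2)]]]) auto
  ultimately show ?thesis using gronwall[OF R(1) R_nonneg, of t "\<lambda>s. norm (x s - y s)" _ t] t by simp
qed

text \<open>The Riesz representative of the derivative of the Hamiltonian in the state.\<close>

definition grad :: "real \<Rightarrow> 'x \<Rightarrow> 'u \<Rightarrow> real \<Rightarrow> 'x \<Rightarrow> 'x" where
  "grad t x u l p = (\<Sum>b\<in>Basis. (p \<bullet> blinfun_apply (f' t x u) b + l * blinfun_apply (g' t x u) b) *\<^sub>R b)"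

lemma inner_grad: "grad t x u l p \<bullet> v = p \<bullet> blinfun_apply (f' t x u) v + l * blinfun_apply (g' t x u) v"
proof -
  have "p \<bullet> blinfun_apply (f' t x u) v + l * blinfun_apply (g' t x u) v =
     (\<Sum>b\<in>Basis. (v \<bullet> b) * (p \<bullet> blinfun_apply (f' t x u) b + l * blinfun_apply (g' t x u) b))"
    by (subst (1 2) euclidean_representation[of v, symmetric])
       (simp add: blinfun.sum_right blinfun.scaleR_right inner_sum_right sum_distrib_left sum.distrib algebra_simps)
  then show ?thesis unfolding grad_def inner_sum_left inner_scaleR_left by (simp add: inner_commute[of v] mult.commute)
qed

lemma norm_le_inner:
  fixes w :: "'x"
  assumes "\<And>v. w \<bullet> v \<le> C * norm v" "0 \<le> C"
  shows "norm w \<le> C"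
proof (cases "w = 0")
  case False
  have "norm w * norm w \<le> C * norm w" using assms(1)[of w] by (simp add: dot_square_norm power2_eq_square)
  then show ?thesis using False by simp
qed (use assms in simp)

lemma blinfun_apply_le: "norm A \<le> c \<Longrightarrow> norm (blinfun_apply A v) \<le> c * norm v"
  by (rule order_trans[OF norm_blinfun mult_right_mono]) auto

lemma inner_le: "norm w \<le> c \<Longrightarrow> (p :: 'x) \<bullet> w \<le> norm p * c"
  by (rule order_trans[OF norm_cauchy_schwarz mult_left_mono]) auto

lemma mult_le_abs: "\<bar>w\<bar> \<le> c \<Longrightarrow> l * w \<le> \<bar>l\<bar> * (c :: real)"
  by (rule order_trans[OF abs_ge_self]) (simp add: abs_mult mult_left_mono)

lemma grad_norm:
  assumes "0 \<le> t" "u \<in> U t" "norm x \<le> tube_radius R0 t"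
  shows "norm (grad t x u l p) \<le> R t * (norm p + \<bar>l\<bar>)"
proof (rule norm_le_inner)
  fix v
  have "p \<bullet> blinfun_apply (f' t x u) v \<le> norm p * (R t * norm v)"
    using bounds[OF assms] by (intro inner_le blinfun_apply_le) auto
  moreover have "l * blinfun_apply (g' t x u) v \<le> \<bar>l\<bar> * (R t * norm v)"
    using bounds[OF assms] blinfun_apply_le[of "g' t x u"] by (intro mult_le_abs) auto
  ultimately show "grad t x u l p \<bullet> v \<le> R t * (norm p + \<bar>l\<bar>) * norm v" by (simp add: inner_grad algebra_simps)
qed (simp add: assms R_nonneg)

lemma grad_lipschitz_state:
  assumes "0 \<le> t" "u \<in> U t" "norm x \<le> tube_radius R0 t" "norm y \<le> tube_radius R0 t"
  shows "norm (grad t x u l p - grad t y u l p) \<le> R t * norm (x - y) * (norm p + \<bar>l\<bar>)"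
proof (rule norm_le_inner)
  fix v
  have "p \<bullet> blinfun_apply (f' t x u - f' t y u) v \<le> norm p * (R t * norm (x - y) * norm v)"
    using lips[OF assms] by (intro inner_le blinfun_apply_le) auto
  moreover have "l * blinfun_apply (g' t x u - g' t y u) v \<le> \<bar>l\<bar> * (R t * norm (x - y) * norm v)"
    using lips[OF assms] blinfun_apply_le[of "g' t x u - g' t y u"] by (intro mult_le_abs) auto
  ultimately show "(grad t x u l p - grad t y u l p) \<bullet> v \<le> R t * norm (x - y) * (norm p + \<bar>l\<bar>) * norm v"
    by (simp add: inner_grad inner_diff_left blinfun.diff_left inner_diff_right algebra_simps)
qed (simp add: assms R_nonneg)

lemma grad_diff: "grad t x u l p - grad t x u l' p' = grad t x u (l - l') (p - p')"
  by (simp add: grad_def sum_subtractf[symmetric] scaleR_diff_left[symmetric] inner_diff_left algebra_simps)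

lemma grad_scale: "grad t x u (c * l) (c *\<^sub>R p) = c *\<^sub>R grad t x u l p"
  by (simp add: grad_def scaleR_sum_right algebra_simps)

text \<open>The derivative is a limit of difference quotients, which are superpositions of \<open>a\<close>.\<close>

lemma derivative_measurable:
  fixes a :: "real \<Rightarrow> 'x \<Rightarrow> 'u \<Rightarrow> 'e::euclidean_space" and a' :: "real \<Rightarrow> 'x \<Rightarrow> 'u \<Rightarrow> 'x \<Rightarrow>\<^sub>L 'e"
  assumes a: "superposition_measurable U a" and u: "u \<in> selectors U"
    and d: "\<And>t x u. 0 \<le> t \<Longrightarrow> u \<in> U t \<Longrightarrow> ((\<lambda>y. a t y u) has_derivative blinfun_apply (a' t x u)) (at x)"
  shows "(\<lambda>t. blinfun_apply (a' t y (u t)) b) \<in> borel_measurable (lebesgue_on {0..})"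
proof (rule borel_measurable_LIMSEQ_metric)
  show "(\<lambda>t. real (Suc n) *\<^sub>R (a t (y + inverse (real (Suc n)) *\<^sub>R b) (u t) - a t y (u t))) \<in> borel_measurable (lebesgue_on {0..})" for n
    using a u by (intro borel_measurable_scaleR borel_measurable_diff) (auto simp: superposition_measurable_def)
  fix t assume "t \<in> space (lebesgue_on {0::real..})"
  then have t: "0 \<le> t" by simp
  define w where "w = blinfun_apply (a' t y (u t)) b"
  define \<phi> where "\<phi> s = a t (y + s *\<^sub>R b) (u t)" for s
  have h1: "((\<lambda>s. y + s *\<^sub>R b) has_derivative (\<lambda>s. s *\<^sub>R b)) (at 0)" by (auto intro!: derivative_eq_intros)
  have h2: "((\<lambda>z. a t z (u t)) has_derivative blinfun_apply (a' t y (u t))) (at (y + 0 *\<^sub>R b))"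
    using d[OF t selectorD[OF u t], of y] by simp
  have "(\<phi> has_derivative (\<lambda>s. s *\<^sub>R w)) (at 0)"
    using has_derivative_compose[OF h1 h2] by (simp add: \<phi>_def[abs_def] w_def blinfun.scaleR_right)
  then have alt: "\<forall>e>0. \<exists>d>0. \<forall>s. \<bar>s\<bar> < d \<longrightarrow> norm (\<phi> s - \<phi> 0 - s *\<^sub>R w) \<le> e * \<bar>s\<bar>"
    by (simp add: has_derivative_within_alt)
  have "(\<lambda>n. real (Suc n) *\<^sub>R (\<phi> (inverse (real (Suc n))) - \<phi> 0)) \<longlonglongrightarrow> w"
  proof (rule metric_LIMSEQ_I)
    fix e :: real assume "0 < e"
    then obtain d where d: "0 < d" "\<And>s. \<bar>s\<bar> < d \<Longrightarrow> norm (\<phi> s - \<phi> 0 - s *\<^sub>R w) \<le> e / 2 * \<bar>s\<bar>"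
      using alt[rule_format, of "e / 2"] by auto
    obtain N where N: "inverse (real (Suc N)) < d" using reals_Archimedean[OF d(1)] by blast
    have "dist (real (Suc n) *\<^sub>R (\<phi> (inverse (real (Suc n))) - \<phi> 0)) w < e" if "N \<le> n" for n
    proof -
      define s where "s = inverse (real (Suc n))"
      have "s \<le> inverse (real (Suc N))" unfolding s_def using that by (intro le_imp_inverse_le) auto
      then have "s < d" using N by linarith
      moreover have "0 < s" by (simp add: s_def)
      ultimately have s: "0 < s" "\<bar>s\<bar> < d" "real (Suc n) = inverse s" by (auto simp: s_def)
      have "inverse s *\<^sub>R (\<phi> s - \<phi> 0) - w = inverse s *\<^sub>R (\<phi> s - \<phi> 0 - s *\<^sub>R w)"
        using s(1) by (simp add: scaleR_diff_right)
      then have "norm (inverse s *\<^sub>R (\<phi> s - \<phi> 0) - w) = inverse s * norm (\<phi> s - \<phi> 0 - s *\<^sub>R w)"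
        using s(1) by simp
      also have "\<dots> \<le> inverse s * (e / 2 * \<bar>s\<bar>)" using s by (intro mult_left_mono d(2)) auto
      also have "\<dots> < e" using s(1) \<open>0 < e\<close> by simp
      finally show ?thesis unfolding dist_norm s_def by (simp only: inverse_inverse_eq)
    qed
    then show "\<exists>N. \<forall>n\<ge>N. dist (real (Suc n) *\<^sub>R (\<phi> (inverse (real (Suc n))) - \<phi> 0)) w < e" by blast
  qed
  then show "(\<lambda>n. real (Suc n) *\<^sub>R (a t (y + inverse (real (Suc n)) *\<^sub>R b) (u t) - a t y (u t)))
     \<longlonglongrightarrow> blinfun_apply (a' t y (u t)) b"
    by (simp add: \<phi>_def w_def)
qed

lemma grad_measurable:
  assumes u: "u \<in> selectors U" and x: "continuous_on {0..} x" and p: "continuous_on {0..} p"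
  shows "(\<lambda>t. grad t (x t) (u t) l (p t)) \<in> borel_measurable (lebesgue_on {0..})"
proof -
  have "(\<lambda>t. (\<lambda>(y, q). grad t y (u t) l q) (x t, p t)) \<in> borel_measurable (lebesgue_on {0..})"
  proof (rule measurable_superposition_continuous[where G="\<lambda>t (y, q). grad t y (u t) l q" and x="\<lambda>t. (x t, p t)"])
    show "continuous_on {0..} (\<lambda>t. (x t, p t))" by (intro continuous_intros x p)
    show "(\<lambda>t. case z of (y, q) \<Rightarrow> grad t y (u t) l q) \<in> borel_measurable (lebesgue_on {0..})" for z
      unfolding grad_def split_beta
      by (intro borel_measurable_sum borel_measurable_scaleR borel_measurable_add borel_measurable_times
          borel_measurable_inner borel_measurable_const derivative_measurable[OF f_meas u f_der] derivative_measurable[OF g_meas u g_der])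
    fix t :: real assume t: "0 \<le> t"
    have "continuous_on UNIV (\<lambda>y. f' t y (u t))" "continuous_on UNIV (\<lambda>y. g' t y (u t))"
      using f'_cont g'_cont t selectorD[OF u t] by (auto intro: continuous_in_state)
    then show "continuous_on UNIV (\<lambda>(y, q). grad t y (u t) l q)"
      unfolding grad_def split_beta
      by (intro continuous_intros continuous_on_compose2[of UNIV _ UNIV fst]) auto
  qed
  then show ?thesis by simp
qed

lemma grad_along_integrable:
  assumes x: "traj u x" and p: "continuous_on {0..} p"
  shows "loc_integrable (\<lambda>t. grad t (x t) (u t) l (p t))"
proof (rule loc_integrable_bounded[OF grad_measurable[OF trajD(1,2)[OF x] p]])
  show "loc_integrable (\<lambda>t. R t * (norm (p t) + \<bar>l\<bar>))"
    by (intro loc_integrable_mult_continuous R continuous_intros p)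
qed (use grad_norm traj_in_tube[OF x] selectorD[OF trajD(1)[OF x]] in auto)

end

section \<open>Adjoint arcs and the Hamiltonian\<close>

lemma loc_integrable_restrict:
  fixes h :: "real \<Rightarrow> real"
  assumes h: "loc_integrable h" and A: "A \<in> sets borel"
  shows "loc_integrable (\<lambda>s. if s \<in> A then h s else 0)"
proof (rule loc_integrable_bounded[OF _ loc_integrable_norm[OF h]])
  have "A \<inter> {0..} \<in> sets (lebesgue_on {0..})"
    using A by (intro sets_restrict_space_iff[THEN iffD2]) auto
  moreover have "A \<inter> {0..} = {x \<in> space (lebesgue_on {0..}). x \<in> A}" by auto
  ultimately have "{x \<in> space (lebesgue_on {0..}). x \<in> A} \<in> sets (lebesgue_on {0..})" by (simp only:)
  then show "(\<lambda>s. if s \<in> A then h s else 0) \<in> borel_measurable (lebesgue_on {0..})"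
    by (intro measurable_If loc_integrable_measurable[OF h]) auto
qed auto

context control_problem
begin

text \<open>The adjoint equation in integral form, for the multiplier \<open>l\<close> of the payoff.\<close>

definition adj :: "(real \<Rightarrow> 'u) \<Rightarrow> (real \<Rightarrow> 'x) \<Rightarrow> real \<Rightarrow> (real \<Rightarrow> 'x) \<Rightarrow> bool" where
  "adj u x l p \<longleftrightarrow> continuous_on {0..} p \<and> (\<forall>t\<ge>0. p t = p 0 - integral {0..t} (\<lambda>s. grad s (x s) (u s) l (p s)))"

lemma adjD:
  assumes "adj u x l p"
  shows "continuous_on {0..} p" "\<And>t. 0 \<le> t \<Longrightarrow> p t = p 0 - integral {0..t} (\<lambda>s. grad s (x s) (u s) l (p s))"
  using assms unfolding adj_def by blast+

lemma adj_exists: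
  assumes x: "traj u x" and a: "0 \<le> a" and l: "\<bar>l\<bar> \<le> 1"
  shows "\<exists>p. adj u x l p \<and> p a = c"
proof -
  note ux = selectorD[OF trajD(1)[OF x]] traj_in_tube[OF x]
  have "\<exists>p. continuous_on {0..} p \<and> loc_integrable (\<lambda>t. - grad t (x t) (u t) l (p t)) \<and> p a = c \<and>
     (\<forall>t\<ge>0. p t = p 0 + integral {0..t} (\<lambda>s. - grad s (x s) (u s) l (p s)))"
  proof (rule caratheodory_ode_solution[of "\<lambda>t y. - grad t (x t) (u t) l y" R a c])
    show "(\<lambda>t. - grad t (x t) (u t) l y) \<in> borel_measurable (lebesgue_on {0..})" for y
      by (intro borel_measurable_uminus grad_measurable trajD[OF x] continuous_on_const)
    show "norm (- grad t (x t) (u t) l y - - grad t (x t) (u t) l z) \<le> R t * norm (y - z)" if t: "0 \<le> t" for t y z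
    proof -
      have "norm (grad t (x t) (u t) l z - grad t (x t) (u t) l y) \<le> R t * (norm (z - y) + \<bar>l - l\<bar>)"
        unfolding grad_diff by (intro grad_norm t ux)
      then show ?thesis by (simp add: norm_minus_commute)
    qed
    show "norm (- grad t (x t) (u t) l 0) \<le> R t" if t: "0 \<le> t" for t
    proof -
      have "norm (grad t (x t) (u t) l 0) \<le> R t * (norm (0 :: 'x) + \<bar>l\<bar>)" by (intro grad_norm t ux)
      also have "\<dots> \<le> R t * 1" using l R_nonneg[OF t] by (intro mult_left_mono) auto
      finally show ?thesis by simp
    qed
  qed (use R R_nonneg a in auto)
  then obtain p where p: "continuous_on {0..} p" "p a = c"
     "\<And>t. 0 \<le> t \<Longrightarrow> p t = p 0 + integral {0..t} (\<lambda>s. - grad s (x s) (u s) l (p s))" by blast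
  have "adj u x l p"
    unfolding adj_def
  proof (intro conjI allI impI p(1))
    fix t :: real assume "0 \<le> t"
    from p(3)[OF this] show "p t = p 0 - integral {0..t} (\<lambda>s. grad s (x s) (u s) l (p s))"
      unfolding integral_neg by simp
  qed
  then show ?thesis using p(2) by blast
qed

lemma adj_scale:
  assumes "adj u x l p" shows "adj u x (c * l) (\<lambda>t. c *\<^sub>R p t)"
  unfolding adj_def
proof (intro conjI allI impI)
  show "continuous_on {0..} (\<lambda>t. c *\<^sub>R p t)" by (intro continuous_intros adjD[OF assms])
  fix t :: real assume "0 \<le> t"
  then have "c *\<^sub>R p t = c *\<^sub>R (p 0 - integral {0..t} (\<lambda>s. grad s (x s) (u s) l (p s)))" using adjD(2)[OF assms] by metis
  then show "c *\<^sub>R p t = c *\<^sub>R p 0 - integral {0..t} (\<lambda>s. grad s (x s) (u s) (c * l) (c *\<^sub>R p s))"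
    by (simp add: grad_scale scaleR_diff_right)
qed

text \<open>The adjoint equation is homogeneous in the pair of arc and multiplier. The arc that vanishes at the
horizon and belongs to the multiplier 1 can therefore be divided, with its multiplier, by \<open>1 + \<bar>p 0\<bar>\<close>.\<close>

lemma adj_terminal_exists:
  assumes x: "traj u x" and \<tau>: "0 \<le> \<tau>"
  shows "\<exists>l p. adj u x l p \<and> 0 < l \<and> l \<le> 1 \<and> norm (p 0) + l = 1 \<and> p \<tau> = 0"
proof -
  obtain p where p: "adj u x 1 p" "p \<tau> = 0" using adj_exists[OF x \<tau>, of 1 0] by auto
  define l where "l = 1 / (1 + norm (p 0))"
  have pos: "0 < 1 + norm (p 0)" using norm_ge_zero[of "p 0"] by linarith
  have "adj u x (l * 1) (\<lambda>t. l *\<^sub>R p t)" by (rule adj_scale[OF p(1)])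
  moreover have "0 < l" "l \<le> 1" using pos by (auto simp: l_def)
  moreover have "norm (l *\<^sub>R p 0) + l = 1" using pos \<open>0 < l\<close> by (simp add: l_def field_simps)
  ultimately show ?thesis using p(2) by (intro exI[of _ l] exI[of _ "\<lambda>t. l *\<^sub>R p t"]) auto
qed

lemma adj_bound:
  assumes x: "traj u x" and p: "adj u x l p" and l: "0 \<le> l" "norm (p 0) + l \<le> 1" and t: "0 \<le> t"
  shows "norm (p t) + l \<le> exp (integral {0..t} R)"
proof -
  note pp = adjD[OF p] and ux = selectorD[OF trajD(1)[OF x]] traj_in_tube[OF x]
  have c: "continuous_on {0..} (\<lambda>s. norm (p s) + l)" by (intro continuous_intros pp)
  have "norm (p s) + l \<le> 1 + integral {0..s} (\<lambda>s. R s * (norm (p s) + l))" if s: "s \<in> {0..t}" for s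
  proof -
    have "norm (integral {0..s} (\<lambda>s. grad s (x s) (u s) l (p s))) \<le> integral {0..s} (\<lambda>s. R s * (norm (p s) + l))"
    proof (rule integral_norm_le)
      fix r assume "r \<in> {0..s}"
      then have r: "0 \<le> r" by simp
      show "norm (grad r (x r) (u r) l (p r)) \<le> R r * (norm (p r) + l)"
        using grad_norm[OF r ux(1)[OF r] ux(2)[OF r], of l "p r"] l by simp
    qed (use grad_along_integrable[OF x pp(1)] loc_integrable_mult_continuous[OF R(1) c] in auto)
    moreover have "norm (p s) \<le> norm (p 0) + norm (integral {0..s} (\<lambda>s. grad s (x s) (u s) l (p s)))"
      using pp(2)[of s] s norm_triangle_ineq4[of "p 0"] by simp
    ultimately show ?thesis using l by linarith
  qed
  moreover have "continuous_on {0..t} (\<lambda>s. norm (p s) + l)" by (rule continuous_on_subset[OF c]) auto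
  ultimately have "norm (p t) + l \<le> 1 * exp (integral {0..t} R)"
    using gronwall[OF R(1) R_nonneg, of t "\<lambda>s. norm (p s) + l" 1 t] t by simp
  then show ?thesis by simp
qed

lemma integral_R_mono: "0 \<le> s \<Longrightarrow> s \<le> t \<Longrightarrow> integral {0..s} R \<le> integral {0..t} R"
  by (intro integral_subset_le loc_integrable_on R) (auto simp: R_nonneg)

lemma integral_R_nonneg: "0 \<le> integral {0..t} R"
  by (intro integral_nonneg loc_integrable_on R) (auto simp: R_nonneg)

lemma adj_bound_on:
  assumes x: "traj u x" and p: "adj u x l p" and l: "0 \<le> l" "norm (p 0) + l \<le> 1" and t: "0 \<le> t" "t \<le> b"
  shows "norm (p t) + l \<le> exp (integral {0..b} R)"
  using adj_bound[OF x p l t(1)] integral_R_mono[OF t] by (meson exp_le_cancel_iff order_trans)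

abbreviation "H t x u l p \<equiv> hamiltonian f g x t u l p"

lemma H_has_derivative:
  assumes "0 \<le> t" "u \<in> U t"
  shows "((\<lambda>y. H t y u l p) has_derivative (\<lambda>v. grad t x u l p \<bullet> v)) (at x)"
  unfolding hamiltonian_def inner_grad
  by (intro has_derivative_add has_derivative_inner_right has_derivative_mult_right f_der g_der assms)

lemma H_bound:
  assumes "0 \<le> t" "u \<in> U t" "norm x \<le> tube_radius R0 t"
  shows "\<bar>H t x u l p\<bar> \<le> R t * (norm p + \<bar>l\<bar>)"
proof -
  have "\<bar>p \<bullet> f t x u\<bar> \<le> norm p * R t"
    using bounds[OF assms] by (intro order_trans[OF Cauchy_Schwarz_ineq2] mult_left_mono) auto
  moreover have "\<bar>l * g t x u\<bar> \<le> \<bar>l\<bar> * R t" using bounds[OF assms] by (simp add: abs_mult mult_left_mono)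
  ultimately show ?thesis unfolding hamiltonian_def by (simp add: algebra_simps)
qed

lemma H_along_integrable:
  assumes x: "traj u x" and v: "v \<in> selectors U" and p: "continuous_on {0..} p"
  shows "loc_integrable (\<lambda>t. H t (x t) (v t) l (p t))"
proof (rule loc_integrable_bounded)
  show "(\<lambda>t. H t (x t) (v t) l (p t)) \<in> borel_measurable (lebesgue_on {0..})"
    unfolding hamiltonian_def
    by (intro borel_measurable_add borel_measurable_inner borel_measurable_times borel_measurable_const
        continuous_on_imp_measurable_half_line p measurable_along[OF f_meas f_cont v trajD(2)[OF x]]
        measurable_along[OF g_meas g_cont v trajD(2)[OF x]])
  show "loc_integrable (\<lambda>t. R t * (norm (p t) + \<bar>l\<bar>))" by (intro loc_integrable_mult_continuous R continuous_intros p)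
qed (use H_bound selectorD[OF v] traj_in_tube[OF x] in auto)

text \<open>The first-order gain in the Hamiltonian, along a state and an adjoint arc, from using \<open>v\<close> instead of \<open>u\<close>
at the times in \<open>A\<close>.\<close>

definition H_gain :: "(real \<Rightarrow> 'u) \<Rightarrow> (real \<Rightarrow> 'x) \<Rightarrow> real \<Rightarrow> (real \<Rightarrow> 'x) \<Rightarrow> (real \<Rightarrow> 'u) \<Rightarrow> real set \<Rightarrow> real \<Rightarrow> real" where
  "H_gain u x l p v A b = integral {0..b} (\<lambda>s. if s \<in> A then H s (x s) (v s) l (p s) - H s (x s) (u s) l (p s) else 0)"

lemma onorm_inner_le: "onorm (\<lambda>v. (w :: 'x) \<bullet> v) \<le> norm w"
  by (rule onorm_le) (simp add: Cauchy_Schwarz_ineq2)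

lemma H_lipschitz:
  assumes t: "0 \<le> t" "u \<in> U t" and xy: "norm x \<le> tube_radius R0 t" "norm y \<le> tube_radius R0 t"
  shows "\<bar>H t y u l p - H t x u l p\<bar> \<le> R t * (norm p + \<bar>l\<bar>) * norm (y - x)"
proof -
  have "norm (H t y u l p - H t x u l p) \<le> R t * (norm p + \<bar>l\<bar>) * norm (y - x)"
  proof (rule differentiable_bound[where S="cball 0 (tube_radius R0 t)" and f'="\<lambda>z v. grad t z u l p \<bullet> v"])
    show "((\<lambda>y. H t y u l p) has_derivative (\<lambda>v. grad t z u l p \<bullet> v)) (at z within cball 0 (tube_radius R0 t))" for z
      by (rule has_derivative_at_withinI[OF H_has_derivative[OF t]])
    show "onorm (\<lambda>v. grad t z u l p \<bullet> v) \<le> R t * (norm p + \<bar>l\<bar>)" if "z \<in> cball 0 (tube_radius R0 t)" for z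
      using that by (intro order_trans[OF onorm_inner_le grad_norm] t) auto
  qed (use xy in auto)
  then show ?thesis by simp
qed

lemma H_taylor:
  assumes t: "0 \<le> t" "u \<in> U t" and xy: "norm x \<le> tube_radius R0 t" "norm y \<le> tube_radius R0 t"
  shows "\<bar>H t y u l p - H t x u l p - grad t x u l p \<bullet> (y - x)\<bar> \<le> R t * (norm p + \<bar>l\<bar>) * (norm (y - x))\<^sup>2"
proof -
  have seg: "closed_segment x y \<subseteq> cball 0 (tube_radius R0 t)"
    using xy by (intro closed_segment_subset convex_cball) auto
  have "norm (H t y u l p - H t x u l p - grad t x u l p \<bullet> (y - x)) \<le> norm (y - x) * (R t * norm (y - x) * (norm p + \<bar>l\<bar>))"
  proof (rule differentiable_bound_linearization[where S="closed_segment x y" and f'="\<lambda>z v. grad t z u l p \<bullet> v"])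
    show "x + s *\<^sub>R (y - x) \<in> closed_segment x y" if "s \<in> {0..1}" for s
      using that by (auto simp: closed_segment_def algebra_simps intro!: exI[of _ s])
    show "((\<lambda>y. H t y u l p) has_derivative (\<lambda>v. grad t z u l p \<bullet> v)) (at z within closed_segment x y)" for z
      by (rule has_derivative_at_withinI[OF H_has_derivative[OF t]])
    show "onorm ((\<lambda>v. grad t z u l p \<bullet> v) - (\<lambda>v. grad t x u l p \<bullet> v)) \<le> R t * norm (y - x) * (norm p + \<bar>l\<bar>)"
      if z: "z \<in> closed_segment x y" for z
    proof -
      have eq: "(\<lambda>v. grad t z u l p \<bullet> v) - (\<lambda>v. grad t x u l p \<bullet> v) = (\<lambda>v. (grad t z u l p - grad t x u l p) \<bullet> v)"
        by (simp add: fun_eq_iff inner_diff_left)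
      have "onorm ((\<lambda>v. grad t z u l p \<bullet> v) - (\<lambda>v. grad t x u l p \<bullet> v)) \<le> norm (grad t z u l p - grad t x u l p)"
        unfolding eq by (rule onorm_inner_le)
      also have "\<dots> \<le> R t * norm (z - x) * (norm p + \<bar>l\<bar>)"
        using z seg xy by (intro grad_lipschitz_state t) auto
      also have "\<dots> \<le> R t * norm (y - x) * (norm p + \<bar>l\<bar>)"
        using z R_nonneg[OF t(1)] segment_bound1[OF z] by (intro mult_left_mono mult_right_mono) (auto simp: norm_minus_commute)
      finally show ?thesis .
    qed
  qed auto
  then show ?thesis by (simp add: power2_eq_square algebra_simps)
qed

section \<open>Variation of the payoff and penalized near-maximizers\<close>

definition variation_const :: "real \<Rightarrow> real" where
  "variation_const \<tau> = 4 * exp (3 * integral {0..\<tau>} R) * integral {0..\<tau>} R + 4 * exp (2 * integral {0..\<tau>} R)"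

lemma variation_const_nonneg: "0 \<le> variation_const \<tau>"
  using integral_R_nonneg by (simp add: variation_const_def)

text \<open>The product of the adjoint arc with the difference of the states vanishes at both ends of the
interval. The integral of its derivative is therefore zero and may be added to the difference of the
payoffs.\<close>

lemma payoff_variation_identity:
  assumes x: "traj u x" and y: "traj v y" and p: "adj u x l p" and \<tau>: "0 \<le> \<tau>" "p \<tau> = 0"
  shows "((\<lambda>t. H t (y t) (v t) l (p t) - H t (x t) (u t) l (p t) - grad t (x t) (u t) l (p t) \<bullet> (y t - x t))
     has_integral l * (payoff g y v \<tau> - payoff g x u \<tau>)) {0..\<tau>}"
proof -
  note xx = trajD[OF x] and yy = trajD[OF y] and pp = adjD[OF p]
  define h where "h t = f t (y t) (v t) - f t (x t) (u t)" for t
  define k where "k t = - grad t (x t) (u t) l (p t)" for t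
  have hI: "loc_integrable h" unfolding h_def
    by (intro loc_integrable_diff f_along_integrable xx yy)
  have kI: "loc_integrable k" unfolding k_def
    using loc_integrable_diff[OF loc_integrable_const grad_along_integrable[OF x pp(1)], of 0] by simp
  have \<Delta>: "0 + integral {0..t} h = y t - x t" if "0 \<le> t" for t
    unfolding h_def using xx(3)[OF that] yy(3)[OF that]
      integral_diff[OF loc_integrable_on(2)[OF f_along_integrable'[OF y yy(1)]] loc_integrable_on(2)[OF f_along_integrable'[OF x xx(1)]]] by simp
  have P: "p 0 + integral {0..t} k = p t" if "0 \<le> t" for t
    unfolding k_def using pp(2)[OF that] by simp
  have "((\<lambda>t. h t \<bullet> (p 0 + integral {0..t} k) + (0 + integral {0..t} h) \<bullet> k t) has_integral
      (0 + integral {0..\<tau>} h) \<bullet> (p 0 + integral {0..\<tau>} k) - (0 + integral {0..0} h) \<bullet> (p 0 + integral {0..0} k)) {0..\<tau>}"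
    by (rule inner_primitives_has_integral[OF hI kI \<tau>(1)]) auto
  then have "((\<lambda>t. h t \<bullet> (p 0 + integral {0..t} k) + (0 + integral {0..t} h) \<bullet> k t) has_integral 0) {0..\<tau>}"
    using P[OF \<tau>(1)] \<tau>(2) by simp
  then have 1: "((\<lambda>t. h t \<bullet> p t + (y t - x t) \<bullet> k t) has_integral 0) {0..\<tau>}"
    by (rule has_integral_eq[rotated]) (simp add: P \<Delta>[unfolded add_0])
  have gy: "(\<lambda>t. g t (y t) (v t)) integrable_on {0..\<tau>}" and gx: "(\<lambda>t. g t (x t) (u t)) integrable_on {0..\<tau>}"
    using g_along_integrable[OF y yy(1)] g_along_integrable[OF x xx(1)] by (auto intro: loc_integrable_on)
  have "((\<lambda>t. l * (g t (y t) (v t) - g t (x t) (u t))) has_integral l * (payoff g y v \<tau> - payoff g x u \<tau>)) {0..\<tau>}"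
    unfolding payoff_eq_integral[OF x] payoff_eq_integral[OF y]
    by (intro has_integral_mult_right has_integral_diff integrable_integral gx gy)
  from has_integral_add[OF this 1] show ?thesis
    by (simp add: h_def k_def hamiltonian_def inner_diff_left inner_diff_right inner_commute algebra_simps)
qed

text \<open>The first-order formula has an error that is quadratic in the distance \<open>d\<close> of the controls: the states
differ by at most a multiple of \<open>d\<close>. Where the controls agree, the error is a Taylor remainder of
second order. Where they differ, it is of first order in the difference of the states, but this set
of times has \<open>R\<close>-measure \<open>d\<close>.\<close>

lemma payoff_variation:
  assumes x: "traj u x" and y: "traj v y" and p: "adj u x l p" and \<tau>: "0 \<le> \<tau>" "p \<tau> = 0"
    and l: "0 \<le> l" "norm (p 0) + l \<le> 1"
  shows "integral {0..\<tau>} (\<lambda>t. H t (x t) (v t) l (p t) - H t (x t) (u t) l (p t))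
     \<le> l * (payoff g y v \<tau> - payoff g x u \<tau>) + variation_const \<tau> * (control_dist u v \<tau>)\<^sup>2"
proof -
  note xx = trajD[OF x] and yy = trajD[OF y] and pp = adjD[OF p]
  define \<Lambda> where "\<Lambda> = integral {0..\<tau>} R"
  define Q where "Q = exp \<Lambda>"
  define d where "d = control_dist u v \<tau>"
  define M where "M = 2 * d * Q"
  define I where "I t = H t (y t) (v t) l (p t) - H t (x t) (u t) l (p t) - grad t (x t) (u t) l (p t) \<bullet> (y t - x t)" for t
  define e where "e t = Q * M\<^sup>2 * R t + 2 * Q * M * (if u t = v t then 0 else R t)" for t
  have d0: "0 \<le> d" unfolding d_def by (rule control_dist_nonneg[OF xx(1) yy(1)])
  have Q0: "0 < Q" by (simp add: Q_def)
  have M0: "0 \<le> M" using d0 Q0 by (simp add: M_def)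
  have II: "(I has_integral l * (payoff g y v \<tau> - payoff g x u \<tau>)) {0..\<tau>}"
    unfolding I_def by (rule payoff_variation_identity[OF x y p \<tau>])
  note DI = control_dist_integrable[OF xx(1) yy(1)]
  have eI: "(e has_integral Q * M\<^sup>2 * \<Lambda> + 2 * Q * M * d) {0..\<tau>}"
    unfolding e_def \<Lambda>_def d_def control_dist_def
    by (intro has_integral_add has_integral_mult_right integrable_integral loc_integrable_on R DI) auto
  have HI: "(\<lambda>t. H t (x t) (v t) l (p t) - H t (x t) (u t) l (p t)) integrable_on {0..\<tau>}"
    by (intro integrable_diff loc_integrable_on(2)[OF H_along_integrable[OF x _ pp(1)]] xx yy) auto
  have "integral {0..\<tau>} (\<lambda>t. H t (x t) (v t) l (p t) - H t (x t) (u t) l (p t)) \<le> integral {0..\<tau>} (\<lambda>t. I t + e t)"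
  proof (rule integral_le[OF HI])
    show "(\<lambda>t. I t + e t) integrable_on {0..\<tau>}" using II eI by (intro integrable_add) auto
    fix t assume "t \<in> {0..\<tau>}"
    then have t: "0 \<le> t" "t \<le> \<tau>" by auto
    note tube = traj_in_tube[OF x t(1)] traj_in_tube[OF y t(1)] and uU = selectorD[OF xx(1) t(1)] and vU = selectorD[OF yy(1) t(1)]
    have q: "norm (p t) + \<bar>l\<bar> \<le> Q" using adj_bound_on[OF x p l t] l by (simp add: Q_def \<Lambda>_def)
    have "norm (x t - y t) \<le> 2 * control_dist u v t * exp (integral {0..t} R)" by (rule traj_stability[OF x y t(1)])
    also have "\<dots> \<le> 2 * d * Q"
      unfolding d_def Q_def \<Lambda>_def
      using control_dist_nonneg[OF xx(1) yy(1)] control_dist_mono[OF xx(1) yy(1) t(2)] integral_R_mono[OF t]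
      by (intro mult_mono) auto
    finally have m: "norm (y t - x t) \<le> M" by (simp add: M_def norm_minus_commute)
    have R0': "0 \<le> R t" by (rule R_nonneg[OF t(1)])
    have "- (H t (y t) (v t) l (p t) - H t (x t) (v t) l (p t) - grad t (x t) (u t) l (p t) \<bullet> (y t - x t)) \<le> e t"
    proof (cases "u t = v t")
      case True
      have "\<bar>H t (y t) (v t) l (p t) - H t (x t) (v t) l (p t) - grad t (x t) (v t) l (p t) \<bullet> (y t - x t)\<bar>
         \<le> R t * (norm (p t) + \<bar>l\<bar>) * (norm (y t - x t))\<^sup>2"
        by (rule H_taylor[OF t(1) vU tube])
      also have "\<dots> \<le> R t * Q * M\<^sup>2"
        using q m R0' Q0 by (intro mult_mono power_mono) auto
      finally show ?thesis using True by (simp add: e_def algebra_simps)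
    next
      case False
      have "\<bar>H t (y t) (v t) l (p t) - H t (x t) (v t) l (p t)\<bar> \<le> R t * (norm (p t) + \<bar>l\<bar>) * norm (y t - x t)"
        by (rule H_lipschitz[OF t(1) vU tube])
      also have "\<dots> \<le> R t * Q * M" using q m R0' Q0 by (intro mult_mono) auto
      finally have a: "\<bar>H t (y t) (v t) l (p t) - H t (x t) (v t) l (p t)\<bar> \<le> R t * Q * M" .
      have "\<bar>grad t (x t) (u t) l (p t) \<bullet> (y t - x t)\<bar> \<le> norm (grad t (x t) (u t) l (p t)) * norm (y t - x t)"
        by (rule Cauchy_Schwarz_ineq2)
      also have "\<dots> \<le> (R t * (norm (p t) + \<bar>l\<bar>)) * norm (y t - x t)"
        by (intro mult_right_mono grad_norm t uU tube) auto
      also have "\<dots> \<le> R t * Q * M" using q m R0' Q0 by (intro mult_mono) auto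
      finally have b: "\<bar>grad t (x t) (u t) l (p t) \<bullet> (y t - x t)\<bar> \<le> R t * Q * M" .
      have "0 \<le> Q * M\<^sup>2 * R t" using Q0 R0' by simp
      then show ?thesis using a b False unfolding e_def by (simp add: algebra_simps abs_le_iff)
    qed
    then show "H t (x t) (v t) l (p t) - H t (x t) (u t) l (p t) \<le> I t + e t" by (simp add: I_def)
  qed
  also have "\<dots> = l * (payoff g y v \<tau> - payoff g x u \<tau>) + (Q * M\<^sup>2 * \<Lambda> + 2 * Q * M * d)"
    by (rule integral_unique[OF has_integral_add[OF II eI]])
  also have "Q * M\<^sup>2 * \<Lambda> + 2 * Q * M * d = variation_const \<tau> * d\<^sup>2"
  proof -
    have "exp (3 * \<Lambda>) = Q ^ 3" "exp (2 * \<Lambda>) = Q ^ 2"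
      unfolding Q_def by (simp_all add: exp_of_nat_mult[symmetric])
    then show ?thesis by (simp add: variation_const_def \<Lambda>_def[symmetric] M_def power2_eq_square power3_eq_cube algebra_simps)
  qed
  finally show ?thesis by (simp add: d_def)
qed

text \<open>Ekeland's variational principle up to an error \<open>\<kappa>\<close>: by the triangle inequality, a control that
maximizes the payoff penalized by \<open>\<delta>\<close> times the distance from \<open>u0\<close>, within \<open>\<kappa>\<close>, has the stated property.\<close>

lemma near_maximizer:
  assumes C: "C \<subseteq> selectors U" and u0: "u0 \<in> C" and x0: "traj u0 x0"
    and opt: "\<And>u x. u \<in> C \<Longrightarrow> traj u x \<Longrightarrow> payoff g x u \<tau> \<le> payoff g x0 u0 \<tau> + \<delta>\<^sup>2"
    and \<delta>: "0 < \<delta>" and \<kappa>: "0 < \<kappa>" "\<kappa> \<le> \<delta>\<^sup>2"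
  shows "\<exists>u x. u \<in> C \<and> traj u x \<and> control_dist u u0 \<tau> \<le> 2 * \<delta> \<and>
     (\<forall>v y. v \<in> C \<longrightarrow> traj v y \<longrightarrow> payoff g y v \<tau> \<le> payoff g x u \<tau> + \<delta> * control_dist u v \<tau> + \<kappa>)"
proof -
  define S where "S = {payoff g x u \<tau> - \<delta> * control_dist u u0 \<tau> | u x. u \<in> C \<and> traj u x}"
  have d0: "0 \<le> control_dist u v \<tau>" if "u \<in> C" "v \<in> C" for u v
    using that C by (intro control_dist_nonneg) auto
  have bd: "s \<le> payoff g x0 u0 \<tau> + \<delta>\<^sup>2" if "s \<in> S" for s
  proof -
    obtain u x where ux: "u \<in> C" "traj u x" and s: "s = payoff g x u \<tau> - \<delta> * control_dist u u0 \<tau>" using \<open>s \<in> S\<close> by (auto simp: S_def)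
    have "0 \<le> \<delta> * control_dist u u0 \<tau>" using d0[OF ux(1) u0] \<delta> by simp
    then show ?thesis using opt[OF ux] s by linarith
  qed
  then have bdd: "bdd_above S" by (auto simp: bdd_above_def)
  have mem0: "payoff g x0 u0 \<tau> \<in> S"
    unfolding S_def using u0 x0 by (force simp: control_dist_def)
  obtain s where s: "s \<in> S" "Sup S - \<kappa> < s"
    using less_cSupE[of "Sup S - \<kappa>" S] mem0 \<kappa> by auto
  then obtain u x where ux: "u \<in> C" "traj u x" and su: "s = payoff g x u \<tau> - \<delta> * control_dist u u0 \<tau>" by (auto simp: S_def)
  have "payoff g x0 u0 \<tau> \<le> Sup S" by (rule cSup_upper[OF mem0 bdd])
  then have "payoff g x0 u0 \<tau> - \<kappa> < payoff g x u \<tau> - \<delta> * control_dist u u0 \<tau>" using s su by simp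
  then have "\<delta> * control_dist u u0 \<tau> \<le> \<delta>\<^sup>2 + \<kappa>" using opt[OF ux] by simp
  also have "\<dots> \<le> \<delta> * (2 * \<delta>)" using \<kappa> by (simp add: power2_eq_square)
  finally have near: "control_dist u u0 \<tau> \<le> 2 * \<delta>" using \<delta> by simp
  have "payoff g y v \<tau> \<le> payoff g x u \<tau> + \<delta> * control_dist u v \<tau> + \<kappa>" if v: "v \<in> C" "traj v y" for v y
  proof -
    have sel: "u \<in> selectors U" "v \<in> selectors U" "u0 \<in> selectors U" using C u0 ux v by auto
    have "payoff g y v \<tau> - \<delta> * control_dist v u0 \<tau> \<le> Sup S"
      using v by (intro cSup_upper bdd) (auto simp: S_def)
    moreover have "control_dist v u0 \<tau> \<le> control_dist u v \<tau> + control_dist u u0 \<tau>"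
    proof -
      note I = control_dist_integrable[OF sel(2,3)] control_dist_integrable[OF sel(1,2)] control_dist_integrable[OF sel(1,3)]
      have "control_dist v u0 \<tau> \<le> integral {0..\<tau>} (\<lambda>s. (if u s = v s then 0 else R s) + (if u s = u0 s then 0 else R s))"
        unfolding control_dist_def
      proof (rule integral_le)
        show "(\<lambda>s. if v s = u0 s then 0 else R s) integrable_on {0..\<tau>}"
          by (rule loc_integrable_on(2)[OF I(1)]) simp
        show "(\<lambda>s. (if u s = v s then 0 else R s) + (if u s = u0 s then 0 else R s)) integrable_on {0..\<tau>}"
          by (intro integrable_add loc_integrable_on(2)[OF I(2)] loc_integrable_on(2)[OF I(3)]) auto
      qed (use R_nonneg in auto)
      also have "\<dots> = control_dist u v \<tau> + control_dist u u0 \<tau>"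
        unfolding control_dist_def by (rule integral_add) (auto intro!: loc_integrable_on I)
      finally show ?thesis .
    qed
    then have "\<delta> * control_dist v u0 \<tau> \<le> \<delta> * (control_dist u v \<tau> + control_dist u u0 \<tau>)" using \<delta> by simp
    ultimately show ?thesis using s su by (simp add: algebra_simps)
  qed
  then show ?thesis using ux near by blast
qed

text \<open>The near-maximizer is compared with its modifications on the parts of \<open>A\<close> in short time intervals. On
such a part the quadratic error of the first-order formula is at most \<open>\<eta>\<close> times a linear one. The
number \<open>m\<close> of intervals is determined by \<open>\<eta>\<close>, and \<open>\<kappa>\<close> is chosen after \<open>m\<close>, so that \<open>m\<close> errors of size \<open>\<kappa>\<close>
remain harmless. The constant in the quadratic error depends only on the horizon, which allows the
control to be chosen last.\<close>

theorem near_maximizer_maximum_principle: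
  assumes C: "C \<subseteq> selectors U" and u0: "u0 \<in> C" and x0: "traj u0 x0"
    and opt: "\<And>u x. u \<in> C \<Longrightarrow> traj u x \<Longrightarrow> payoff g x u \<tau> \<le> payoff g x0 u0 \<tau> + \<delta>\<^sup>2"
    and \<delta>: "0 < \<delta>" and \<tau>: "0 < \<tau>"
    and patch: "\<And>u v A. u \<in> C \<Longrightarrow> v \<in> W \<Longrightarrow> A \<in> sets borel \<Longrightarrow> A \<subseteq> {0..\<tau>} \<Longrightarrow> (\<lambda>t. if t \<in> A then v t else u t) \<in> C"
    and W: "W \<subseteq> selectors U"
  shows "\<exists>u x l p. u \<in> C \<and> traj u x \<and> control_dist u u0 \<tau> \<le> 2 * \<delta> \<and> adj u x l p \<and> 0 < l \<and> l \<le> 1 \<and>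
     norm (p 0) + l = 1 \<and> p \<tau> = 0 \<and>
     (\<forall>v\<in>W. \<forall>A\<in>sets borel. H_gain u x l p v A \<tau>
       \<le> \<delta> * integral {0..\<tau>} (\<lambda>s. if s \<in> A then R s else 0) + \<delta>)"
proof -
  define c where "c = variation_const \<tau>"
  have c0: "0 \<le> c" unfolding c_def by (rule variation_const_nonneg)
  define \<Lambda> where "\<Lambda> t = integral {0..t} R" for t
  have \<Lambda>0: "0 \<le> \<Lambda> t" for t unfolding \<Lambda>_def by (rule integral_R_nonneg)
  define \<eta> where "\<eta> = \<delta> / (2 * (c * \<Lambda> \<tau> + 1))"
  have pos: "0 < c * \<Lambda> \<tau> + 1" using c0 \<Lambda>0[of \<tau>] by (simp add: add_nonneg_pos)
  have \<eta>: "0 < \<eta>" "c * \<eta> * \<Lambda> \<tau> \<le> \<delta> / 2"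
    using pos \<delta> by (auto simp: \<eta>_def field_simps)
  have "continuous_on {0..\<tau>} \<Lambda>"
    using continuous_on_subset[OF continuous_on_primitive[OF R(1), of 0], of "{0..\<tau>}"] by (simp add: \<Lambda>_def[abs_def])
  then have "uniformly_continuous_on {0..\<tau>} \<Lambda>" by (rule compact_uniformly_continuous) simp
  then obtain h where h: "0 < h" "\<And>s t. s \<in> {0..\<tau>} \<Longrightarrow> t \<in> {0..\<tau>} \<Longrightarrow> dist s t < h \<Longrightarrow> dist (\<Lambda> s) (\<Lambda> t) < \<eta>"
    unfolding uniformly_continuous_on_def using \<eta>(1) by metis
  obtain m where m: "\<tau> / h < real m" using reals_Archimedean2 by blast
  have m0: "0 < m" using m \<tau> h(1) by (cases m) (auto simp: divide_less_0_iff)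
  define \<sigma> where "\<sigma> i = real i * \<tau> / real m" for i
  have \<sigma>: "0 \<le> \<sigma> i" "\<sigma> i \<le> \<sigma> (Suc i)" "dist (\<sigma> (Suc i)) (\<sigma> i) < h" for i
  proof -
    show "0 \<le> \<sigma> i" "\<sigma> i \<le> \<sigma> (Suc i)" using \<tau> by (auto simp: \<sigma>_def divide_right_mono)
    have "\<sigma> (Suc i) - \<sigma> i = \<tau> / real m" by (simp add: \<sigma>_def add_divide_distrib distrib_right)
    moreover have "\<tau> / real m < h" using m m0 h(1) by (simp add: field_simps)
    ultimately show "dist (\<sigma> (Suc i)) (\<sigma> i) < h" using \<open>\<sigma> i \<le> \<sigma> (Suc i)\<close> by (simp add: dist_real_def)
  qed
  have \<sigma>\<tau>: "\<sigma> i \<le> \<tau>" if "i \<le> m" for i using that m0 \<tau> by (simp add: \<sigma>_def field_simps)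
  define \<kappa> where "\<kappa> = min (\<delta>\<^sup>2) (\<delta> / (2 * real m))"
  have \<kappa>: "0 < \<kappa>" "\<kappa> \<le> \<delta>\<^sup>2" using \<delta> m0 by (auto simp: \<kappa>_def)
  have m\<kappa>: "real m * \<kappa> \<le> \<delta> / 2"
  proof -
    have "real m * \<kappa> \<le> real m * (\<delta> / (2 * real m))" by (intro mult_left_mono) (auto simp: \<kappa>_def)
    then show ?thesis using m0 by simp
  qed
  obtain u x where u: "u \<in> C" and x: "traj u x" and near: "control_dist u u0 \<tau> \<le> 2 * \<delta>"
    and best: "\<And>v y. v \<in> C \<Longrightarrow> traj v y \<Longrightarrow> payoff g y v \<tau> \<le> payoff g x u \<tau> + \<delta> * control_dist u v \<tau> + \<kappa>"
    using near_maximizer[OF C u0 x0 opt \<delta> \<kappa>] by blast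
  obtain l p where p: "adj u x l p" and l: "0 < l" "l \<le> 1" "norm (p 0) + l = 1" and p\<tau>: "p \<tau> = 0"
    using adj_terminal_exists[OF x, of \<tau>] \<tau> by auto
  have "H_gain u x l p v A \<tau>
       \<le> \<delta> * integral {0..\<tau>} (\<lambda>s. if s \<in> A then R s else 0) + \<delta>" if v: "v \<in> W" and A: "A \<in> sets borel" for v A
  proof -
    define G where "G s = (if s \<in> A then H s (x s) (v s) l (p s) - H s (x s) (u s) l (p s) else 0)" for s
    define r where "r s = (if s \<in> A then R s else 0)" for s
    have vs: "v \<in> selectors U" using v W by auto
    have GI: "loc_integrable G" unfolding G_def
      by (intro loc_integrable_restrict loc_integrable_diff H_along_integrable[OF x _ adjD(1)[OF p]] vs trajD[OF x] A)
    have rI: "loc_integrable r" unfolding r_def by (intro loc_integrable_restrict R A)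
    have r0: "0 \<le> r s" if "0 \<le> s" for s using R_nonneg[OF that] by (simp add: r_def)
    have piece: "integral {a..b} G \<le> (\<delta> + c * \<eta>) * integral {a..b} r + \<kappa>"
      if ab: "0 \<le> a" "a \<le> b" "b \<le> \<tau>" "dist b a < h" for a b
    proof -
      define A' where "A' = A \<inter> {a..b}"
      define w where "w t = (if t \<in> A' then v t else u t)" for t
      have w: "w \<in> C" unfolding w_def A'_def by (rule patch[OF u v]) (use A ab in auto)
      then obtain y where y: "traj w y" using C traj_exists by blast
      define \<rho> where "\<rho> = integral {a..b} r"
      have sub: "{a..b} \<inter> {0..\<tau>} = {a..b}" using ab by auto
      have \<rho>0: "0 \<le> \<rho>" unfolding \<rho>_def using ab r0 by (intro integral_nonneg loc_integrable_on rI) auto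
      have "\<rho> \<le> integral {a..b} R"
        unfolding \<rho>_def using ab R_nonneg by (intro integral_le loc_integrable_on rI R) (auto simp: r_def)
      also have "\<dots> = \<Lambda> b - \<Lambda> a" unfolding \<Lambda>_def by (rule primitive_diff[OF R(1) ab(1,2), symmetric])
      also have "\<dots> \<le> \<eta>" using h(2)[of b a] ab by (auto simp: dist_real_def)
      finally have \<rho>\<eta>: "\<rho> \<le> \<eta>" .
      have "integral {0..\<tau>} (\<lambda>s. if s \<in> {a..b} then G s else 0) = integral {a..b} G"
        unfolding integral_restrict_Int sub ..
      moreover have "(\<lambda>s. if s \<in> {a..b} then G s else 0) = (\<lambda>t. H t (x t) (w t) l (p t) - H t (x t) (u t) l (p t))"
        by (auto simp: fun_eq_iff G_def w_def A'_def)
      ultimately have GH: "integral {a..b} G = integral {0..\<tau>} (\<lambda>t. H t (x t) (w t) l (p t) - H t (x t) (u t) l (p t))" by simp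
      have d: "control_dist u w \<tau> \<le> \<rho>"
      proof -
        have "control_dist u w \<tau> \<le> integral {0..\<tau>} (\<lambda>s. if s \<in> {a..b} then r s else 0)"
          unfolding control_dist_def
        proof (rule integral_le)
          show "(\<lambda>s. if s \<in> {a..b} then r s else 0) integrable_on {0..\<tau>}"
            unfolding integrable_restrict_Int sub using ab by (intro loc_integrable_on rI)
          show "(\<lambda>s. if u s = w s then 0 else R s) integrable_on {0..\<tau>}"
            using C u w by (intro loc_integrable_on control_dist_integrable) auto
        qed (auto simp: w_def A'_def r_def R_nonneg)
        then show ?thesis unfolding integral_restrict_Int sub \<rho>_def .
      qed
      have d0: "0 \<le> control_dist u w \<tau>" using C u w by (intro control_dist_nonneg) auto
      have "integral {a..b} G \<le> l * (payoff g y w \<tau> - payoff g x u \<tau>) + c * (control_dist u w \<tau>)\<^sup>2"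
        unfolding GH c_def using \<tau> l p\<tau> by (intro payoff_variation[OF x y p]) auto
      also have "\<dots> \<le> (\<delta> * \<rho> + \<kappa>) + c * (\<eta> * \<rho>)"
      proof (rule add_mono)
        have "payoff g y w \<tau> - payoff g x u \<tau> \<le> \<delta> * \<rho> + \<kappa>"
          using best[OF w y] mult_left_mono[OF d, of \<delta>] \<delta> by linarith
        then have "l * (payoff g y w \<tau> - payoff g x u \<tau>) \<le> l * (\<delta> * \<rho> + \<kappa>)" using l by (intro mult_left_mono) auto
        also have "\<dots> \<le> 1 * (\<delta> * \<rho> + \<kappa>)" using l \<delta> \<rho>0 \<kappa> by (intro mult_right_mono) auto
        finally show "l * (payoff g y w \<tau> - payoff g x u \<tau>) \<le> \<delta> * \<rho> + \<kappa>" by simp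
        have "(control_dist u w \<tau>)\<^sup>2 \<le> \<eta> * \<rho>"
          unfolding power2_eq_square using d d0 \<rho>\<eta> \<rho>0 by (intro mult_mono) auto
        then show "c * (control_dist u w \<tau>)\<^sup>2 \<le> c * (\<eta> * \<rho>)" using c0 by (rule mult_left_mono)
      qed
      finally show ?thesis by (simp add: \<rho>_def algebra_simps)
    qed
    have "integral {0..\<sigma> i} G \<le> (\<delta> + c * \<eta>) * integral {0..\<sigma> i} r + real i * \<kappa>" if "i \<le> m" for i
      using that
    proof (induction i)
      case 0 then show ?case by (simp add: \<sigma>_def)
    next
      case (Suc i)
      have "integral {\<sigma> i..\<sigma> (Suc i)} G \<le> (\<delta> + c * \<eta>) * integral {\<sigma> i..\<sigma> (Suc i)} r + \<kappa>"
        by (rule piece[OF \<sigma>(1,2) \<sigma>\<tau> \<sigma>(3)]) (use Suc in simp)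
      moreover have "integral {0..\<sigma> (Suc i)} G = integral {0..\<sigma> i} G + integral {\<sigma> i..\<sigma> (Suc i)} G"
         "integral {0..\<sigma> (Suc i)} r = integral {0..\<sigma> i} r + integral {\<sigma> i..\<sigma> (Suc i)} r"
        using primitive_diff[OF GI \<sigma>(1,2)] primitive_diff[OF rI \<sigma>(1,2)] by (simp_all add: algebra_simps)
      ultimately show ?case using Suc by (simp add: algebra_simps)
    qed
    from this[of m] have "integral {0..\<tau>} G \<le> (\<delta> + c * \<eta>) * integral {0..\<tau>} r + real m * \<kappa>"
      using m0 by (simp add: \<sigma>_def)
    also have "\<dots> = \<delta> * integral {0..\<tau>} r + c * \<eta> * integral {0..\<tau>} r + real m * \<kappa>" by (simp add: distrib_right)
    also have "c * \<eta> * integral {0..\<tau>} r \<le> c * \<eta> * \<Lambda> \<tau>"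
      unfolding \<Lambda>_def using c0 \<eta>(1) R_nonneg by (intro mult_left_mono integral_le loc_integrable_on rI R) (auto simp: r_def)
    also have "\<delta> * integral {0..\<tau>} r + c * \<eta> * \<Lambda> \<tau> + real m * \<kappa> \<le> \<delta> * integral {0..\<tau>} r + \<delta>"
      using \<eta>(2) m\<kappa> by linarith
    finally show ?thesis by (simp add: H_gain_def G_def[abs_def] r_def[abs_def])
  qed
  then show ?thesis using u x near p l p\<tau> by blast
qed

end

section \<open>Passage to the limit\<close>

lemma AE_nonpos_from_integrals:
  fixes \<phi> :: "real \<Rightarrow> real"
  assumes \<phi>: "loc_integrable \<phi>"
    and le: "\<And>b A. 0 \<le> b \<Longrightarrow> A \<in> sets borel \<Longrightarrow> integral {0..b} (\<lambda>s. if s \<in> A then \<phi> s else 0) \<le> 0"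
  shows "AE t in lebesgue_on {0..}. \<phi> t \<le> 0"
proof -
  define S where "S = {t \<in> space (lebesgue_on {0..}). 0 < \<phi> t}"
  have "S \<in> sets (lebesgue_on {0..})"
    unfolding S_def by (rule borel_measurable_less[OF borel_measurable_const loc_integrable_measurable[OF \<phi>]])
  then have "S \<in> sets lebesgue" by (simp add: sets_restrict_space_iff)
  then obtain B N where BN: "B \<in> sets borel" "negligible N" "B \<union> N = S"
    by (rule sets_lebesgue_almost_borel)
  have pos: "0 < \<phi> t" "0 \<le> t" if "t \<in> B" for t using that BN(3) by (auto simp: S_def)
  have "negligible (B \<inter> {0..real n})" for n
  proof -
    define \<psi> where "\<psi> s = (if s \<in> B then \<phi> s else 0)" for s
    have I: "loc_integrable \<psi>" unfolding \<psi>_def by (rule loc_integrable_restrict[OF \<phi> BN(1)])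
    have nn: "0 \<le> \<psi> s" for s using pos(1)[of s] by (simp add: \<psi>_def less_imp_le)
    have "integral {0..real n} \<psi> \<le> 0" unfolding \<psi>_def by (rule le) (use BN in auto)
    moreover have "0 \<le> integral {0..real n} \<psi>" by (intro integral_nonneg loc_integrable_on I nn) auto
    ultimately have "integral {0..real n} \<psi> = 0" by simp
    moreover have "set_integrable lebesgue {0..real n} \<psi>" by (rule loc_integrable_on(1)[OF I]) simp
    ultimately have int: "integrable lebesgue (\<lambda>s. indicator {0..real n} s *\<^sub>R \<psi> s)"
      and zero: "(LINT s|lebesgue. indicator {0..real n} s *\<^sub>R \<psi> s) = 0"
      using set_lebesgue_integral_eq_integral(2)[of "{0..real n}" \<psi>]
      by (simp_all add: set_integrable_def set_lebesgue_integral_def)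
    have "AE s in lebesgue. indicator {0..real n} s *\<^sub>R \<psi> s = 0"
      using zero by (subst (asm) integral_nonneg_eq_0_iff_AE[OF int]) (auto simp: nn)
    then have "AE s in lebesgue. s \<notin> B \<inter> {0..real n}"
      by (rule eventually_mono) (use pos in \<open>force simp: \<psi>_def indicator_def split: if_splits\<close>)
    moreover have "B \<inter> {0..real n} \<in> sets lebesgue" using BN(1) by (intro sets.Int) auto
    ultimately show ?thesis by (simp add: AE_iff_null_sets negligible_iff_null_sets)
  qed
  then have "negligible (\<Union>n. B \<inter> {0..real n})" by (intro negligible_countable_Union) auto
  moreover have "B \<subseteq> (\<Union>n. B \<inter> {0..real n})" using pos(2) real_arch_simple by fastforce
  ultimately have "negligible S" using BN(2,3) by (metis negligible_Un negligible_subset)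
  then have "AE t in lebesgue. t \<notin> S" by (simp add: negligible_iff_null_sets AE_not_in)
  then show ?thesis
    by (subst AE_restrict_space_iff) (auto simp: S_def elim!: eventually_mono)
qed

context control_problem
begin

definition stability_const :: "real \<Rightarrow> real" where
  "stability_const b = exp (integral {0..b} R)"

lemma stability_const_ge_1: "1 \<le> stability_const b"
  using integral_R_nonneg by (simp add: stability_const_def)

lemma traj_stability_on:
  assumes x: "traj u x" and y: "traj v y" and t: "0 \<le> t" "t \<le> b"
  shows "norm (x t - y t) \<le> 2 * control_dist u v b * stability_const b"
proof -
  have "norm (x t - y t) \<le> 2 * control_dist u v t * exp (integral {0..t} R)" by (rule traj_stability[OF x y t(1)])
  also have "\<dots> \<le> 2 * control_dist u v b * stability_const b"
    unfolding stability_const_def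
    using control_dist_nonneg[OF trajD(1)[OF x] trajD(1)[OF y]] control_dist_mono[OF trajD(1)[OF x] trajD(1)[OF y] t(2)]
      integral_R_mono[OF t] by (intro mult_mono) auto
  finally show ?thesis .
qed

text \<open>The adjoint equations differ where the controls differ, and elsewhere through the states and the
multipliers; Gronwall's inequality turns this into a bound for the arcs.\<close>

lemma adj_stability:
  assumes x: "traj u x" and y: "traj v y" and p: "adj u x l p" and q: "adj v y k q"
    and k: "0 \<le> k" "norm (q 0) + k \<le> 1" and t: "0 \<le> t" "t \<le> b"
  shows "norm (p t - q t) \<le> (norm (p 0 - q 0) +
     (\<bar>l - k\<bar> + 2 * control_dist u v b * (stability_const b)\<^sup>2) * integral {0..b} R
      + 2 * stability_const b * control_dist u v b) * stability_const b"
proof -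
  note xx = trajD[OF x] and yy = trajD[OF y] and pp = adjD[OF p] and qq = adjD[OF q]
  define Q where "Q = stability_const b"
  define d where "d = control_dist u v b"
  define M where "M = 2 * d * Q"
  define A where "A = norm (p 0 - q 0) + (\<bar>l - k\<bar> + M * Q) * integral {0..b} R + 2 * Q * d"
  have Q1: "1 \<le> Q" unfolding Q_def by (rule stability_const_ge_1)
  note DI = control_dist_integrable[OF xx(1) yy(1)]
  have d0: "0 \<le> d" unfolding d_def by (rule control_dist_nonneg[OF xx(1) yy(1)])
  have M0: "0 \<le> M" using d0 Q1 by (simp add: M_def)
  have c: "continuous_on {0..} (\<lambda>s. norm (p s - q s))" by (intro continuous_intros pp qq)
  have cI: "loc_integrable (\<lambda>s. R s * norm (p s - q s))" by (rule loc_integrable_mult_continuous[OF R(1) c])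
  have gp: "loc_integrable (\<lambda>s. grad s (x s) (u s) l (p s))" and gq: "loc_integrable (\<lambda>s. grad s (y s) (v s) k (q s))"
    by (intro grad_along_integrable x y pp qq)+
  define B where "B s = (\<bar>l - k\<bar> + M * Q) * R s + 2 * Q * (if u s = v s then 0 else R s)" for s
  have BI: "loc_integrable B" unfolding B_def by (intro loc_integrable_add loc_integrable_mult_const R DI)
  have "norm (p s - q s) \<le> A + integral {0..s} (\<lambda>s. R s * norm (p s - q s))" if s: "s \<in> {0..b}" for s
  proof -
    have "p s - q s = (p 0 - q 0) - integral {0..s} (\<lambda>s. grad s (x s) (u s) l (p s) - grad s (y s) (v s) k (q s))"
      using pp(2)[of s] qq(2)[of s] s integral_diff[OF loc_integrable_on(2)[OF gp, of 0 s] loc_integrable_on(2)[OF gq, of 0 s]] by simp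
    then have "norm (p s - q s) \<le> norm (p 0 - q 0) + norm (integral {0..s} (\<lambda>s. grad s (x s) (u s) l (p s) - grad s (y s) (v s) k (q s)))"
      using norm_triangle_ineq4[of "p 0 - q 0"] by simp
    also have "norm (integral {0..s} (\<lambda>s. grad s (x s) (u s) l (p s) - grad s (y s) (v s) k (q s)))
       \<le> integral {0..s} (\<lambda>s. B s + R s * norm (p s - q s))"
    proof (rule integral_norm_le[OF loc_integrable_diff[OF gp gq] loc_integrable_add[OF BI cI]])
      fix r assume "r \<in> {0..s}"
      then have r: "0 \<le> r" "r \<le> b" using s by auto
      note tube = traj_in_tube[OF x r(1)] traj_in_tube[OF y r(1)] and uU = selectorD[OF xx(1) r(1)] and vU = selectorD[OF yy(1) r(1)]
      have Rr: "0 \<le> R r" by (rule R_nonneg[OF r(1)])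
      have q1: "norm (q r) + \<bar>k\<bar> \<le> Q"
        using adj_bound_on[OF y q k r] k by (simp add: Q_def stability_const_def)
      have m: "norm (x r - y r) \<le> M" unfolding M_def d_def Q_def by (rule traj_stability_on[OF x y r])
      have 1: "norm (grad r (x r) (u r) l (p r) - grad r (x r) (u r) k (q r)) \<le> R r * (norm (p r - q r) + \<bar>l - k\<bar>)"
        unfolding grad_diff by (rule grad_norm[OF r(1) uU tube(1)])
      have 2: "norm (grad r (x r) (u r) k (q r) - grad r (y r) (v r) k (q r)) \<le> M * Q * R r + 2 * Q * (if u r = v r then 0 else R r)"
      proof (cases "u r = v r")
        case True
        have "norm (grad r (x r) (v r) k (q r) - grad r (y r) (v r) k (q r)) \<le> R r * norm (x r - y r) * (norm (q r) + \<bar>k\<bar>)"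
          by (rule grad_lipschitz_state[OF r(1) vU tube])
        also have "\<dots> \<le> R r * M * Q" using m q1 Rr M0 by (intro mult_mono) auto
        finally show ?thesis using True by (simp add: algebra_simps)
      next
        case False
        have a: "norm (grad r (x r) (u r) k (q r)) \<le> R r * Q" "norm (grad r (y r) (v r) k (q r)) \<le> R r * Q"
          using grad_norm[OF r(1) uU tube(1), of k "q r"] grad_norm[OF r(1) vU tube(2), of k "q r"]
            mult_left_mono[OF q1 Rr] by auto
        have "0 \<le> M * Q * R r" using M0 Q1 Rr by simp
        then show ?thesis
          using False a norm_triangle_ineq4[of "grad r (x r) (u r) k (q r)" "grad r (y r) (v r) k (q r)"] by (simp add: algebra_simps)
      qed
      show "norm (grad r (x r) (u r) l (p r) - grad r (y r) (v r) k (q r)) \<le> B r + R r * norm (p r - q r)"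
        using norm_triangle_ineq[of "grad r (x r) (u r) l (p r) - grad r (x r) (u r) k (q r)" "grad r (x r) (u r) k (q r) - grad r (y r) (v r) k (q r)"] 1 2
        by (simp add: B_def algebra_simps)
    qed simp
    also have "\<dots> = integral {0..s} B + integral {0..s} (\<lambda>s. R s * norm (p s - q s))"
      by (rule integral_add) (auto intro: loc_integrable_on BI cI)
    also have "integral {0..s} B \<le> integral {0..b} B"
      using s M0 Q1 R_nonneg by (intro integral_subset_le loc_integrable_on BI) (auto simp: B_def)
    also have "integral {0..b} B = (\<bar>l - k\<bar> + M * Q) * integral {0..b} R + 2 * Q * d"
      unfolding B_def d_def control_dist_def integral_mult_right[symmetric]
      by (intro integral_add loc_integrable_on loc_integrable_mult_const R DI) auto
    finally show ?thesis by (simp add: A_def)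
  qed
  moreover have "continuous_on {0..b} (\<lambda>s. norm (p s - q s))" by (rule continuous_on_subset[OF c]) auto
  ultimately have "norm (p t - q t) \<le> A * exp (integral {0..t} R)"
    using gronwall[OF R(1) R_nonneg, of b "\<lambda>s. norm (p s - q s)" A t] t by simp
  also have "\<dots> \<le> A * stability_const b"
    unfolding stability_const_def using integral_R_mono[OF t] integral_R_nonneg[of b] M0 Q1 d0
    by (intro mult_left_mono) (auto simp: A_def)
  finally show ?thesis by (simp add: A_def M_def Q_def d_def power2_eq_square algebra_simps)
qed

lemma H_stability:
  assumes t: "0 \<le> t" and w: "w \<in> U t" and xy: "norm x \<le> tube_radius R0 t" "norm y \<le> tube_radius R0 t"
    and Q: "norm q + \<bar>k\<bar> \<le> Q"
  shows "\<bar>H t x w l p - H t y w k q\<bar> \<le> R t * (norm (p - q) + \<bar>l - k\<bar> + Q * norm (x - y))"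
proof -
  have "\<bar>H t x w (l - k) (p - q)\<bar> \<le> R t * (norm (p - q) + \<bar>l - k\<bar>)" by (rule H_bound[OF t w xy(1)])
  moreover have "H t x w l p - H t x w k q = H t x w (l - k) (p - q)"
    by (simp add: hamiltonian_def inner_diff_left algebra_simps)
  moreover have "\<bar>H t x w k q - H t y w k q\<bar> \<le> R t * (norm q + \<bar>k\<bar>) * norm (x - y)"
    by (rule H_lipschitz[OF t w xy(2,1)])
  moreover have "R t * (norm q + \<bar>k\<bar>) * norm (x - y) \<le> R t * Q * norm (x - y)"
    using Q R_nonneg[OF t] by (intro mult_right_mono mult_left_mono) auto
  ultimately show ?thesis by (simp add: algebra_simps abs_le_iff)
qed

lemma H_gap_stability:
  assumes x: "traj u x" and y: "traj v y" and p: "continuous_on {0..} p" and q: "adj v y k q"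
    and k: "0 \<le> k" "norm (q 0) + k \<le> 1" and w: "w \<in> selectors U" and A: "A \<in> sets borel"
    and P: "\<And>t. t \<in> {0..b} \<Longrightarrow> norm (p t - q t) + \<bar>l - k\<bar> \<le> P"
  shows "H_gain v y k q w A b
    \<le> H_gain u x l p w A b
     + (2 * (P + 2 * control_dist u v b * (stability_const b)\<^sup>2) * integral {0..b} R + 2 * stability_const b * control_dist u v b)"
proof -
  note xx = trajD[OF x] and yy = trajD[OF y] and qq = adjD[OF q]
  define Q where "Q = stability_const b"
  define d where "d = control_dist u v b"
  define M where "M = 2 * d * Q"
  have Q1: "1 \<le> Q" unfolding Q_def by (rule stability_const_ge_1)
  have d0: "0 \<le> d" unfolding d_def by (rule control_dist_nonneg[OF xx(1) yy(1)])
  have M0: "0 \<le> M" using d0 Q1 by (simp add: M_def)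
  note DI = control_dist_integrable[OF xx(1) yy(1)]
  define G where "G s = (if s \<in> A then H s (y s) (w s) k (q s) - H s (y s) (v s) k (q s) else 0)" for s
  define G' where "G' s = (if s \<in> A then H s (x s) (w s) l (p s) - H s (x s) (u s) l (p s) else 0)" for s
  define e where "e s = 2 * (P + Q * M) * R s + 2 * Q * (if u s = v s then 0 else R s)" for s
  have GI: "loc_integrable G" "loc_integrable G'" unfolding G_def G'_def
    by (intro loc_integrable_restrict loc_integrable_diff A H_along_integrable[OF x _ p] H_along_integrable[OF y _ qq(1)]
        w xx(1) yy(1))+
  have eI: "loc_integrable e" unfolding e_def by (intro loc_integrable_add loc_integrable_mult_const R DI)
  have "integral {0..b} G \<le> integral {0..b} (\<lambda>s. G' s + e s)"
  proof (rule integral_le)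
    show "G integrable_on {0..b}" "(\<lambda>s. G' s + e s) integrable_on {0..b}"
      by (intro loc_integrable_on loc_integrable_add GI eI order_refl)+
    fix r assume r': "r \<in> {0..b}"
    then have r: "0 \<le> r" "r \<le> b" by auto
    note tube = traj_in_tube[OF x r(1)] traj_in_tube[OF y r(1)] and uU = selectorD[OF xx(1) r(1)] and vU = selectorD[OF yy(1) r(1)]
      and wU = selectorD[OF w r(1)]
    have Rr: "0 \<le> R r" by (rule R_nonneg[OF r(1)])
    have q1: "norm (q r) + \<bar>k\<bar> \<le> Q" using adj_bound_on[OF y q k r] k by (simp add: Q_def stability_const_def)
    have m: "norm (x r - y r) \<le> M" unfolding M_def d_def Q_def by (rule traj_stability_on[OF x y r])
    have P0: "0 \<le> P" using P[OF r'] by (meson add_nonneg_nonneg norm_ge_zero abs_ge_zero order_trans)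
    have bnd: "R r * (norm (p r - q r) + \<bar>l - k\<bar> + Q * norm (x r - y r)) \<le> R r * (P + Q * M)"
      using P[OF r'] m Q1 by (intro mult_left_mono add_mono Rr) auto
    have hw: "\<bar>H r (x r) (w r) l (p r) - H r (y r) (w r) k (q r)\<bar> \<le> R r * (P + Q * M)"
      by (rule order_trans[OF H_stability[OF r(1) wU tube q1] bnd])
    have hu: "\<bar>H r (x r) (u r) l (p r) - H r (y r) (u r) k (q r)\<bar> \<le> R r * (P + Q * M)"
      by (rule order_trans[OF H_stability[OF r(1) uU tube q1] bnd])
    have "\<bar>H r (y r) (u r) k (q r) - H r (y r) (v r) k (q r)\<bar> \<le> 2 * Q * (if u r = v r then 0 else R r)"
    proof (cases "u r = v r")
      case False
      have one: "\<bar>H r (y r) z k (q r)\<bar> \<le> R r * Q" if z: "z \<in> U r" for z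
      proof -
        have "\<bar>H r (y r) z k (q r)\<bar> \<le> R r * (norm (q r) + \<bar>k\<bar>)" by (rule H_bound[OF r(1) z tube(2)])
        also have "\<dots> \<le> R r * Q" using q1 Rr by (rule mult_left_mono)
        finally show ?thesis .
      qed
      show ?thesis using one[OF uU] one[OF vU] False by (simp add: algebra_simps)
    qed simp
    moreover have "0 \<le> e r" using P0 Q1 M0 Rr by (simp add: e_def)
    ultimately show "G r \<le> G' r + e r"
      using hw hu by (simp add: G_def G'_def e_def abs_le_iff algebra_simps)
  qed
  also have "\<dots> = integral {0..b} G' + integral {0..b} e"
    by (rule integral_add) (auto intro: loc_integrable_on GI eI)
  also have "integral {0..b} e = 2 * (P + Q * M) * integral {0..b} R + 2 * Q * d"
    unfolding e_def d_def control_dist_def integral_mult_right[symmetric]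
    by (intro integral_add loc_integrable_on loc_integrable_mult_const R DI) auto
  finally show ?thesis by (simp add: H_gain_def G_def[abs_def] G'_def[abs_def] M_def Q_def d_def power2_eq_square algebra_simps)
qed

lemma limit_convergence:
  assumes y: "traj v y" and q: "adj v y k q" and k: "0 \<le> k" "norm (q 0) + k \<le> 1"
    and x: "\<And>n. traj (u n) (x n)" and p: "\<And>n. adj (u n) (x n) (l n) (p n)"
    and d: "\<And>b. 0 \<le> b \<Longrightarrow> (\<lambda>n. control_dist (u n) v b) \<longlonglongrightarrow> 0"
    and l: "l \<longlonglongrightarrow> k" and p0: "(\<lambda>n. p n 0) \<longlonglongrightarrow> q 0" and b: "0 \<le> b" and e: "0 < e"
  shows "\<forall>\<^sub>F n in sequentially. \<forall>t\<in>{0..b}. norm (x n t - y t) < e \<and> norm (p n t - q t) < e"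
proof -
  define X where "X n = 2 * control_dist (u n) v b * stability_const b" for n
  define P where "P n = (norm (p n 0 - q 0) +
     (\<bar>l n - k\<bar> + 2 * control_dist (u n) v b * (stability_const b)\<^sup>2) * integral {0..b} R
      + 2 * stability_const b * control_dist (u n) v b) * stability_const b" for n
  have "X \<longlonglongrightarrow> 2 * 0 * stability_const b" unfolding X_def by (intro tendsto_intros d b)
  then have X: "\<forall>\<^sub>F n in sequentially. X n < e" using e by (intro order_tendstoD) auto
  have "P \<longlonglongrightarrow> (norm (q 0 - q 0) + (\<bar>k - k\<bar> + 2 * 0 * (stability_const b)\<^sup>2) * integral {0..b} R
      + 2 * stability_const b * 0) * stability_const b"
    unfolding P_def by (intro tendsto_intros d b l p0)
  then have "\<forall>\<^sub>F n in sequentially. P n < e" using e by (intro order_tendstoD) auto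
  with X show ?thesis
  proof eventually_elim
    case (elim n)
    show ?case
    proof (intro ballI conjI)
      fix t assume "t \<in> {0..b}"
      then have t: "0 \<le> t" "t \<le> b" by auto
      show "norm (x n t - y t) < e" using le_less_trans[OF traj_stability_on[OF x y t] elim(1)[unfolded X_def]] .
      show "norm (p n t - q t) < e" using le_less_trans[OF adj_stability[OF x y p q k t] elim(2)[unfolded P_def]] .
    qed
  qed
qed

text \<open>The approximate inequality for the integrated gain passes to the limit on each test set, and test sets
detect the sign of an integrable function almost everywhere.\<close>

lemma limit_maximum_condition:
  assumes y: "traj v y" and q: "adj v y k q" and k: "0 \<le> k" "norm (q 0) + k \<le> 1"
    and x: "\<And>n. traj (u n) (x n)" and p: "\<And>n. adj (u n) (x n) (l n) (p n)"
    and d: "\<And>b. 0 \<le> b \<Longrightarrow> (\<lambda>n. control_dist (u n) v b) \<longlonglongrightarrow> 0"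
    and l: "l \<longlonglongrightarrow> k" and p0: "(\<lambda>n. p n 0) \<longlonglongrightarrow> q 0"
    and w: "w \<in> selectors U" and \<delta>: "\<delta> \<longlonglongrightarrow> 0"
    and max: "\<And>b A. 0 \<le> b \<Longrightarrow> A \<in> sets borel \<Longrightarrow> \<forall>\<^sub>F n in sequentially.
       H_gain (u n) (x n) (l n) (p n) w A b
       \<le> \<delta> n * integral {0..b} (\<lambda>s. if s \<in> A then R s else 0) + \<delta> n"
  shows "AE t in lebesgue_on {0..}. H t (y t) (w t) k (q t) \<le> H t (y t) (v t) k (q t)"
proof -
  note qq = adjD[OF q]
  have "AE t in lebesgue_on {0..}. H t (y t) (w t) k (q t) - H t (y t) (v t) k (q t) \<le> 0"
  proof (rule AE_nonpos_from_integrals)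
    show "loc_integrable (\<lambda>t. H t (y t) (w t) k (q t) - H t (y t) (v t) k (q t))"
      by (intro loc_integrable_diff H_along_integrable[OF y _ qq(1)] w trajD(1)[OF y])
    fix b :: real and A :: "real set" assume b: "0 \<le> b" and A: "A \<in> sets borel"
    define I where "I = H_gain v y k q w A b"
    have "I \<le> 0 + e" if e: "0 < e" for e
    proof -
      define c where "c = e / (4 * (integral {0..b} R + 1))"
      have pos: "0 < integral {0..b} R + 1" using integral_R_nonneg[of b] by linarith
      have c: "0 < c" using e pos by (simp add: c_def)
      define D where "D n = \<delta> n * integral {0..b} (\<lambda>s. if s \<in> A then R s else 0) + \<delta> n +
        (2 * (c + 2 * control_dist (u n) v b * (stability_const b)\<^sup>2) * integral {0..b} R + 2 * stability_const b * control_dist (u n) v b)" for n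
      have "D \<longlonglongrightarrow> 0 * integral {0..b} (\<lambda>s. if s \<in> A then R s else 0) + 0 +
        (2 * (c + 2 * 0 * (stability_const b)\<^sup>2) * integral {0..b} R + 2 * stability_const b * 0)"
        unfolding D_def by (intro tendsto_intros d b \<delta>)
      moreover have "2 * c * integral {0..b} R < e"
        using e pos integral_R_nonneg[of b] by (simp add: c_def field_simps add_pos_nonneg)
      ultimately have "\<forall>\<^sub>F n in sequentially. D n < e" by (intro order_tendstoD) auto
      moreover have "(\<lambda>n. \<bar>l n - k\<bar>) \<longlonglongrightarrow> \<bar>k - k\<bar>" by (intro tendsto_intros l)
      then have "\<forall>\<^sub>F n in sequentially. \<bar>l n - k\<bar> < c / 2" using c by (intro order_tendstoD) auto
      moreover have "\<forall>\<^sub>F n in sequentially. \<forall>t\<in>{0..b}. norm (x n t - y t) < c / 2 \<and> norm (p n t - q t) < c / 2"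
        using c by (intro limit_convergence[OF y q k x p d l p0 b]) auto
      moreover note max[OF b A]
      ultimately have "\<forall>\<^sub>F n in sequentially. I \<le> e"
      proof eventually_elim
        case (elim n)
        have "I \<le> H_gain (u n) (x n) (l n) (p n) w A b
          + (2 * (c + 2 * control_dist (u n) v b * (stability_const b)\<^sup>2) * integral {0..b} R + 2 * stability_const b * control_dist (u n) v b)"
          unfolding I_def
        proof (rule H_gap_stability[OF x y adjD(1)[OF p] q k w A])
          show "norm (p n t - q t) + \<bar>l n - k\<bar> \<le> c" if "t \<in> {0..b}" for t
            using elim(2) elim(3)[rule_format, OF that] by linarith
        qed
        then show ?case using elim(1,4) by (simp add: D_def)
      qed
      then show ?thesis by (auto simp: eventually_sequentially)
    qed
    then have "I \<le> 0" by (rule field_le_epsilon)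
    then show "integral {0..b} (\<lambda>s. if s \<in> A then H s (y s) (w s) k (q s) - H s (y s) (v s) k (q s) else 0) \<le> 0"
      by (simp add: I_def H_gain_def)
  qed
  then show ?thesis by (rule eventually_mono) simp
qed

lemma H_continuous_control:
  assumes "0 \<le> t" shows "continuous_on (U t) (\<lambda>w. H t x w l p)"
proof -
  have fg: "continuous_on (UNIV \<times> U t) (\<lambda>(y, u). f t y u)" "continuous_on (UNIV \<times> U t) (\<lambda>(y, u). g t y u)"
    using f_cont g_cont assms by (auto simp: caratheodory_def)
  have c: "continuous_on (U t) (\<lambda>w. (x, w))" "(\<lambda>w. (x, w)) ` U t \<subseteq> UNIV \<times> U t" by (auto intro!: continuous_intros)
  have "continuous_on (U t) (\<lambda>w. f t x w)" "continuous_on (U t) (\<lambda>w. g t x w)"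
    using continuous_on_compose2[OF fg(1) c] continuous_on_compose2[OF fg(2) c] by simp_all
  then show ?thesis unfolding hamiltonian_def by (intro continuous_intros)
qed

lemma maximum_condition_closure:
  assumes t: "0 \<le> t" and v: "\<And>n. v n \<in> U t" and p: "w \<in> U t" "w \<in> closure (range v)"
    and le: "\<And>n. H t x (v n) l q \<le> c"
  shows "H t x w l q \<le> c"
proof -
  obtain s where s: "\<And>n. s n \<in> range v" "s \<longlonglongrightarrow> w" using p(2) by (auto simp: closure_sequential)
  have sU: "s n \<in> U t" "H t x (s n) l q \<le> c" for n using s(1)[of n] v le by auto
  have "(\<lambda>n. H t x (s n) l q) \<longlonglongrightarrow> H t x w l q"
    by (rule continuous_on_tendsto_compose[OF H_continuous_control[OF t] s(2) p(1)]) (use sU in auto)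
  then show ?thesis by (rule LIMSEQ_le_const2) (use sU in auto)
qed

end

section \<open>Extremals, generalized extremals and their topology\<close>

text \<open>If the base point of the difference quotients is kept at \<open>x\<close>, their limit is the ordinary directional
derivative, so the upper limit that defines Clarke's directional derivative is at least as large.\<close>

lemma gradient_in_clarke_gradient:
  assumes h: "(h has_derivative (\<lambda>v. z \<bullet> v)) (at x)"
  shows "z \<in> clarke_gradient h x"
  unfolding clarke_gradient_def clarke_dderiv_def
proof (intro CollectI allI)
  fix v
  define \<phi> where "\<phi> s = h (x + s *\<^sub>R v)" for s :: real
  have 1: "((\<lambda>s::real. x + s *\<^sub>R v) has_derivative (\<lambda>s. s *\<^sub>R v)) (at 0)" by (auto intro!: derivative_eq_intros)
  have 2: "(h has_derivative (\<lambda>v. z \<bullet> v)) (at (x + 0 *\<^sub>R v))" using h by simp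
  have "(\<phi> has_real_derivative z \<bullet> v) (at 0)"
    using has_derivative_compose[OF 1 2] by (simp add: \<phi>_def[abs_def] has_field_derivative_def mult_commute_abs)
  then have "((\<lambda>s. (\<phi> (0 + s) - \<phi> 0) / s) \<longlongrightarrow> z \<bullet> v) (at 0)" by (simp add: DERIV_def)
  then have "((\<lambda>s. (\<phi> (0 + s) - \<phi> 0) / s) \<longlongrightarrow> z \<bullet> v) (at_right 0)" by (rule tendsto_mono[OF at_le, rotated]) simp
  then have lim: "((\<lambda>s. ereal ((h (x + s *\<^sub>R v) - h x) / s)) \<longlongrightarrow> ereal (z \<bullet> v)) (at_right 0)"
    by (simp add: \<phi>_def)
  show "ereal (z \<bullet> v) \<le> Limsup (nhds x \<times>\<^sub>F at_right 0) (\<lambda>(y, s). ereal ((h (y + s *\<^sub>R v) - h y) / s))"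
  proof (rule ccontr)
    assume "\<not> ereal (z \<bullet> v) \<le> Limsup (nhds x \<times>\<^sub>F at_right 0) (\<lambda>(y, s). ereal ((h (y + s *\<^sub>R v) - h y) / s))"
    then have "Limsup (nhds x \<times>\<^sub>F at_right 0) (\<lambda>(y, s). ereal ((h (y + s *\<^sub>R v) - h y) / s)) < ereal (z \<bullet> v)"
      by (simp only: not_le)
    from dense[OF this] obtain c where c: "c < ereal (z \<bullet> v)"
      and "Limsup (nhds x \<times>\<^sub>F at_right 0) (\<lambda>(y, s). ereal ((h (y + s *\<^sub>R v) - h y) / s)) < c"
      by blast
    from Limsup_lessD[OF this(2)] have "\<forall>\<^sub>F ys in nhds x \<times>\<^sub>F at_right 0. \<not> c < (case ys of (y, s) \<Rightarrow> ereal ((h (y + s *\<^sub>R v) - h y) / s))"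
      by (auto elim!: eventually_mono)
    then obtain Pf Pg where P: "eventually Pf (nhds x)" "eventually Pg (at_right 0)"
      "\<And>y s. Pf y \<Longrightarrow> Pg s \<Longrightarrow> \<not> c < ereal ((h (y + s *\<^sub>R v) - h y) / s)"
      by (auto simp: eventually_prod_filter)
    have "Pf x" by (rule eventually_nhds_x_imp_x[OF P(1)])
    have "eventually (\<lambda>s. \<not> c < ereal ((h (x + s *\<^sub>R v) - h x) / s)) (at_right 0)"
      by (intro eventually_mono[OF P(2)] P(3)[OF \<open>Pf x\<close>])
    moreover have "eventually (\<lambda>s. c < ereal ((h (x + s *\<^sub>R v) - h x) / s)) (at_right 0)"
      by (rule order_tendstoD(1)[OF lim c])
    ultimately have "eventually (\<lambda>s :: real. False) (at_right 0)" by eventually_elim simp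
    then show False by (simp add: trivial_limit_at_right_real)
  qed
qed

lemma set_integral_return:
  fixes h :: "'u::euclidean_space \<Rightarrow> 'b::euclidean_space"
  assumes "S \<in> sets borel" "p \<in> S" "continuous_on S h"
  shows "(LINT w:S|return borel p. h w) = h p"
proof -
  have "(\<lambda>w. indicator S w *\<^sub>R h w) \<in> borel_measurable borel"
    by (rule borel_measurable_continuous_on_indicator[OF assms(1,3)])
  then show ?thesis
    unfolding set_lebesgue_integral_def using assms(2) by (subst integral_return) auto
qed

text \<open>The constant integrand \<open>c\<close> is a selection outside a set that the Dirac measure does not charge.\<close>

lemma aumann_integral_return:
  fixes F :: "'u::euclidean_space \<Rightarrow> 'x::euclidean_space set"
  assumes S: "S \<in> sets borel" "p \<in> S" and c: "c \<in> F p"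
  shows "c \<in> aumann_integral (restrict_space (return borel p) S) F"
proof -
  let ?M = "restrict_space (return borel p) S"
  interpret p: prob_space "return borel p" by (rule prob_space_return) simp
  have S': "S \<inter> space (return borel p) \<in> sets (return borel p)" using S by simp
  interpret M: finite_measure ?M
    by (rule finite_measure_restrict_space) (use S p.finite_measure_axioms in auto)
  have sp: "space ?M = S" by (simp add: space_restrict_space)
  have em: "emeasure ?M A = indicator A p" if "A \<in> sets borel" "A \<subseteq> S" for A
    using that by (subst emeasure_restrict_space[OF S']) auto
  have "measure ?M S = 1" using em[of S] S by (simp add: measure_def)
  then have "(LINT w|?M. c) = c" by (simp add: sp)
  moreover have "AE w in ?M. c \<in> F w"
  proof (rule AE_I')
    have "S - {p} \<in> sets ?M" using S by (subst sets_restrict_space_iff[OF S']) auto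
    then show "S - {p} \<in> null_sets ?M" using em[of "S - {p}"] S by (auto intro!: null_setsI)
    show "{w \<in> space ?M. c \<notin> F w} \<subseteq> S - {p}" using c by (auto simp: sp)
  qed
  ultimately show ?thesis unfolding aumann_integral_def by (intro CollectI exI[of _ "\<lambda>_. c"]) auto
qed

lemma compact_open_topology_eventually:
  fixes x :: "nat \<Rightarrow> real \<Rightarrow> 'e::metric_space"
  assumes x: "\<And>n. continuous_on {0..} (x n)"
    and lim: "\<And>b e. 0 \<le> b \<Longrightarrow> 0 < e \<Longrightarrow> \<forall>\<^sub>F n in sequentially. \<forall>t\<in>{0..b}. dist (x n t) (y t) < e"
    and S: "openin compact_open_topology S" "y \<in> S"
  shows "\<forall>\<^sub>F n in sequentially. x n \<in> S"
proof -
  have "generate_topology_on {{x. continuous_on {0..} x \<and> x ` K \<subseteq> V} | K V. compact K \<and> K \<subseteq> {0..} \<and> open V} S"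
    using S(1) by (simp add: compact_open_topology_def openin_topology_generated_by_iff)
  then show ?thesis using S(2)
  proof induction
    case (Int a b) then show ?case by (auto intro: eventually_conj)
  next
    case (UN K)
    then obtain k where "k \<in> K" "y \<in> k" by auto
    with UN.IH have "\<forall>\<^sub>F n in sequentially. x n \<in> k" by blast
    then show ?case by (rule eventually_mono) (use \<open>k \<in> K\<close> in auto)
  next
    case (Basis s)
    then obtain K V where s: "s = {x. continuous_on {0..} x \<and> x ` K \<subseteq> V}" and K: "compact K" "K \<subseteq> {0..}" "open V" by auto
    have yc: "continuous_on {0..} y" "y ` K \<subseteq> V" using Basis s by auto
    have "compact (y ` K)" by (rule compact_continuous_image[OF continuous_on_subset[OF yc(1) K(2)] K(1)])
    then obtain e where e: "0 < e" "(\<Union>z\<in>y ` K. ball z e) \<subseteq> V"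
      using compact_subset_open_imp_ball_epsilon_subset K(3) yc(2) by metis
    obtain b where b: "\<And>t. t \<in> K \<Longrightarrow> \<bar>t\<bar> \<le> b" using compact_imp_bounded[OF K(1)] by (auto simp: bounded_iff)
    have "\<forall>\<^sub>F n in sequentially. \<forall>t\<in>{0..max b 0}. dist (x n t) (y t) < e" by (rule lim) (use e in auto)
    then show ?case
    proof (rule eventually_mono)
      fix n assume n: "\<forall>t\<in>{0..max b 0}. dist (x n t) (y t) < e"
      have "x n t \<in> V" if "t \<in> K" for t
      proof -
        have "t \<in> {0..max b 0}" using b[OF that] K(2) that by auto
        then have "x n t \<in> ball (y t) e" using n by (simp add: dist_commute)
        then show ?thesis using e(2) that by blast
      qed
      then show "x n \<in> s" using x by (auto simp: s)
    qed
  qed auto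
qed

lemma indiscrete_topology_member:
  assumes "openin (indiscrete_topology S) W" "a \<in> W" "c \<in> S"
  shows "c \<in> W"
proof -
  have "generate_topology_on {S} W" using assms(1) by (simp add: indiscrete_topology_def openin_topology_generated_by_iff)
  then have "W = {} \<or> W = S" by induction auto
  then show ?thesis using assms by auto
qed

text \<open>A neighborhood in the extremal topology is tested by locally uniform convergence of the two arcs and
convergence of the multiplier; all generalized controls are indistinguishable.\<close>

lemma extremal_topology_eventually:
  fixes x p :: "nat \<Rightarrow> real \<Rightarrow> 'e::euclidean_space"
  assumes S: "openin (extremal_topology Ur) S" "(y, \<eta>, k, q) \<in> S"
    and x: "\<And>n. continuous_on {0..} (x n)" "\<And>n. continuous_on {0..} (p n)"
    and lx: "\<And>b e. 0 \<le> b \<Longrightarrow> 0 < e \<Longrightarrow> \<forall>\<^sub>F n in sequentially. \<forall>t\<in>{0..b}. dist (x n t) (y t) < e"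
    and lp: "\<And>b e. 0 \<le> b \<Longrightarrow> 0 < e \<Longrightarrow> \<forall>\<^sub>F n in sequentially. \<forall>t\<in>{0..b}. dist (p n t) (q t) < e"
    and l: "l \<longlonglongrightarrow> k" "\<And>n. l n \<in> {0..1}" and e: "\<And>n. \<theta> n \<in> gen_controls Ur"
  shows "\<forall>\<^sub>F n in sequentially. (x n, \<theta> n, l n, p n) \<in> S"
proof -
  obtain S1 T1 where 1: "openin compact_open_topology S1" "y \<in> S1" "S1 \<times> T1 \<subseteq> S" "(\<eta>, k, q) \<in> T1"
    "openin (prod_topology (indiscrete_topology (gen_controls Ur)) (prod_topology (top_of_set {0..1}) compact_open_topology)) T1"
    using S unfolding extremal_topology_def openin_prod_topology_alt[of compact_open_topology] by metis
  obtain S2 T2 where 2: "openin (indiscrete_topology (gen_controls Ur)) S2" "\<eta> \<in> S2" "S2 \<times> T2 \<subseteq> T1" "(k, q) \<in> T2"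
    "openin (prod_topology (top_of_set {0..1}) compact_open_topology) T2"
    using 1(4,5) unfolding openin_prod_topology_alt[of "indiscrete_topology (gen_controls Ur)"] by metis
  obtain S3 S4 where 3: "openin (top_of_set {0..1}) S3" "k \<in> S3" "openin compact_open_topology S4" "q \<in> S4" "S3 \<times> S4 \<subseteq> T2"
    using 2(4,5) unfolding openin_prod_topology_alt[of "top_of_set {0..1}"] by metis
  obtain V where V: "open V" "S3 = {0..1} \<inter> V" using 3(1) by (auto simp: openin_open)
  have "\<forall>\<^sub>F n in sequentially. l n \<in> V" using l(1) V 3(2) by (intro topological_tendstoD) auto
  moreover have "\<forall>\<^sub>F n in sequentially. x n \<in> S1" by (rule compact_open_topology_eventually[OF x(1) lx 1(1,2)])
  moreover have "\<forall>\<^sub>F n in sequentially. p n \<in> S4" by (rule compact_open_topology_eventually[OF x(2) lp 3(3,4)])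
  ultimately show ?thesis
  proof eventually_elim
    case (elim n)
    have "\<theta> n \<in> S2" by (rule indiscrete_topology_member[OF 2(1,2) e])
    moreover have "l n \<in> S3" using V l(2) elim by auto
    ultimately show ?case using elim 1(3) 2(3) 3(5) by blast
  qed
qed

lemma cond_u_sigmaD:
  assumes "cond_u_sigma U Ur" "0 \<le> t"
  shows "U t \<in> sets borel" "Ur r t \<in> sets borel" "Ur r t \<subseteq> U t" "U t = (\<Union>r. Ur r t)" "r \<le> s \<Longrightarrow> Ur r t \<subseteq> Ur s t"
proof -
  have all: "\<forall>t\<ge>0. \<exists>C :: nat \<Rightarrow> _ set. (\<forall>i. compact (C i)) \<and> U t = (\<Union>i. C i)"
    "\<forall>r. \<forall>t\<ge>0. Ur r t \<subseteq> Ur (Suc r) t" "\<forall>r. \<forall>t\<ge>0. compact (Ur r t)" "\<forall>t\<ge>0. U t = (\<Union>r. Ur r t)"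
    using assms(1) unfolding cond_u_sigma_def by - (elim conjE, assumption)+
  obtain C :: "nat \<Rightarrow> _ set" where C: "\<And>i. compact (C i)" "U t = (\<Union>i. C i)" using all(1) assms(2) by blast
  then have "(\<Union>i. C i) \<in> sets borel" by (intro sets.countable_UN image_subsetI borel_compact) auto
  then show "U t \<in> sets borel" using C(2) by simp
  show "Ur r t \<in> sets borel" using all(3) assms(2) by (auto intro!: borel_compact)
  show eq: "U t = (\<Union>r. Ur r t)" using all(4) assms(2) by blast
  show "Ur r t \<subseteq> U t" unfolding eq by blast
  show "Ur r t \<subseteq> Ur s t" if "r \<le> s" using that
  proof (induction rule: dec_induct)
    case (step n)
    have "Ur n t \<subseteq> Ur (Suc n) t" using all(2) assms(2) by simp
    then show ?case using step.IH by blast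
  qed simp
qed

lemma dirac_control_gen_controls:
  fixes U :: "real \<Rightarrow> 'u::euclidean_space set"
  assumes us: "cond_u_sigma U Ur" and u: "u \<in> selectors U" and r: "\<And>t. 0 \<le> t \<Longrightarrow> u t \<in> Ur r t"
  shows "dirac_control u \<in> gen_controls Ur"
  unfolding gen_controls_def gen_controls_upto_def dirac_control_def
proof (intro CollectI allI exI[of _ r] conjI ballI impI)
  fix n :: nat and t assume "t \<in> {0..real n}"
  show "prob_space (return borel (u t))" by (rule prob_space_return) simp
  show "sets (return borel (u t)) = sets borel" by simp
next
  fix n :: nat and \<phi> :: "'u \<Rightarrow> real" assume \<phi>: "continuous_on UNIV \<phi> \<and> bounded (range \<phi>)"
  then have m: "\<phi> \<in> borel_measurable borel" by (auto intro: borel_measurable_continuous_onI)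
  have "(\<lambda>t. \<phi> (u t)) \<in> borel_measurable (lebesgue_on {0..real n})"
    by (rule measurable_compose[OF measurable_restrict_mono[OF borel_selector_lebesgue_measurable[OF u]] m]) auto
  moreover have "(\<lambda>t. LINT w|return borel (u t). \<phi> w) = (\<lambda>t. \<phi> (u t))" using m by (simp add: integral_return fun_eq_iff)
  ultimately show "(\<lambda>t. LINT w|return borel (u t). \<phi> w) \<in> borel_measurable (lebesgue_on {0..real n})" by simp
next
  fix n :: nat
  have "measure (return borel (u t)) (Ur r t) = 1" if "t \<in> {0..real n}" for t
    using that r[of t] cond_u_sigmaD(2)[OF us, of t r] by (simp add: measure_return)
  then show "AE t in lebesgue_on {0..real n}. measure (return borel (u t)) (Ur r t) = 1"
    by (intro AE_I2) auto
qed

lemma sup_norm_le: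
  assumes "\<And>t. 0 \<le> t \<Longrightarrow> norm (x t) \<le> c" shows "sup_norm x \<le> ereal c"
  unfolding sup_norm_def by (rule SUP_least) (use assms in auto)

lemma norm_less_sup_norm:
  assumes "sup_norm x < ereal c" "0 \<le> t" shows "norm (x t) < c"
proof -
  have "ereal (norm (x t)) \<le> sup_norm x" unfolding sup_norm_def by (rule SUP_upper) (use assms in simp)
  then show ?thesis using assms(1) by (metis ereal_less_eq(3) leD less_le_trans linorder_not_less less_ereal.simps(1) order.strict_trans1)
qed

lemma liminf_norm_eq_0:
  fixes X :: "nat \<Rightarrow> real"
  assumes nn: "\<And>n. 0 \<le> X n" and small: "\<And>e m. 0 < e \<Longrightarrow> \<exists>n\<ge>m. X n < e"
  shows "liminf (\<lambda>n. ereal (X n)) = 0"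
proof (rule antisym)
  show "0 \<le> liminf (\<lambda>n. ereal (X n))" by (rule Liminf_bounded) (use nn in auto)
  show "liminf (\<lambda>n. ereal (X n)) \<le> 0"
  proof (rule ccontr)
    assume "\<not> liminf (\<lambda>n. ereal (X n)) \<le> 0"
    then have "0 < liminf (\<lambda>n. ereal (X n))" by simp
    then obtain e where e: "0 < ereal e" "ereal e < liminf (\<lambda>n. ereal (X n))"
      using ereal_dense2[of 0] by auto
    then have "\<forall>\<^sub>F n in sequentially. ereal e < ereal (X n)" by (intro less_LiminfD)
    then obtain m where "\<And>n. m \<le> n \<Longrightarrow> e < X n" by (auto simp: eventually_sequentially)
    moreover obtain n where "m \<le> n" "X n < e" using small[of e m] e by auto
    ultimately show False by fastforce
  qed
qed

context control_problem
begin

lemma adj_solution: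
  assumes x: "traj u x" and p: "adj u x l p"
  shows "loc_abs_continuous p"
    and "AE t in lebesgue_on {0..}. (p has_vector_derivative - grad t (x t) (u t) l (p t)) (at t within {0..})"
proof -
  have I: "loc_integrable (\<lambda>t. - grad t (x t) (u t) l (p t))"
    using loc_integrable_diff[OF loc_integrable_const grad_along_integrable[OF x adjD(1)[OF p]], of 0] by simp
  have "p t = p 0 + integral {0..t} (\<lambda>t. - grad t (x t) (u t) l (p t))" if "0 \<le> t" for t
    using adjD(2)[OF p that] unfolding integral_neg by simp
  note * = has_integral_primitive_solution[OF I this]
  show "loc_abs_continuous p" by (rule *(1))
  show "AE t in lebesgue_on {0..}. (p has_vector_derivative - grad t (x t) (u t) l (p t)) (at t within {0..})" by (rule *(2))
qed

lemma grad_in_clarke_gradient: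
  assumes "0 \<le> t" "w \<in> U t"
  shows "grad t x w l p \<in> clarke_gradient (\<lambda>y. H t y w l p) x"
  by (rule gradient_in_clarke_gradient[OF H_has_derivative[OF assms]])

lemma AE_half_line: "AE t in lebesgue_on {0..}. 0 \<le> (t::real)"
  by (subst AE_restrict_space_iff) auto

text \<open>Generalized extremals carry no maximum condition, so an ordinary control with bounded index \<open>r\<close>, its
trajectory and any normalized adjoint arc form one.\<close>

lemma dirac_gen_extremal:
  assumes us: "cond_u_sigma U Ur" and x: "traj u x" and p: "adj u x l p" and r: "\<And>t. 0 \<le> t \<Longrightarrow> u t \<in> Ur r t"
    and l: "0 \<le> l" "l \<le> 1" "norm (p 0) + l = 1"
  shows "(x, dirac_control u, l, p) \<in> gen_extremals U Ur f g"
proof -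
  note xx = trajD[OF x] and pp = adjD[OF p]
  have "AE t in lebesgue_on {0..}.
        (x has_vector_derivative (LINT w:U t|dirac_control u t. f t (x t) w)) (at t within {0..}) \<and>
        (\<exists>d. (p has_vector_derivative d) (at t within {0..}) \<and>
             d \<in> uminus ` aumann_integral (restrict_space (dirac_control u t) (U t))
               (\<lambda>w. clarke_gradient (\<lambda>y. H t y w l (p t)) (x t)))"
    using traj_solution(2)[OF x] adj_solution(2)[OF x p] AE_half_line
  proof eventually_elim
    case (elim t)
    have B: "U t \<in> sets borel" "u t \<in> U t" using cond_u_sigmaD(1)[OF us elim(3)] selectorD[OF xx(1) elim(3)] by auto
    have fc: "continuous_on (UNIV \<times> U t) (\<lambda>(y, u). f t y u)" using f_cont elim(3) by (simp add: caratheodory_def)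
    have "continuous_on (U t) (\<lambda>w. (x t, w))" "(\<lambda>w. (x t, w)) ` U t \<subseteq> UNIV \<times> U t" by (auto intro!: continuous_intros)
    from continuous_on_compose2[OF fc this] have "continuous_on (U t) (\<lambda>w. f t (x t) w)" by simp
    then have "(LINT w:U t|dirac_control u t. f t (x t) w) = f t (x t) (u t)"
      unfolding dirac_control_def by (rule set_integral_return[OF B])
    moreover have "grad t (x t) (u t) l (p t) \<in> aumann_integral (restrict_space (dirac_control u t) (U t))
               (\<lambda>w. clarke_gradient (\<lambda>y. H t y w l (p t)) (x t))"
      unfolding dirac_control_def
      by (rule aumann_integral_return[OF B]) (rule grad_in_clarke_gradient[OF elim(3) B(2)])
    ultimately show ?case using elim(1,2) by (auto intro!: exI[of _ "- grad t (x t) (u t) l (p t)"])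
  qed
  then show ?thesis
    unfolding gen_extremals_def
    using xx pp(1) l traj_solution(1)[OF x] adj_solution(1)[OF x p] dirac_control_gen_controls[OF us xx(1) r] by simp
qed

lemma extremal_if_maximum_condition:
  assumes x: "traj u x" and p: "adj u x l p" and l: "0 \<le> l" "l \<le> 1" "norm (p 0) + l = 1"
    and max: "AE t in lebesgue_on {0..}. \<forall>w\<in>U t. H t (x t) w l (p t) \<le> H t (x t) (u t) l (p t)"
  shows "(x, u, l, p) \<in> extremals U f g"
proof -
  note xx = trajD[OF x] and pp = adjD[OF p]
  have "AE t in lebesgue_on {0..}.
        (x has_vector_derivative f t (x t) (u t)) (at t within {0..}) \<and>
        (\<exists>d. (p has_vector_derivative d) (at t within {0..}) \<and>
             d \<in> uminus ` clarke_gradient (\<lambda>y. H t y (u t) l (p t)) (x t)) \<and>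
        (SUP w\<in>U t. ereal (H t (x t) w l (p t))) = ereal (H t (x t) (u t) l (p t))"
    using traj_solution(2)[OF x] adj_solution(2)[OF x p] AE_half_line max
  proof eventually_elim
    case (elim t)
    have uU: "u t \<in> U t" by (rule selectorD[OF xx(1) elim(3)])
    have "(SUP w\<in>U t. ereal (H t (x t) w l (p t))) = ereal (H t (x t) (u t) l (p t))"
      by (rule antisym) (use elim(4) uU in \<open>auto intro!: SUP_least SUP_upper\<close>)
    then show ?case
      using elim(1,2) grad_in_clarke_gradient[OF elim(3) uU] by (auto intro!: exI[of _ "- grad t (x t) (u t) l (p t)"])
  qed
  then show ?thesis
    unfolding extremals_def using xx pp(1) l traj_solution(1)[OF x] adj_solution(1)[OF x p] by simp
qed

text \<open>The weight has integral zero along \<open>u0\<close>, and it is at most \<open>R\<close> where \<open>u\<close> departs from \<open>u0\<close>.\<close>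

lemma weight_integral_dirac_le:
  assumes us: "cond_u_sigma U Ur" and w: "w \<in> null_weights U Ur u0"
    and wR: "\<And>t v. 0 \<le> t \<Longrightarrow> v \<in> U t \<Longrightarrow> w t v \<le> R t"
    and u: "u \<in> selectors U" and u0: "u0 \<in> selectors U" and t: "0 \<le> t"
  shows "\<bar>weight_integral U w (dirac_control u) t\<bar> \<le> control_dist u u0 t"
proof -
  have w0: "0 \<le> w t v" if "0 \<le> t" for t v using w that by (simp add: null_weights_def)
  have I: "loc_integrable (\<lambda>s. w s (v s))" if v: "v \<in> selectors U" for v
  proof (rule loc_integrable_bounded[OF _ R(1)])
    have "superposition_measurable U (\<lambda>t (_::real) u. w t u)" using w by (simp add: null_weights_def)
    then show "(\<lambda>s. w s (v s)) \<in> borel_measurable (lebesgue_on {0..})" using v by (simp add: superposition_measurable_def)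
  qed (use wR w0 selectorD[OF v] in auto)
  have eq: "weight_integral U w (dirac_control v) t = integral {0..t} (\<lambda>s. w s (v s))"
    if v: "v \<in> selectors U" and t: "0 \<le> t" for v t
  proof -
    have "(LINT z:U s|dirac_control v s. w s z) = w s (v s)" if s: "0 \<le> s" for s
    proof -
      have "caratheodory U (\<lambda>t (_::real) u. w t u)" using w by (simp add: null_weights_def)
      then have c: "continuous_on (UNIV \<times> U s) (\<lambda>(_::real, u). w s u)" using s by (simp add: caratheodory_def)
      have "continuous_on (U s) (\<lambda>z. (0::real, z))" "(\<lambda>z. (0::real, z)) ` U s \<subseteq> UNIV \<times> U s" by (auto intro!: continuous_intros)
      from continuous_on_compose2[OF c this] have "continuous_on (U s) (\<lambda>z. w s z)" by simp
      then show ?thesis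
        unfolding dirac_control_def by (rule set_integral_return[OF cond_u_sigmaD(1)[OF us s] selectorD[OF v s]])
    qed
    then have "weight_integral U w (dirac_control v) t = (LINT s:{0..t}|lebesgue. w s (v s))"
      unfolding weight_integral_def by (intro set_lebesgue_integral_cong) auto
    also have "\<dots> = integral {0..t} (\<lambda>s. w s (v s))"
      by (rule set_lebesgue_integral_eq_integral(2)) (rule loc_integrable_on(1)[OF I[OF v]], simp)
    finally show ?thesis .
  qed
  have z: "integral {0..t} (\<lambda>s. w s (u0 s)) = 0"
    using w t eq[OF u0 t] by (simp add: null_weights_def)
  note DI = control_dist_integrable[OF u u0]
  have "integral {0..t} (\<lambda>s. w s (u s)) \<le> integral {0..t} (\<lambda>s. (if u s = u0 s then 0 else R s) + w s (u0 s))"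
  proof (rule integral_le)
    show "(\<lambda>s. w s (u s)) integrable_on {0..t}" "(\<lambda>s. (if u s = u0 s then 0 else R s) + w s (u0 s)) integrable_on {0..t}"
      by (intro loc_integrable_on loc_integrable_add DI I u u0 order_refl)+
    fix s assume "s \<in> {0..t}"
    then have s: "0 \<le> s" by simp
    show "w s (u s) \<le> (if u s = u0 s then 0 else R s) + w s (u0 s)"
      using wR[OF s selectorD[OF u s]] w0[OF s, of "u0 s"] by auto
  qed
  also have "\<dots> = control_dist u u0 t + integral {0..t} (\<lambda>s. w s (u0 s))"
    unfolding control_dist_def by (rule integral_add) (auto intro!: loc_integrable_on DI I u0)
  finally have "weight_integral U w (dirac_control u) t \<le> control_dist u u0 t" using z eq[OF u t] by simp
  moreover have "0 \<le> weight_integral U w (dirac_control u) t"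
    unfolding eq[OF u t] by (intro integral_nonneg loc_integrable_on I u) (use w0 in auto)
  ultimately show ?thesis by simp
qed

lemma control_dist_stationary:
  assumes u: "u \<in> selectors U" "v \<in> selectors U" and eq: "\<And>t. \<tau> < t \<Longrightarrow> u t = v t" and \<tau>: "0 \<le> \<tau>"
  shows "control_dist u v t \<le> control_dist u v \<tau>"
proof (cases "t \<le> \<tau>")
  case True then show ?thesis by (rule control_dist_mono[OF u])
next
  case False
  note DI = control_dist_integrable[OF u]
  have "integral {\<tau>..t} (\<lambda>s. if u s = v s then 0 else R s) = integral {\<tau>..t} (\<lambda>s. 0)"
    by (rule integral_spike[of "{\<tau>}"]) (use eq in auto)
  then show ?thesis using primitive_diff[OF DI \<tau>, of t] False by (simp add: control_dist_def)
qed

end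

section \<open>Common moduli of the data\<close>

lemma loc_integrable_piecewise:
  fixes M :: "nat \<Rightarrow> real \<Rightarrow> real"
  assumes M: "\<And>k. loc_integrable (M k)" "\<And>k t. 0 \<le> t \<Longrightarrow> 0 \<le> M k t"
  shows "loc_integrable (\<lambda>t. M (nat \<lfloor>t\<rfloor>) t)"
  unfolding loc_integrable_def
proof (intro allI impI)
  fix b :: real assume b: "0 \<le> b"
  show "(\<lambda>t. M (nat \<lfloor>t\<rfloor>) t) absolutely_integrable_on {0..b}"
  proof (rule measurable_bounded_by_integrable_imp_absolutely_integrable)
    have "(\<lambda>t. M (nat \<lfloor>t\<rfloor>) t) \<in> borel_measurable (lebesgue_on {0..})"
    proof (rule measurable_compose_countable[of "\<lambda>i t. M (nat i) t"])
      show "(\<lambda>t. \<lfloor>t\<rfloor>) \<in> lebesgue_on {0::real..} \<rightarrow>\<^sub>M count_space UNIV"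
        by (rule measurable_compose[OF continuous_on_imp_measurable_half_line measurable_real_floor]) (rule continuous_on_id)
    qed (rule loc_integrable_measurable[OF M(1)])
    then show "(\<lambda>t. M (nat \<lfloor>t\<rfloor>) t) \<in> borel_measurable (lebesgue_on {0..b})"
      by (rule measurable_restrict_mono) auto
    show "(\<lambda>t. \<Sum>k\<le>nat \<lfloor>b\<rfloor>. M k t) integrable_on {0..b}"
      by (intro integrable_sum loc_integrable_on M) auto
    fix t assume t: "t \<in> {0..b}"
    then have "nat \<lfloor>t\<rfloor> \<in> {..nat \<lfloor>b\<rfloor>}" by (auto intro: nat_mono floor_mono)
    then have "M (nat \<lfloor>t\<rfloor>) t \<le> (\<Sum>k\<le>nat \<lfloor>b\<rfloor>. M k t)"
      using t M(2) by (intro member_le_sum) auto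
    then show "norm (M (nat \<lfloor>t\<rfloor>) t) \<le> (\<Sum>k\<le>nat \<lfloor>b\<rfloor>. M k t)" using M(2)[of t] t by simp
  qed auto
qed

text \<open>The majorants for the compact sets that cover the time intervals \<open>[k, k + 1]\<close> are glued together.\<close>

lemma majorant_from_compact_slabs:
  fixes Q :: "(real \<times> 'x::euclidean_space) set \<Rightarrow> (real \<Rightarrow> real) \<Rightarrow> bool" and \<rho> :: "real \<Rightarrow> real"
  assumes ex: "\<And>K. compact K \<Longrightarrow> K \<subseteq> {0..} \<times> UNIV \<Longrightarrow> \<exists>M\<in>loc_summable. Q K M"
    and \<rho>: "\<And>b. \<exists>r. \<forall>t\<in>{0..b}. \<rho> t \<le> (r :: real)"
  shows "\<exists>M. loc_integrable M \<and> (\<forall>t\<ge>0. 0 \<le> M t) \<and>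
    (\<forall>t\<ge>0. \<exists>K N. Q K N \<and> M t = N t \<and> (\<forall>x::'x. norm x \<le> \<rho> t \<longrightarrow> (t, x) \<in> K))"
proof -
  obtain r where r: "\<And>b t. t \<in> {0..b} \<Longrightarrow> \<rho> t \<le> r b" using \<rho> by metis
  define K where "K k = {real k..real k + 1} \<times> cball (0::'x) (r (real k + 1))" for k
  have "compact (K k)" "K k \<subseteq> {0..} \<times> UNIV" for k unfolding K_def by (auto intro!: compact_Times)
  then have "\<forall>k. \<exists>N. N \<in> loc_summable \<and> Q (K k) N" using ex by blast
  then obtain N where N: "\<And>k. N k \<in> loc_summable" "\<And>k. Q (K k) (N k)" by metis
  have NI: "loc_integrable (N k)" "\<And>t. 0 \<le> t \<Longrightarrow> 0 \<le> N k t" for k using N(1)[of k] by (auto simp: loc_integrable_summable)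
  have inK: "(t, x) \<in> K (nat \<lfloor>t\<rfloor>)" if "0 \<le> t" "norm x \<le> \<rho> t" for t x
  proof -
    have "real (nat \<lfloor>t\<rfloor>) \<le> t" "t \<le> real (nat \<lfloor>t\<rfloor>) + 1" using that by linarith+
    then show ?thesis using r[of t "real (nat \<lfloor>t\<rfloor>) + 1"] that by (auto simp: K_def)
  qed
  show ?thesis
  proof (intro exI[of _ "\<lambda>t. N (nat \<lfloor>t\<rfloor>) t"] conjI allI impI)
    show "loc_integrable (\<lambda>t. N (nat \<lfloor>t\<rfloor>) t)" by (rule loc_integrable_piecewise[OF NI])
    fix t :: real assume t: "0 \<le> t"
    show "0 \<le> N (nat \<lfloor>t\<rfloor>) t" by (rule NI(2)[OF t])
    show "\<exists>K' N'. Q K' N' \<and> N (nat \<lfloor>t\<rfloor>) t = N' t \<and> (\<forall>x. norm x \<le> \<rho> t \<longrightarrow> (t, x) \<in> K')"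
      by (rule exI[of _ "K (nat \<lfloor>t\<rfloor>)"], rule exI[of _ "N (nat \<lfloor>t\<rfloor>)"]) (simp add: N(2) inK[OF t])
  qed
qed

lemma integrally_bounded_majorant:
  fixes a :: "real \<Rightarrow> 'x::euclidean_space \<Rightarrow> 'u::euclidean_space \<Rightarrow> 'e::real_normed_vector"
  assumes a: "integrally_bounded U a" and \<rho>: "\<And>b. \<exists>r. \<forall>t\<in>{0..b}. \<rho> t \<le> (r :: real)"
  obtains M where "loc_integrable M" "\<And>t. 0 \<le> t \<Longrightarrow> 0 \<le> M t"
    "\<And>t x u. 0 \<le> t \<Longrightarrow> u \<in> U t \<Longrightarrow> norm x \<le> \<rho> t \<Longrightarrow> norm (a t x u) \<le> M t"
proof -
  have "\<exists>M. loc_integrable M \<and> (\<forall>t\<ge>0. 0 \<le> M t) \<and>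
    (\<forall>t\<ge>0. \<exists>K N. (\<forall>(t, x)\<in>K. \<forall>u\<in>U t. norm (a t x u) \<le> N t) \<and> M t = N t \<and> (\<forall>x::'x. norm x \<le> \<rho> t \<longrightarrow> (t, x) \<in> K))"
    by (rule majorant_from_compact_slabs[OF _ \<rho>]) (use a in \<open>auto simp: integrally_bounded_def\<close>)
  then obtain M where M: "loc_integrable M" "\<forall>t\<ge>0. 0 \<le> M t"
    "\<And>t. 0 \<le> t \<Longrightarrow> \<exists>K N. (\<forall>(t, x)\<in>K. \<forall>u\<in>U t. norm (a t x u) \<le> N t) \<and> M t = N t \<and> (\<forall>x::'x. norm x \<le> \<rho> t \<longrightarrow> (t, x) \<in> K)"
    by blast
  have fin: "norm (a t x u) \<le> M t" if t: "0 \<le> t" and u: "u \<in> U t" and x: "norm x \<le> \<rho> t" for t x u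
  proof -
    obtain K N where KN: "\<forall>(t, x)\<in>K. \<forall>u\<in>U t. norm (a t x u) \<le> N t" "M t = N t" "(t, x) \<in> K"
      using M(3)[OF t] x by blast
    then show ?thesis using bspec[OF KN(1,3)] u by simp
  qed
  show ?thesis by (rule that[OF M(1) M(2)[rule_format] fin])
qed

lemma locally_lipschitz_majorant:
  fixes a :: "real \<Rightarrow> 'x::euclidean_space \<Rightarrow> 'u::euclidean_space \<Rightarrow> 'e::real_normed_vector"
  assumes a: "locally_lipschitz U a" and \<rho>: "\<And>b. \<exists>r. \<forall>t\<in>{0..b}. \<rho> t \<le> (r :: real)"
  obtains M where "loc_integrable M" "\<And>t. 0 \<le> t \<Longrightarrow> 0 \<le> M t"
    "\<And>t x y u. 0 \<le> t \<Longrightarrow> u \<in> U t \<Longrightarrow> norm x \<le> \<rho> t \<Longrightarrow> norm y \<le> \<rho> t \<Longrightarrow> norm (a t x u - a t y u) \<le> M t * norm (x - y)"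
proof -
  have "\<exists>M. loc_integrable M \<and> (\<forall>t\<ge>0. 0 \<le> M t) \<and>
    (\<forall>t\<ge>0. \<exists>K N. lipschitz_bound U a K N \<and> M t = N t \<and> (\<forall>x::'x. norm x \<le> \<rho> t \<longrightarrow> (t, x) \<in> K))"
    by (rule majorant_from_compact_slabs[OF _ \<rho>]) (use a in \<open>auto simp: locally_lipschitz_def\<close>)
  then obtain M where M: "loc_integrable M" "\<forall>t\<ge>0. 0 \<le> M t"
    "\<And>t. 0 \<le> t \<Longrightarrow> \<exists>K N. lipschitz_bound U a K N \<and> M t = N t \<and> (\<forall>x::'x. norm x \<le> \<rho> t \<longrightarrow> (t, x) \<in> K)" by blast
  have fin: "norm (a t x u - a t y u) \<le> M t * norm (x - y)"
    if t: "0 \<le> t" and u: "u \<in> U t" and x: "norm x \<le> \<rho> t" and y: "norm y \<le> \<rho> t" for t x y u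
  proof -
    obtain K N where "lipschitz_bound U a K N" "M t = N t" "(t, x) \<in> K" "(t, y) \<in> K"
      using M(3)[OF t] x y by blast
    then show ?thesis using u by (simp add: lipschitz_bound_def)
  qed
  show ?thesis by (rule that[OF M(1) M(2)[rule_format] fin])
qed

lemma tube_radius_bounded:
  assumes "loc_integrable R"
  shows "\<exists>r. \<forall>t\<in>{0..b}. tube_radius R t \<le> r"
proof -
  have "continuous_on {0..b} (\<lambda>t. 0 + integral {0..t} R)"
    by (rule continuous_on_subset[OF continuous_on_primitive[OF assms]]) auto
  then have "continuous_on {0..b} (tube_radius R)" unfolding tube_radius_def[abs_def] by (auto intro!: continuous_intros)
  then have "bounded (tube_radius R ` {0..b})" by (auto intro: compact_imp_bounded compact_continuous_image)
  then obtain r where "\<forall>y\<in>tube_radius R ` {0..b}. norm y \<le> r" unfolding bounded_iff by blast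
  then show ?thesis by (intro exI[of _ r]) (auto simp: abs_le_iff)
qed

text \<open>The tube is determined by the dynamics alone, so the remaining moduli can be collected over the
tube afterwards; the weight is included among them, to be dominated by \<open>R\<close>.\<close>

lemma control_problem_exists:
  fixes U :: "real \<Rightarrow> 'u::euclidean_space set" and f :: "real \<Rightarrow> 'x::euclidean_space \<Rightarrow> 'u \<Rightarrow> 'x"
  assumes fg: "cond_fg U f g" and d: "cond_partial U f g"
    and w: "integrally_bounded U (\<lambda>t (_::real) u. w t u)"
  shows "\<exists>f' g' R0 R. control_problem U f g f' g' R0 R \<and> (\<forall>t\<ge>0. \<forall>u\<in>U t. w t u \<le> (R t :: real))"
proof -
  obtain f' :: "real \<Rightarrow> 'x \<Rightarrow> 'u \<Rightarrow> 'x \<Rightarrow>\<^sub>L 'x" where f': 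
    "\<And>t x u. 0 \<le> t \<Longrightarrow> u \<in> U t \<Longrightarrow> ((\<lambda>y. f t y u) has_derivative blinfun_apply (f' t x u)) (at x)"
    "caratheodory U f'" "locally_lipschitz U f'" "integrally_bounded U f'"
  proof -
    have "regular_derivative U f" using d by (simp add: cond_partial_def)
    then obtain a' :: "real \<Rightarrow> 'x \<Rightarrow> 'u \<Rightarrow> 'x \<Rightarrow>\<^sub>L 'x" where
      a': "\<forall>t\<ge>0. \<forall>x. \<forall>u\<in>U t. ((\<lambda>y. f t y u) has_derivative blinfun_apply (a' t x u)) (at x)"
      and rest: "caratheodory U a'" "locally_lipschitz U a'" "integrally_bounded U a'"
      unfolding regular_derivative_def by (elim exE conjE)
    show ?thesis by (rule that[OF a'[rule_format] rest])
  qed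
  obtain g' :: "real \<Rightarrow> 'x \<Rightarrow> 'u \<Rightarrow> 'x \<Rightarrow>\<^sub>L real" where g': 
    "\<And>t x u. 0 \<le> t \<Longrightarrow> u \<in> U t \<Longrightarrow> ((\<lambda>y. g t y u) has_derivative blinfun_apply (g' t x u)) (at x)"
    "caratheodory U g'" "locally_lipschitz U g'" "integrally_bounded U g'"
  proof -
    have "regular_derivative U g" using d by (simp add: cond_partial_def)
    then obtain a' :: "real \<Rightarrow> 'x \<Rightarrow> 'u \<Rightarrow> 'x \<Rightarrow>\<^sub>L real" where
      a': "\<forall>t\<ge>0. \<forall>x. \<forall>u\<in>U t. ((\<lambda>y. g t y u) has_derivative blinfun_apply (a' t x u)) (at x)"
      and rest: "caratheodory U a'" "locally_lipschitz U a'" "integrally_bounded U a'"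
      unfolding regular_derivative_def by (elim exE conjE)
    show ?thesis by (rule that[OF a'[rule_format] rest])
  qed
  have F: "caratheodory U f" "superposition_measurable U f" "integrally_bounded U f" "continuable U f"
    "caratheodory U g" "superposition_measurable U g" "integrally_bounded U g"
    using fg by (auto simp: cond_fg_def)
  obtain L where L: "L \<in> loc_summable" "\<And>K. compact K \<Longrightarrow> K \<subseteq> {0..} \<times> UNIV \<Longrightarrow> lipschitz_bound U f K L"
    using F(4) unfolding continuable_def by blast
  have Lip: "norm (f t x u - f t y u) \<le> L t * norm (x - y)" if "0 \<le> t" "u \<in> U t" for t x y u
    using L(2)[of "{t} \<times> {x, y}"] that by (auto simp: lipschitz_bound_def intro: compact_Times)
  have zero: "\<exists>r. \<forall>t\<in>{0..b}. (0::real) \<le> r" for b :: real by auto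
  obtain M0 where M0: "loc_integrable M0" "\<And>t. 0 \<le> t \<Longrightarrow> 0 \<le> M0 t" "\<And>t x u. 0 \<le> t \<Longrightarrow> u \<in> U t \<Longrightarrow> norm x \<le> 0 \<Longrightarrow> norm (f t x u) \<le> M0 t"
    by (rule integrally_bounded_majorant[where \<rho>="\<lambda>_. 0", OF F(3) zero]) (rule that)
  define R0 where "R0 t = L t + M0 t" for t
  have R0: "loc_integrable R0" "\<And>t. 0 \<le> t \<Longrightarrow> 0 \<le> L t" "\<And>t. 0 \<le> t \<Longrightarrow> 0 \<le> R0 t"
    unfolding R0_def using L(1) M0(1,2) by (auto simp: loc_integrable_summable intro!: loc_integrable_add add_nonneg_nonneg)
  note \<rho> = tube_radius_bounded[OF R0(1)]
  obtain M1 where M1: "loc_integrable M1" "\<And>t. 0 \<le> t \<Longrightarrow> 0 \<le> M1 t" "\<And>t x u. 0 \<le> t \<Longrightarrow> u \<in> U t \<Longrightarrow> norm x \<le> tube_radius R0 t \<Longrightarrow> norm (f t x u) \<le> M1 t"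
    by (rule integrally_bounded_majorant[OF F(3) \<rho>]) (rule that)
  obtain M2 where M2: "loc_integrable M2" "\<And>t. 0 \<le> t \<Longrightarrow> 0 \<le> M2 t" "\<And>t x u. 0 \<le> t \<Longrightarrow> u \<in> U t \<Longrightarrow> norm x \<le> tube_radius R0 t \<Longrightarrow> norm (g t x u) \<le> M2 t"
    by (rule integrally_bounded_majorant[OF F(7) \<rho>]) (rule that)
  obtain M3 where M3: "loc_integrable M3" "\<And>t. 0 \<le> t \<Longrightarrow> 0 \<le> M3 t" "\<And>t x u. 0 \<le> t \<Longrightarrow> u \<in> U t \<Longrightarrow> norm x \<le> tube_radius R0 t \<Longrightarrow> norm (f' t x u) \<le> M3 t"
    by (rule integrally_bounded_majorant[OF f'(4) \<rho>]) (rule that)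
  obtain M4 where M4: "loc_integrable M4" "\<And>t. 0 \<le> t \<Longrightarrow> 0 \<le> M4 t" "\<And>t x u. 0 \<le> t \<Longrightarrow> u \<in> U t \<Longrightarrow> norm x \<le> tube_radius R0 t \<Longrightarrow> norm (g' t x u) \<le> M4 t"
    by (rule integrally_bounded_majorant[OF g'(4) \<rho>]) (rule that)
  obtain M5 where M5: "loc_integrable M5" "\<And>t. 0 \<le> t \<Longrightarrow> 0 \<le> M5 t" "\<And>t x y u. 0 \<le> t \<Longrightarrow> u \<in> U t \<Longrightarrow> norm x \<le> tube_radius R0 t \<Longrightarrow> norm y \<le> tube_radius R0 t \<Longrightarrow> norm (f' t x u - f' t y u) \<le> M5 t * norm (x - y)"
    by (rule locally_lipschitz_majorant[OF f'(3) \<rho>]) (rule that)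
  obtain M6 where M6: "loc_integrable M6" "\<And>t. 0 \<le> t \<Longrightarrow> 0 \<le> M6 t" "\<And>t x y u. 0 \<le> t \<Longrightarrow> u \<in> U t \<Longrightarrow> norm x \<le> tube_radius R0 t \<Longrightarrow> norm y \<le> tube_radius R0 t \<Longrightarrow> norm (g' t x u - g' t y u) \<le> M6 t * norm (x - y)"
    by (rule locally_lipschitz_majorant[OF g'(3) \<rho>]) (rule that)
  obtain M7 where M7: "loc_integrable M7" "\<And>t. 0 \<le> t \<Longrightarrow> 0 \<le> M7 t" "\<And>t (x::real) u. 0 \<le> t \<Longrightarrow> u \<in> U t \<Longrightarrow> norm x \<le> 0 \<Longrightarrow> norm (w t u) \<le> M7 t"
    by (rule integrally_bounded_majorant[where \<rho>="\<lambda>_. 0", OF w zero]) (rule that)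
  define R where "R t = R0 t + M1 t + M2 t + M3 t + M4 t + M5 t + M6 t + M7 t" for t
  have RI: "loc_integrable R" unfolding R_def
    by (intro loc_integrable_add R0 M1 M2 M3 M4 M5 M6 M7)
  have le: "R0 t \<le> R t" "M1 t \<le> R t" "M2 t \<le> R t" "M3 t \<le> R t" "M4 t \<le> R t" "M5 t \<le> R t" "M6 t \<le> R t" "M7 t \<le> R t" if "0 \<le> t" for t
    unfolding R_def using R0(3)[OF that] M1(2)[OF that] M2(2)[OF that] M3(2)[OF that] M4(2)[OF that] M5(2)[OF that] M6(2)[OF that] M7(2)[OF that]
    by linarith+
  have "control_problem U f g f' g' R0 R"
  proof
    show "norm (f t x u - f t y u) \<le> R0 t * norm (x - y)" if "0 \<le> t" "u \<in> U t" for t x y u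
      by (rule order_trans[OF Lip[OF that] mult_right_mono]) (use M0(2)[OF that(1)] in \<open>simp_all add: R0_def\<close>)
    show "norm (f t 0 u) \<le> R0 t" if "0 \<le> t" "u \<in> U t" for t u
      using M0(3)[OF that, of 0] R0(2)[OF that(1)] by (simp add: R0_def)
    show "norm (f t x u) \<le> R t \<and> \<bar>g t x u\<bar> \<le> R t \<and> norm (f' t x u) \<le> R t \<and> norm (g' t x u) \<le> R t"
      if "0 \<le> t" "u \<in> U t" "norm x \<le> tube_radius R0 t" for t x u
      using M1(3)[OF that] M2(3)[OF that] M3(3)[OF that] M4(3)[OF that] le[OF that(1)] by simp
    show "norm (f' t x u - f' t y u) \<le> R t * norm (x - y) \<and> norm (g' t x u - g' t y u) \<le> R t * norm (x - y)"
      if "0 \<le> t" "u \<in> U t" "norm x \<le> tube_radius R0 t" "norm y \<le> tube_radius R0 t" for t x y u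
      using order_trans[OF M5(3)[OF that] mult_right_mono[OF le(6)[OF that(1)]]]
        order_trans[OF M6(3)[OF that] mult_right_mono[OF le(7)[OF that(1)]]] by simp
  qed (use F f' g' R0 RI le in auto)
  moreover have "w t u \<le> R t" if "0 \<le> t" "u \<in> U t" for t u
    using M7(3)[OF that, of 0] le(8)[OF that(1)] by simp
  ultimately show ?thesis by blast
qed

section \<open>Vanishing of the shadow price\<close>

context control_problem
begin

text \<open>The competitors of \<open>u0\<close> for index \<open>k\<close> take values in \<open>Ur (Suc k)\<close> and return to \<open>u0\<close> after the horizon \<open>\<tau> N\<close>.
The first property makes their Dirac controls generalized controls; owing to the second one, their
distance from \<open>u0\<close> stays bounded by its value at the horizon. The horizon is taken so late that \<open>u0\<close> is optimal up to
the square of the penalty factor.\<close>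

lemma penalized_controls:
  assumes us: "cond_u_sigma U Ur" and u0: "\<forall>t\<ge>0. u0 t \<in> Ur 1 t"
    and opt: "unif_overtaking_optimal U f g x0 u0" and \<tau>: "incseq \<tau>" "\<not> bdd_above (range \<tau>)"
  shows "\<exists>N u x l p. k \<le> N \<and> real k \<le> \<tau> N \<and> traj u x \<and> (\<forall>t\<ge>0. u t \<in> Ur (Suc k) t) \<and>
    (\<forall>t. control_dist u u0 t \<le> 2 / real (Suc k)) \<and> adj u x l p \<and> 0 < l \<and> l \<le> 1 \<and> norm (p 0) + l = 1 \<and> p (\<tau> N) = 0 \<and>
    (\<forall>v\<in>selectors (Ur (Suc k)). \<forall>A\<in>sets borel.
       H_gain u x l p v A (\<tau> N)
       \<le> 1 / real (Suc k) * integral {0..\<tau> N} (\<lambda>s. if s \<in> A then R s else 0) + 1 / real (Suc k))"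
proof -
  define \<delta> where "\<delta> = 1 / real (Suc k)"
  have \<delta>: "0 < \<delta>" by (simp add: \<delta>_def)
  have u0s: "u0 \<in> selectors U" and x0: "traj u0 x0"
    using opt trajectory_traj by (auto simp: unif_overtaking_optimal_def)
  have "0 < \<delta>\<^sup>2" using \<delta> by simp
  have "\<forall>\<epsilon>>0. \<exists>T>0. \<forall>u\<in>selectors U. \<forall>x. trajectory f u x \<longrightarrow> (\<forall>t\<ge>T. payoff g x0 u0 t \<ge> payoff g x u t - \<epsilon>)"
    using opt unfolding unif_overtaking_optimal_def by (elim conjE)
  from this[rule_format, OF \<open>0 < \<delta>\<^sup>2\<close>] obtain T where T: "0 < T" "\<And>u x t. u \<in> selectors U \<Longrightarrow> trajectory f u x \<Longrightarrow> T \<le> t \<Longrightarrow> payoff g x u t - \<delta>\<^sup>2 \<le> payoff g x0 u0 t"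
    by blast
  obtain N0 where N0: "max T (real k) < \<tau> N0"
    using \<tau>(2) unfolding bdd_above_def by (metis not_le rangeE)
  define N where "N = max N0 k"
  have N: "k \<le> N" "max T (real k) < \<tau> N" using N0 incseqD[OF \<tau>(1), of N0 N] by (auto simp: N_def)
  then have \<tau>N: "0 < \<tau> N" "T \<le> \<tau> N" "real k \<le> \<tau> N" using T(1) by auto
  define C where "C = {u \<in> selectors U. (\<forall>t\<ge>0. u t \<in> Ur (Suc k) t) \<and> (\<forall>t>\<tau> N. u t = u0 t)}"
  have CU: "C \<subseteq> selectors U" by (auto simp: C_def)
  have u0C: "u0 \<in> C" using u0s u0 cond_u_sigmaD(5)[OF us, of _ 1 "Suc k"] by (auto simp: C_def)
  have W: "selectors (Ur (Suc k)) \<subseteq> selectors U" using cond_u_sigmaD(3)[OF us] by (fastforce simp: selectors_def)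
  have "\<exists>u x l p. u \<in> C \<and> traj u x \<and> control_dist u u0 (\<tau> N) \<le> 2 * \<delta> \<and> adj u x l p \<and> 0 < l \<and> l \<le> 1 \<and>
     norm (p 0) + l = 1 \<and> p (\<tau> N) = 0 \<and>
     (\<forall>v\<in>selectors (Ur (Suc k)). \<forall>A\<in>sets borel.
        H_gain u x l p v A (\<tau> N)
       \<le> \<delta> * integral {0..\<tau> N} (\<lambda>s. if s \<in> A then R s else 0) + \<delta>)"
  proof (rule near_maximizer_maximum_principle[OF CU u0C x0 _ \<delta> \<tau>N(1) _ W])
    show "payoff g x u (\<tau> N) \<le> payoff g x0 u0 (\<tau> N) + \<delta>\<^sup>2" if "u \<in> C" "traj u x" for u x
      using T(2)[OF _ traj_trajectory[OF that(2)] \<tau>N(2)] that(1) CU by auto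
    show "(\<lambda>t. if t \<in> A then v t else u t) \<in> C"
      if "u \<in> C" "v \<in> selectors (Ur (Suc k))" "A \<in> sets borel" "A \<subseteq> {0..\<tau> N}" for u v A
    proof -
      have "(\<lambda>t. if t \<in> A then v t else u t) \<in> selectors U" using that W CU by (intro selectors_patch) auto
      moreover have "\<forall>t\<ge>0. (if t \<in> A then v t else u t) \<in> Ur (Suc k) t" using that(1,2) by (simp add: C_def selectors_def)
      moreover have "(if t \<in> A then v t else u t) = u0 t" if "\<tau> N < t" for t
      proof -
        have "t \<notin> A" using \<open>A \<subseteq> {0..\<tau> N}\<close> that by auto
        then show ?thesis using \<open>u \<in> C\<close> that by (simp add: C_def)
      qed
      ultimately show ?thesis by (simp add: C_def)
    qed
  qed
  then obtain u x l p where *: "u \<in> C" "traj u x" "control_dist u u0 (\<tau> N) \<le> 2 * \<delta>" "adj u x l p" "0 < l" "l \<le> 1"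
     "norm (p 0) + l = 1" "p (\<tau> N) = 0"
     "\<forall>v\<in>selectors (Ur (Suc k)). \<forall>A\<in>sets borel.
        H_gain u x l p v A (\<tau> N)
       \<le> \<delta> * integral {0..\<tau> N} (\<lambda>s. if s \<in> A then R s else 0) + \<delta>" by blast
  have "control_dist u u0 t \<le> 2 / real (Suc k)" for t
    using control_dist_stationary[of u u0 "\<tau> N" t] *(1,3) u0s \<tau>N(1) by (auto simp: C_def \<delta>_def)
  then have cd: "\<forall>t. control_dist u u0 t \<le> 2 / real (Suc k)" by blast
  have uC: "\<forall>t\<ge>0. u t \<in> Ur (Suc k) t" using *(1) by (simp add: C_def)
  show ?thesis
    unfolding \<delta>_def[symmetric]
    by (intro exI[of _ N] exI[of _ u] exI[of _ x] exI[of _ l] exI[of _ p] conjI N(1) \<tau>N(3) *(2,4-9) cd uC)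
qed

text \<open>A dense sequence of selectors for each of the countably many maps \<open>Ur\<close> leaves one exceptional null set;
outside it the inequality extends to all control values by continuity of the Hamiltonian.\<close>

lemma dense_selectors_maximum_condition:
  assumes us: "cond_u_sigma U Ur" and u0: "\<forall>t\<ge>0. u0 t \<in> Ur 1 t" and u0s: "u0 \<in> selectors U"
    and le: "\<And>j w. w \<in> selectors (Ur j) \<Longrightarrow> AE t in lebesgue_on {0..}. H t (y t) (w t) l (q t) \<le> H t (y t) (u0 t) l (q t)"
  shows "AE t in lebesgue_on {0..}. \<forall>w\<in>U t. H t (y t) w l (q t) \<le> H t (y t) (u0 t) l (q t)"
proof -
  have "\<forall>j. \<exists>v. (\<forall>n::nat. v n \<in> selectors (Ur (Suc j))) \<and>
    (\<exists>N. negligible N \<and> (\<forall>t. 0 \<le> t \<longrightarrow> t \<notin> N \<longrightarrow> Ur (Suc j) t \<subseteq> closure (range (\<lambda>n. v n t))))"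
  proof
    fix j
    have "u0 \<in> selectors (Ur (Suc j))"
      using u0s u0 cond_u_sigmaD(5)[OF us, of _ 1 "Suc j"] by (auto simp: selectors_def)
    moreover have "graph (Ur (Suc j)) \<in> sets borel" using us by (simp add: cond_u_sigma_def)
    ultimately show "\<exists>v. (\<forall>n::nat. v n \<in> selectors (Ur (Suc j))) \<and>
    (\<exists>N. negligible N \<and> (\<forall>t. 0 \<le> t \<longrightarrow> t \<notin> N \<longrightarrow> Ur (Suc j) t \<subseteq> closure (range (\<lambda>n. v n t))))"
      by (intro dense_selectors)
  qed
  then obtain v N where v: "\<And>j n. v j n \<in> selectors (Ur (Suc j))"
    and N: "\<And>j. negligible (N j)" "\<And>j t. 0 \<le> t \<Longrightarrow> t \<notin> N j \<Longrightarrow> Ur (Suc j) t \<subseteq> closure (range (\<lambda>n::nat. v j n t))"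
    by metis
  have "AE t in lebesgue_on {0..}. \<forall>j. t \<notin> N j"
  proof (subst AE_all_countable, intro allI)
    fix j
    have "AE t in lebesgue. t \<notin> N j" using N(1)[of j] by (simp add: negligible_iff_null_sets AE_not_in)
    then show "AE t in lebesgue_on {0..}. t \<notin> N j" by (subst AE_restrict_space_iff) (auto elim: eventually_mono)
  qed
  moreover have "AE t in lebesgue_on {0..}. \<forall>j n. H t (y t) (v j n t) l (q t) \<le> H t (y t) (u0 t) l (q t)"
    unfolding AE_all_countable using le v by blast
  ultimately show ?thesis
    using AE_half_line
  proof eventually_elim
    case (elim t)
    show ?case
    proof
      fix w assume w: "w \<in> U t"
      then obtain r where "w \<in> Ur r t" using cond_u_sigmaD(4)[OF us elim(3)] by blast
      then have wr: "w \<in> Ur (Suc r) t" using cond_u_sigmaD(5)[OF us elim(3), of r "Suc r"] by auto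
      show "H t (y t) w l (q t) \<le> H t (y t) (u0 t) l (q t)"
      proof (rule maximum_condition_closure[OF elim(3), of "\<lambda>n. v r n t"])
        show "v r n t \<in> U t" for n
          using v[of r n] cond_u_sigmaD(3)[OF us elim(3), of "Suc r"] elim(3) by (auto simp: selectors_def)
        show "w \<in> closure (range (\<lambda>n. v r n t))" using N(2)[OF elim(3)] elim(1) wr by blast
      qed (use w elim in auto)
    qed
  qed
qed

text \<open>The normalized initial data of the adjoint arcs of the penalized controls have a convergent
subsequence. Its limit determines an adjoint arc along the optimal pair, which satisfies the maximum
condition. By hypothesis, the approximating arcs, which vanish at their horizons, converge to it
uniformly on the half-line, so its values at the horizons of the subsequence tend to zero.\<close>

theorem vanishing_shadow_price:
  assumes us: "cond_u_sigma U Ur" and u0: "\<forall>t\<ge>0. u0 t \<in> Ur 1 t"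
    and opt: "unif_overtaking_optimal U f g x0 u0"
    and w: "w \<in> null_weights U Ur u0" and wR: "\<forall>t\<ge>0. \<forall>v\<in>U t. w t v \<le> R t"
    and psi: "\<forall>l0 \<psi>0. (x0, u0, l0, \<psi>0) \<in> extremals U f g \<longrightarrow>
        (\<forall>\<epsilon>>0. \<exists>\<delta>>0. \<exists>\<Upsilon>. openin (extremal_topology Ur) \<Upsilon> \<and>
           (x0, dirac_control u0, l0, \<psi>0) \<in> \<Upsilon> \<and>
           (\<forall>(x, \<eta>, l, \<psi>)\<in>\<Upsilon> \<inter> gen_extremals U Ur f g.
              sup_norm (weight_integral U w \<eta>) < ereal \<delta> \<longrightarrow>
              sup_norm (\<lambda>t. \<psi> t - \<psi>0 t) < ereal \<epsilon>))"
    and \<tau>: "\<forall>n. 0 \<le> \<tau> n" "incseq \<tau>" "\<not> bdd_above (range \<tau>)"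
  shows "\<exists>l0 \<psi>0. (x0, u0, l0, \<psi>0) \<in> extremals U f g \<and> liminf (\<lambda>n. ereal (norm (\<psi>0 (\<tau> n)))) = 0"
proof -
  have u0s: "u0 \<in> selectors U" and x0: "traj u0 x0"
    using opt trajectory_traj by (auto simp: unif_overtaking_optimal_def)
  have "\<forall>k. \<exists>N u x l p. k \<le> N \<and> real k \<le> \<tau> N \<and> traj u x \<and> (\<forall>t\<ge>0. u t \<in> Ur (Suc k) t) \<and>
    (\<forall>t. control_dist u u0 t \<le> 2 / real (Suc k)) \<and> adj u x l p \<and> 0 < l \<and> l \<le> 1 \<and> norm (p 0) + l = 1 \<and> p (\<tau> N) = 0 \<and>
    (\<forall>v\<in>selectors (Ur (Suc k)). \<forall>A\<in>sets borel.
       H_gain u x l p v A (\<tau> N)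
       \<le> 1 / real (Suc k) * integral {0..\<tau> N} (\<lambda>s. if s \<in> A then R s else 0) + 1 / real (Suc k))"
    using penalized_controls[OF us u0 opt \<tau>(2,3)] by blast
  then obtain N u x l p where N: "\<And>k. k \<le> N k" "\<And>k. real k \<le> \<tau> (N k)" and x: "\<And>k. traj (u k) (x k)"
    and uUr: "\<And>k t. 0 \<le> t \<Longrightarrow> u k t \<in> Ur (Suc k) t" and d: "\<And>k t. control_dist (u k) u0 t \<le> 2 / real (Suc k)"
    and p: "\<And>k. adj (u k) (x k) (l k) (p k)" and l: "\<And>k. 0 < l k" "\<And>k. l k \<le> 1" "\<And>k. norm (p k 0) + l k = 1"
    and p\<tau>: "\<And>k. p k (\<tau> (N k)) = 0"
    and max: "\<And>k v A. v \<in> selectors (Ur (Suc k)) \<Longrightarrow> A \<in> sets borel \<Longrightarrow>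
       H_gain (u k) (x k) (l k) (p k) v A (\<tau> (N k))
       \<le> 1 / real (Suc k) * integral {0..\<tau> (N k)} (\<lambda>s. if s \<in> A then R s else 0) + 1 / real (Suc k)"
    unfolding choice_iff by blast
  have "(p n 0, l n) \<in> cball 0 1 \<times> {0..1}" for n
  proof -
    have "norm (p n 0) \<le> 1" "0 \<le> l n" "l n \<le> 1" using l(1)[of n] l(2)[of n] l(3)[of n] by linarith+
    then show ?thesis by simp
  qed
  moreover have "compact (cball (0::'x) 1 \<times> {0..1::real})" by (intro compact_Times) auto
  ultimately obtain z r where r: "strict_mono r" and z: "((\<lambda>n. (p n 0, l n)) \<circ> r) \<longlonglongrightarrow> z"
    unfolding compact_eq_seq_compact_metric seq_compact_def by (metis (no_types, lifting))
  define \<xi> where "\<xi> = fst z"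
  define \<mu> where "\<mu> = snd z"
  have lim: "(\<lambda>n. p (r n) 0) \<longlonglongrightarrow> \<xi>" "(\<lambda>n. l (r n)) \<longlonglongrightarrow> \<mu>"
    using tendsto_fst[OF z] tendsto_snd[OF z] by (simp_all add: \<xi>_def \<mu>_def o_def)
  have "(\<lambda>n. norm (p (r n) 0) + l (r n)) \<longlonglongrightarrow> norm \<xi> + \<mu>" by (intro tendsto_intros lim)
  then have n1: "norm \<xi> + \<mu> = 1" using l(3) LIMSEQ_unique[OF _ tendsto_const] by simp
  have \<mu>0: "0 \<le> \<mu>" by (rule LIMSEQ_le_const[OF lim(2)]) (use l(1) in \<open>auto intro: less_imp_le\<close>)
  have \<mu>1: "\<mu> \<le> 1" using n1 norm_ge_zero[of \<xi>] by linarith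
  obtain q where q: "adj u0 x0 \<mu> q" and q0: "q 0 = \<xi>" using adj_exists[OF x0 order_refl, of \<mu> \<xi>] \<mu>0 \<mu>1 by auto
  have nq: "norm (q 0) + \<mu> \<le> 1" using n1 q0 by simp
  have inv: "(\<lambda>n. c / real (Suc (r n))) \<longlonglongrightarrow> 0" for c
    using LIMSEQ_subseq_LIMSEQ[OF tendsto_mult_right_zero[OF LIMSEQ_inverse_real_of_nat, of c] r]
    by (simp add: o_def divide_inverse)
  have d0: "(\<lambda>n. control_dist (u (r n)) u0 b) \<longlonglongrightarrow> 0" for b
  proof (rule tendsto_sandwich[OF _ _ tendsto_const inv[of 2]])
    show "\<forall>\<^sub>F n in sequentially. 0 \<le> control_dist (u (r n)) u0 b"
      by (intro always_eventually allI control_dist_nonneg trajD(1)[OF x] u0s)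
    show "\<forall>\<^sub>F n in sequentially. control_dist (u (r n)) u0 b \<le> 2 / real (Suc (r n))"
      by (intro always_eventually allI d)
  qed
  note conv = limit_convergence[OF x0 q \<mu>0 nq x p d0 lim(2) lim(1)[folded q0]]
  have "AE t in lebesgue_on {0..}. H t (x0 t) (v t) \<mu> (q t) \<le> H t (x0 t) (u0 t) \<mu> (q t)" if v: "v \<in> selectors (Ur j)" for j v
  proof (rule limit_maximum_condition[OF x0 q \<mu>0 nq x p d0 lim(2) lim(1)[folded q0] _ inv[of 1]])
    show "v \<in> selectors U" using v cond_u_sigmaD(3)[OF us] by (fastforce simp: selectors_def)
    fix b :: real and A :: "real set" assume b: "0 \<le> b" and A: "A \<in> sets borel"
    obtain m where m: "max b (real j) \<le> real m" using real_arch_simple by blast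
    show "\<forall>\<^sub>F n in sequentially.
       H_gain (u (r n)) (x (r n)) (l (r n)) (p (r n)) v A b
       \<le> 1 / real (Suc (r n)) * integral {0..b} (\<lambda>s. if s \<in> A then R s else 0) + 1 / real (Suc (r n))"
    proof (rule eventually_sequentiallyI[of m])
      fix n assume "m \<le> n"
      then have mr: "m \<le> r n" using seq_suble[OF r, of n] by simp
      then have "v \<in> selectors (Ur (Suc (r n)))"
        using v m cond_u_sigmaD(5)[OF us, of _ j "Suc (r n)"] by (fastforce simp: selectors_def)
      note mx = max[OF this, of "{0..b} \<inter> A"]
      have "b \<le> \<tau> (N (r n))" using N(2)[of "r n"] mr m by simp
      then have sub: "{0..b} \<inter> {0..\<tau> (N (r n))} = {0..b}" by auto
      have cut: "integral {0..\<tau> (N (r n))} (\<lambda>s. if s \<in> {0..b} \<inter> A then \<phi> s else 0) = integral {0..b} (\<lambda>s. if s \<in> A then \<phi> s else 0)"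
        for \<phi> :: "real \<Rightarrow> real"
      proof -
        have "(\<lambda>s. if s \<in> {0..b} \<inter> A then \<phi> s else 0) = (\<lambda>s. if s \<in> {0..b} then (if s \<in> A then \<phi> s else 0) else 0)" by auto
        then show ?thesis by (simp only: integral_restrict_Int sub)
      qed
      show "H_gain (u (r n)) (x (r n)) (l (r n)) (p (r n)) v A b
       \<le> 1 / real (Suc (r n)) * integral {0..b} (\<lambda>s. if s \<in> A then R s else 0) + 1 / real (Suc (r n))"
        using mx[unfolded H_gain_def cut] A by (simp add: H_gain_def sets.Int)
    qed
  qed
  then have "AE t in lebesgue_on {0..}. \<forall>w\<in>U t. H t (x0 t) w \<mu> (q t) \<le> H t (x0 t) (u0 t) \<mu> (q t)"
    by (rule dense_selectors_maximum_condition[OF us u0 u0s])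
  then have ext: "(x0, u0, \<mu>, q) \<in> extremals U f g"
    using n1 q0 by (intro extremal_if_maximum_condition[OF x0 q \<mu>0 \<mu>1]) auto
  have "liminf (\<lambda>n. ereal (norm (q (\<tau> n)))) = 0"
  proof (rule liminf_norm_eq_0)
    fix e :: real and m :: nat assume e: "0 < e"
    obtain \<delta> S where \<delta>: "0 < \<delta>" and S: "openin (extremal_topology Ur) S" "(x0, dirac_control u0, \<mu>, q) \<in> S"
      and close: "\<forall>(x, \<eta>, l, \<psi>)\<in>S \<inter> gen_extremals U Ur f g.
              sup_norm (weight_integral U w \<eta>) < ereal \<delta> \<longrightarrow> sup_norm (\<lambda>t. \<psi> t - q t) < ereal e"
      using psi[rule_format, OF ext e] by (elim exE conjE)
    have "\<forall>\<^sub>F n in sequentially. (x (r n), dirac_control (u (r n)), l (r n), p (r n)) \<in> S"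
    proof (rule extremal_topology_eventually[OF S])
      show "continuous_on {0..} (x (r n))" "continuous_on {0..} (p (r n))" for n
        by (rule trajD(2)[OF x], rule adjD(1)[OF p])
      show "\<forall>\<^sub>F n in sequentially. \<forall>t\<in>{0..b}. dist (x (r n) t) (x0 t) < e'"
        "\<forall>\<^sub>F n in sequentially. \<forall>t\<in>{0..b}. dist (p (r n) t) (q t) < e'" if "0 \<le> b" "0 < e'" for b e'
        using conv[OF that] by (auto elim: eventually_mono simp: dist_norm)
      show "l (r n) \<in> {0..1}" for n using l(1,2)[of "r n"] by simp
      show "dirac_control (u (r n)) \<in> gen_controls Ur" for n
        by (rule dirac_control_gen_controls[OF us trajD(1)[OF x] uUr])
    qed (rule lim)
    moreover have "\<forall>\<^sub>F n in sequentially. 2 / real (Suc (r n)) < \<delta>" using inv[of 2] \<delta> by (intro order_tendstoD) auto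
    ultimately have "\<forall>\<^sub>F n in sequentially. m \<le> n \<and> (x (r n), dirac_control (u (r n)), l (r n), p (r n)) \<in> S \<and> 2 / real (Suc (r n)) < \<delta>"
      using eventually_ge_at_top[of m] by eventually_elim simp
    then obtain n where n: "m \<le> n" "(x (r n), dirac_control (u (r n)), l (r n), p (r n)) \<in> S" "2 / real (Suc (r n)) < \<delta>"
      by (auto simp: eventually_sequentially)
    have "(x (r n), dirac_control (u (r n)), l (r n), p (r n)) \<in> gen_extremals U Ur f g"
      using l[of "r n"] by (intro dirac_gen_extremal[OF us x p uUr]) auto
    moreover have "sup_norm (weight_integral U w (dirac_control (u (r n)))) < ereal \<delta>"
    proof -
      have "norm (weight_integral U w (dirac_control (u (r n))) t) \<le> 2 / real (Suc (r n))" if t: "0 \<le> t" for t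
        using weight_integral_dirac_le[OF us w _ trajD(1)[OF x] u0s t, of "r n"] wR d[of "r n" t] by force
      then have "sup_norm (weight_integral U w (dirac_control (u (r n)))) \<le> ereal (2 / real (Suc (r n)))" by (rule sup_norm_le)
      also have "\<dots> < ereal \<delta>" using n(3) by simp
      finally show ?thesis .
    qed
    ultimately have "sup_norm (\<lambda>t. p (r n) t - q t) < ereal e" using close n(2) by blast
    then have "norm (p (r n) (\<tau> (N (r n))) - q (\<tau> (N (r n)))) < e" using norm_less_sup_norm[of "\<lambda>t. p (r n) t - q t" e "\<tau> (N (r n))"] \<tau>(1) by simp
    then have "norm (q (\<tau> (N (r n)))) < e" using p\<tau> by simp
    moreover have "m \<le> N (r n)" using n(1) seq_suble[OF r, of n] N(1)[of "r n"] by linarith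
    ultimately show "\<exists>n\<ge>m. norm (q (\<tau> n)) < e" by blast
  qed simp
  then show ?thesis using ext by blast
qed

end

theorem proposition9:
  fixes U :: "real \<Rightarrow> 'u::euclidean_space set"
    and Ur :: "nat \<Rightarrow> real \<Rightarrow> 'u set"
    and f :: "real \<Rightarrow> real ^ 'm \<Rightarrow> 'u \<Rightarrow> real ^ 'm"
    and g :: "real \<Rightarrow> real ^ 'm \<Rightarrow> 'u \<Rightarrow> real"
    and x0 :: "real \<Rightarrow> real ^ 'm"
    and u0 :: "real \<Rightarrow> 'u"
    and \<tau> :: "nat \<Rightarrow> real"
  assumes "cond_u_sigma U Ur"
    and "\<forall>t\<ge>0. u0 t \<in> Ur 1 t"
    and "cond_fg U f g"
    and "cond_partial U f g"
    and "continuous_on {0..} x0" and "u0 \<in> selectors U"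
    and "unif_overtaking_optimal U f g x0 u0"
    and "cond_psi U Ur f g x0 u0"
    and "\<forall>n. 0 \<le> \<tau> n" and "incseq \<tau>" and "\<not> bdd_above (range \<tau>)"
  shows "\<exists>l0 \<psi>0. (x0, u0, l0, \<psi>0) \<in> extremals U f g \<and>
           liminf (\<lambda>n. ereal (norm (\<psi>0 (\<tau> n)))) = 0"
proof -
  obtain w where w: "w \<in> null_weights U Ur u0" and psi: "\<forall>l0 \<psi>0. (x0, u0, l0, \<psi>0) \<in> extremals U f g \<longrightarrow>
        (\<forall>\<epsilon>>0. \<exists>\<delta>>0. \<exists>\<Upsilon>. openin (extremal_topology Ur) \<Upsilon> \<and>
           (x0, dirac_control u0, l0, \<psi>0) \<in> \<Upsilon> \<and>
           (\<forall>(x, \<eta>, l, \<psi>)\<in>\<Upsilon> \<inter> gen_extremals U Ur f g.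
              sup_norm (weight_integral U w \<eta>) < ereal \<delta> \<longrightarrow>
              sup_norm (\<lambda>t. \<psi> t - \<psi>0 t) < ereal \<epsilon>))"
    using assms(8) unfolding cond_psi_def by blast
  have "integrally_bounded U (\<lambda>t (_::real) u. w t u)" using w by (simp add: null_weights_def)
  then obtain f' g' R0 R where cp: "control_problem U f g f' g' R0 R" and wR: "\<forall>t\<ge>0. \<forall>u\<in>U t. w t u \<le> R t"
    using control_problem_exists[OF assms(3,4)] by blast
  show ?thesis
    by (rule control_problem.vanishing_shadow_price[OF cp assms(1,2,7) w wR psi assms(9-11)])
qed

end
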